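(* For every $0 < \alpha < 2$ there exist $\varepsilon = \varepsilon(\alpha) > 0$ and $c = c(\alpha) > 0$ such that the following holds. Let $p$ be a prime with $p \equiv 3 \pmod 4$, let $F := \mathbf{Z}/p\mathbf{Z}$, and let $P \subseteq F^2$ have cardinality $|P| = N = |F|^\alpha$. Then $$|\Delta(P)| \geq c N^{1/2+\varepsilon}.$$
   Context: For points $(x_1,y_1),(x_2,y_2) \in F^2$ define $d((x_1,y_1),(x_2,y_2)) := (x_1-x_2)^2 + (y_1-y_2)^2 \in F$, and for $P \subseteq F^2$ define the distance set $\Delta(P) := \{d(p,p') : p, p' \in P\} \subseteq F$. *)

theory Defs
  imports Complex_Main "HOL-Number_Theory.Residues"
begin

definition plane_dist :: "('a, 'm) ring_scheme \<Rightarrow> 'a \<times> 'a \<Rightarrow> 'a \<times> 'a \<Rightarrow> 'a" where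
  "plane_dist F u v =
     (fst u \<ominus>\<^bsub>F\<^esub> fst v) [^]\<^bsub>F\<^esub> (2::nat) \<oplus>\<^bsub>F\<^esub> (snd u \<ominus>\<^bsub>F\<^esub> snd v) [^]\<^bsub>F\<^esub> (2::nat)"

definition distance_set :: "('a, 'm) ring_scheme \<Rightarrow> ('a \<times> 'a) set \<Rightarrow> 'a set" where
  "distance_set F P = {plane_dist F u v | u v. u \<in> P \<and> v \<in> P}"

end

theory Submission
  imports Defs "HOL-Library.Set_Algebras"
begin

text \<open>
  Suppose that \<open>P\<close> has \<open>N\<close> points and few distances. Then there are many isosceles triangles with apex in
  \<open>P\<close>, hence a point \<open>u\<close> of \<open>P\<close> such that the \<open>N\<close> perpendicular bisectors of \<open>u\<close> and the other points of
  \<open>P\<close> have almost $N^{3/2}$ incidences with \<open>P\<close>. Here $-1$ being a nonresidue makes bisectors genuine and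
  distinct lines.

  For $\alpha > 1$ this contradicts the second moment bound for point-line incidences. For
  $\alpha \le 1$ it contradicts an incidence theorem of Szemeredi-Trotter type. To prove the latter, one finds
  two points whose pencils of lines cover much of \<open>P\<close> by a small grid, and a projective map
  turns rich lines into many solutions of $\lambda x + y \in C_\lambda$ with $x, y$ in a set \<open>B\<close>, for many
  $\lambda$. By the Balog-Szemeredi-Gowers argument there are then an approximate group \<open>H\<close> and many
  $\lambda$ such that few translates of \<open>H\<close> cover $\lambda H$. The set of such dilators is essentially closed
  under the field operations. As the prime field has no proper subfield, repeatedly passing from \<open>L\<close> to
  \<open>L + (r + 1) L\<close> with a quotient of differences \<open>r\<close> such that \<open>r + 1\<close> is not one makes the set of dilators
  grow until it is the whole field, which contradicts the average size of \<open>H + r H\<close>.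

  Losses are recorded as powers of one parameter \<open>K\<close>, whose exponents are not optimised.
\<close>

section \<open>Counting and covering\<close>

text \<open>N points and N lines have at most about N^(3/2) incidences for trivial reasons, so only
  a saving by a power contradicts the isosceles triangles. The second moment gives one when N
  exceeds |F| by a power; below |F| the plane over a proper subfield would attain the trivial order,
  so primality has to enter. Three points of a line with pencil coordinates x1, x2, x in the
  direction \<open>a\<close> have second coordinates related by interpolation, (x2 - x) y1 + (x -
  x1) y2 = (x2 - x1) y. With x1 and x2 fixed, division by x - x1 gives l y1 + y2 in (l + 1) B, with
  one l for each x. Balog-Szemeredi-Gowers yields different sets for different l; choosing one l0
  whose sets largely meet those of many l lets a single H serve all of them. A growth round squares
  the number of dilators, so the number of rounds, and with it the exponent of K, depends on
  \<alpha> alone. At the end some r has |H + r H| of order min(|F|, |H|^2), which forces |H| to be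
  tiny or almost |F|; neither fits the scale sqrt N.\<close>

definition dset :: "'a::ab_group_add set \<Rightarrow> 'a set \<Rightarrow> 'a set" where
  "dset A B = (\<lambda>(a, b). a - b) ` (A \<times> B)"

lemma dset_iff: "x \<in> dset A B \<longleftrightarrow> (\<exists>a\<in>A. \<exists>b\<in>B. x = a - b)"
  by (auto simp: dset_def)

lemma dset_diffI: "a \<in> A \<Longrightarrow> b \<in> B \<Longrightarrow> a - b \<in> dset A B"
  by (auto simp: dset_def)

lemma dset_mono: "A \<subseteq> A' \<Longrightarrow> B \<subseteq> B' \<Longrightarrow> dset A B \<subseteq> dset A' B'"
  by (auto simp: dset_def)

lemma finite_dset [simp]: "finite A \<Longrightarrow> finite B \<Longrightarrow> finite (dset A B)"
  by (auto simp: dset_def)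

lemma card_dset_le: "finite A \<Longrightarrow> finite B \<Longrightarrow> card (dset A B) \<le> card A * card B"
  unfolding dset_def using card_image_le[of "A \<times> B"] by (metis card_cartesian_product finite_SigmaI)

lemma card_sumset_le:
  fixes A B :: "'a::ab_group_add set"
  assumes "finite A" "finite B"
  shows "card (A + B) \<le> card A * card B"
  using card_image_le[of "A \<times> B" "\<lambda>(x, y). x + y"] assms
  by (simp add: set_plus_image card_cartesian_product)

text \<open>A pairwise disjoint subfamily of maximum size works: disjointness inside
  \<open>C\<close> bounds its number of members, and a set \<open>Z i\<close> missing all of them
  could be added. This is the principle behind both \<open>ruzsa_cover\<close> and
  \<open>bsg_cover\<close>.\<close>

lemma greedy_cover:
  fixes m :: real
  assumes fin: "finite I" "finite C" and Z: "\<And>i. i \<in> I \<Longrightarrow> Z i \<subseteq> C"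
    and m: "\<And>i. i \<in> I \<Longrightarrow> m \<le> card (Z i)" "0 < m"
  shows "\<exists>X\<subseteq>I. card X * m \<le> card C \<and> (\<forall>i\<in>I. \<exists>x\<in>X. Z i \<inter> Z x \<noteq> {})"
proof -
  define D where "D = {X. X \<subseteq> I \<and> (\<forall>x\<in>X. \<forall>y\<in>X. x \<noteq> y \<longrightarrow> Z x \<inter> Z y = {})}"
  have finD: "finite D" unfolding D_def using fin by simp
  have "{} \<in> D" unfolding D_def by simp
  then obtain X where X: "X \<in> D" and max: "\<And>Y. Y \<in> D \<Longrightarrow> card Y \<le> card X"
  proof -
    have "Max (card ` D) \<in> card ` D" using finD \<open>{} \<in> D\<close> by (intro Max_in) auto
    then obtain X where "X \<in> D" "card X = Max (card ` D)" by auto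
    moreover have "card Y \<le> Max (card ` D)" if "Y \<in> D" for Y using that finD by simp
    ultimately show ?thesis using that by metis
  qed
  have XI: "X \<subseteq> I" and disj: "\<And>x y. x \<in> X \<Longrightarrow> y \<in> X \<Longrightarrow> x \<noteq> y \<Longrightarrow> Z x \<inter> Z y = {}"
    using X unfolding D_def by auto
  have finX: "finite X" using XI fin finite_subset by blast
  have finZ: "finite (Z i)" if "i \<in> I" for i using Z[OF that] fin finite_subset by blast
  have "card X * m \<le> (\<Sum>x\<in>X. real (card (Z x)))"
    using sum_mono[of X "\<lambda>_. m" "\<lambda>x. real (card (Z x))"] m XI by (auto simp: mult.commute)
  also have "\<dots> = real (card (\<Union>x\<in>X. Z x))"
    by (subst card_UN_disjoint) (use finX finZ XI disj in auto)
  also have "\<dots> \<le> card C" using Z XI fin by (intro of_nat_mono card_mono) auto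
  finally have 1: "card X * m \<le> card C" .
  have "\<exists>x\<in>X. Z i \<inter> Z x \<noteq> {}" if i: "i \<in> I" for i
  proof (rule ccontr)
    assume "\<not> ?thesis"
    then have no: "\<And>x. x \<in> X \<Longrightarrow> Z i \<inter> Z x = {}" by blast
    have "Z i \<noteq> {}" using m i by (metis card.empty of_nat_0 not_less)
    then have "i \<notin> X" using no by auto
    moreover have "insert i X \<in> D" unfolding D_def using XI i disj no by (auto simp: Int_commute)
    ultimately show False using max[of "insert i X"] finX by simp
  qed
  then show ?thesis using 1 XI by blast
qed

text \<open>Ruzsa's covering lemma, from a maximal disjoint family of translates x + V: if u + V
  meets x + V, then u lies in x + (V - V).\<close>

lemma ruzsa_cover:
  fixes U V :: "'a::ab_group_add set"
  assumes fin: "finite U" "finite V" "V \<noteq> {}"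
  shows "\<exists>X\<subseteq>U. card X * card V \<le> card (U + V) \<and> U \<subseteq> X + dset V V"
proof -
  have "\<exists>X\<subseteq>U. real (card X) * real (card V) \<le> real (card (U + V)) \<and>
      (\<forall>i\<in>U. \<exists>x\<in>X. (+) i ` V \<inter> (+) x ` V \<noteq> {})"
    by (rule greedy_cover) (use fin in \<open>auto simp: card_image finite_set_plus card_gt_0_iff\<close>)
  then obtain X where X: "X \<subseteq> U" "real (card X) * real (card V) \<le> real (card (U + V))"
    and hit: "\<And>i. i \<in> U \<Longrightarrow> \<exists>x\<in>X. (+) i ` V \<inter> (+) x ` V \<noteq> {}" by blast
  have "u \<in> X + dset V V" if "u \<in> U" for u
  proof -
    from hit[OF that] obtain x v v' where h: "x \<in> X" "v \<in> V" "v' \<in> V" "u + v = x + v'"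
      by (auto simp: set_eq_iff)
    then have "u = x + (v' - v)" by (simp add: algebra_simps)
    moreover have "v' - v \<in> dset V V" using h by (intro dset_diffI)
    ultimately show ?thesis using h(1) by (simp add: set_plus_intro)
  qed
  moreover have "card X * card V \<le> card (U + V)" using X(2) by (simp flip: of_nat_mult)
  ultimately show ?thesis using X(1) by blast
qed

lemma pigeonhole_sum:
  fixes f :: "'b \<Rightarrow> real" and c :: real
  assumes "finite A" "A \<noteq> {}" "card A * c \<le> sum f A"
  shows "\<exists>x\<in>A. c \<le> f x"
proof (rule ccontr)
  assume "\<not> ?thesis"
  then have "\<And>x. x \<in> A \<Longrightarrow> f x < c" by auto
  then have "sum f A < (\<Sum>x\<in>A. c)" using assms by (intro sum_strict_mono) auto
  then show False using assms by (simp add: mult.commute)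
qed

lemma card_Sigma_sum:
  assumes "finite A" "finite B" "E \<subseteq> A \<times> B"
  shows "card E = (\<Sum>a\<in>A. card {b. (a, b) \<in> E})"
    and "card E = (\<Sum>b\<in>B. card {a. (a, b) \<in> E})"
proof -
  have finE: "finite E" using assms finite_subset by (metis finite_SigmaI)
  have f1: "finite {b. (a, b) \<in> E}" for a
    by (rule finite_subset[of _ B]) (use assms in auto)
  have f2: "finite {a. (a, b) \<in> E}" for b
    by (rule finite_subset[of _ A]) (use assms in auto)
  have "E = Sigma A (\<lambda>a. {b. (a, b) \<in> E})" using assms by auto
  then show "card E = (\<Sum>a\<in>A. card {b. (a, b) \<in> E})"
    using card_SigmaI[of A "\<lambda>a. {b. (a, b) \<in> E}"] assms f1 by simp
  have "prod.swap ` E = Sigma B (\<lambda>b. {a. (a, b) \<in> E})"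
    using assms by force
  then show "card E = (\<Sum>b\<in>B. card {a. (a, b) \<in> E})"
    using card_SigmaI[of B "\<lambda>b. {a. (a, b) \<in> E}"] assms f2 card_image[of prod.swap E] by simp
qed

text \<open>Terms below the threshold \<open>c\<close> contribute at most \<open>card A * c\<close>,
  hence at most half of the total. All later prunings to popular elements rest on this.\<close>

lemma popular_sum:
  fixes f :: "'b \<Rightarrow> real" and c :: real
  assumes fin: "finite A" and S: "S \<le> sum f A" and c: "card A * c \<le> S / 2"  and nn: "0 \<le> c"
  shows "S / 2 \<le> sum f {x\<in>A. c \<le> f x}"
proof -
  have "sum f A \<le> (\<Sum>x\<in>A. (if c \<le> f x then f x else 0) + c)" using nn by (intro sum_mono) auto
  also have "\<dots> = sum f {x\<in>A. c \<le> f x} + card A * c"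
    using fin by (simp add: sum.distrib sum.inter_filter)
  finally show ?thesis using S c by simp
qed

text \<open>Values with many representations are few, because their fibres are disjoint subsets of
  \<open>U\<close>.\<close>

lemma card_fibres_le:
  fixes m :: real
  assumes fin: "finite Y" "finite U" and m: "\<And>y. y \<in> Y \<Longrightarrow> m \<le> card {u\<in>U. f u = y}"
  shows "card Y * m \<le> card U"
proof -
  have "card Y * m \<le> (\<Sum>y\<in>Y. real (card {u\<in>U. f u = y}))"
    using sum_mono[of Y "\<lambda>_. m"] m by auto
  also have "\<dots> = card (\<Union>y\<in>Y. {u\<in>U. f u = y})"
    using fin by (subst card_UN_disjoint) auto
  also have "\<dots> \<le> card U" using fin by (intro of_nat_mono card_mono) auto
  finally show ?thesis .
qed

text \<open>Cauchy-Schwarz against a constant, obtained by expanding the squared deviations from the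
  mean, scaled by \<open>card A\<close>.\<close>

lemma sum_square_ge:
  fixes f :: "'b \<Rightarrow> real"
  shows "(sum f A)\<^sup>2 \<le> card A * (\<Sum>x\<in>A. (f x)\<^sup>2)"
  proof (cases "card A = 0")
  case False
  have "0 \<le> (\<Sum>x\<in>A. (card A * f x - sum f A)\<^sup>2)" by (intro sum_nonneg) auto
  also have "\<dots> = card A * (card A * (\<Sum>x\<in>A. (f x)\<^sup>2)) - card A * (sum f A)\<^sup>2"
    by (simp add: power2_diff sum.distrib sum_subtractf power_mult_distrib algebra_simps
        flip: sum_distrib_left sum_distrib_right) (simp add: power2_eq_square algebra_simps)
  finally have "card A * (sum f A)\<^sup>2 \<le> card A * (card A * (\<Sum>x\<in>A. (f x)\<^sup>2))" by simp
  then show ?thesis using False by simp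
qed (auto simp: card_eq_0_iff)

text \<open>Cauchy-Schwarz over the fibres of \<open>f\<close>: few values force many pairs of equal
  value. It serves for distances from an apex and for the sums x + r y.\<close>

lemma card_collisions_ge:
  assumes "finite D"
  shows "(real (card D))\<^sup>2 \<le> card (f ` D) * card {(x, y). x \<in> D \<and> y \<in> D \<and> f x = f y}"
proof -
  have 1: "card D = (\<Sum>z\<in>f ` D. card {x\<in>D. f x = z})"
    using sum.image_gen[OF assms, of "\<lambda>_. 1::nat" f] by simp
  have "{(x, y). x \<in> D \<and> y \<in> D \<and> f x = f y} = (\<Union>z\<in>f ` D. {x\<in>D. f x = z} \<times> {x\<in>D. f x = z})" by auto
  moreover have "card \<dots> = (\<Sum>z\<in>f ` D. card ({x\<in>D. f x = z} \<times> {x\<in>D. f x = z}))"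
    by (intro card_UN_disjoint) (use assms in auto)
  ultimately have 2: "card {(x, y). x \<in> D \<and> y \<in> D \<and> f x = f y} = (\<Sum>z\<in>f ` D. (card {x\<in>D. f x = z})\<^sup>2)"
    by (simp only: card_cartesian_product power2_eq_square)
  show ?thesis unfolding 2 unfolding 1
    using sum_square_ge[of "\<lambda>z. real (card {x\<in>D. f x = z})" "f ` D"] by simp
qed

lemma card_le_sumset:
  fixes A X :: "'a::ab_group_add set"
  assumes "finite A" "finite X" "A \<noteq> {}"
  shows "card X \<le> card (A + X)"
proof -
  obtain a where a: "a \<in> A" using assms by auto
  have "card ((+) a ` X) \<le> card (A + X)"
    using a assms by (intro card_mono finite_set_plus) auto
  then show ?thesis by (simp add: card_image)
qed

lemma card_le_dset:
  fixes A X :: "'a::ab_group_add set"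
  assumes "finite A" "finite X" "A \<noteq> {}"
  shows "card X \<le> card (dset X A)"
proof -
  obtain a where a: "a \<in> A" using assms by auto
  have "card ((\<lambda>x. x - a) ` X) \<le> card (dset X A)"
    using a assms by (intro card_mono) (auto intro: dset_diffI)
  then show ?thesis by (simp add: card_image inj_on_def)
qed

section \<open>The Balog-Szemeredi-Gowers theorem\<close>

lemma power_absorb:
  fixes K :: real
  assumes "2 \<le> K" "c \<le> 2 ^ n"
  shows "c \<le> K ^ n"
  using assms power_mono[of 2 K n] by linarith

text \<open>The counted triples are the paths of length four from \<open>a\<close> to
  \<open>a'\<close>. A pair with few common neighbours rarely lies in the neighbourhood of one
  \<open>b\<close>, so some \<open>b0\<close> has a large neighbourhood with few such bad pairs.
  After removal of the vertices in too many bad pairs, any two remaining vertices share many good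
  middle vertices \<open>c\<close>.\<close>

lemma bsg_graph:
  fixes M K :: real
  assumes fin: "finite A" "finite B" and E: "E \<subseteq> A \<times> B"
    and cA: "card A \<le> M" and cB: "card B \<le> M" and cE: "M\<^sup>2 / K \<le> card E"
    and K: "2 \<le> K" and M: "0 < M"
  shows "\<exists>A'\<subseteq>A. M / K ^ 3 \<le> card A' \<and> (\<forall>a\<in>A'. M / K\<^sup>2 \<le> card {b. (a, b) \<in> E}) \<and>
     (\<forall>a\<in>A'. \<forall>a'\<in>A'. M ^ 3 / K ^ 22 \<le>
        card {(b, c, b'). (a, b) \<in> E \<and> (c, b) \<in> E \<and> (c, b') \<in> E \<and> (a', b') \<in> E})"
proof -
  define deg where "deg a = real (card {b. (a, b) \<in> E})" for a
  define A1 where "A1 = {a\<in>A. M / (2 * K) \<le> deg a}"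
  have finA1: "finite A1" using fin by (simp add: A1_def)
  have cA1: "card A1 \<le> M" using card_mono[of A A1] fin cA unfolding A1_def by fastforce
  have "real (card E) = sum deg A"
    using card_Sigma_sum(1)[OF fin E] by (simp add: deg_def)
  then have d1: "M\<^sup>2 / K / 2 \<le> sum deg A1"
    unfolding A1_def using cE cA K M fin
    by (intro popular_sum) (auto simp: field_simps power2_eq_square)
  define N where "N b = {a\<in>A1. (a, b) \<in> E}" for b
  have finN: "finite (N b)" for b using finA1 by (simp add: N_def)
  define E1 where "E1 = E \<inter> A1 \<times> B"
  have e1: "{b. (a, b) \<in> E1} = {b. (a, b) \<in> E}" if "a \<in> A1" for a
    using that E by (auto simp: E1_def)
  have e2: "{a. (a, b) \<in> E1} = N b" if "b \<in> B" for b
    using that by (auto simp: E1_def N_def)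
  have "E1 \<subseteq> A1 \<times> B" by (auto simp: E1_def)
  from card_Sigma_sum[OF finA1 fin(2) this]
  have "sum deg A1 = (\<Sum>b\<in>B. real (card (N b)))"
    by (simp add: e1 e2 deg_def flip: of_nat_sum)
  with d1 have "M\<^sup>2 / K / 2 \<le> (\<Sum>b\<in>B. real (card (N b)))" by simp
  then have "(M\<^sup>2 / K / 2)\<^sup>2 \<le> (\<Sum>b\<in>B. real (card (N b)))\<^sup>2"
    using K M by (intro power_mono) auto
  also have "\<dots> \<le> card B * (\<Sum>b\<in>B. (real (card (N b)))\<^sup>2)" by (rule sum_square_ge)
  also have "\<dots> \<le> M * (\<Sum>b\<in>B. (real (card (N b)))\<^sup>2)"
    using cB by (intro mult_right_mono sum_nonneg) auto
  finally have sq: "M ^ 3 / (4 * K\<^sup>2) \<le> (\<Sum>b\<in>B. (real (card (N b)))\<^sup>2)"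
    using M K by (simp add: field_simps power2_eq_square power3_eq_cube)
  \<comment> \<open>This makes the total over bad pairs at most 1/32 of the lower bound in
    \<open>sq\<close>, so that the weight 16 used below costs only half of it.\<close>
  define \<delta> where "\<delta> = 1 / (128 * K\<^sup>2)"
  have \<delta>: "\<delta> > 0" using K by (simp add: \<delta>_def)
  define cn where "cn a c = {b. (a, b) \<in> E \<and> (c, b) \<in> E}" for a c
  have cnB: "cn a c \<subseteq> B" for a c using E by (auto simp: cn_def)
  then have fincn: "finite (cn a c)" for a c using fin finite_subset by blast
  define Bad where "Bad = {(a, c). a \<in> A1 \<and> c \<in> A1 \<and> card (cn a c) < \<delta> * M}"
  have Bad: "Bad \<subseteq> A1 \<times> A1" by (auto simp: Bad_def)
  then have finBad: "finite Bad" using finA1 finite_subset by blast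
  define bad where "bad b = real (card {x\<in>Bad. fst x \<in> N b \<and> snd x \<in> N b})" for b
  define R where "R = {(x, b). x \<in> Bad \<and> b \<in> cn (fst x) (snd x)}"
  have R: "R \<subseteq> Bad \<times> B" using cnB by (auto simp: R_def)
  have r1: "{b. (x, b) \<in> R} = cn (fst x) (snd x)" if "x \<in> Bad" for x using that by (auto simp: R_def)
  have r2: "{x. (x, b) \<in> R} = {x\<in>Bad. fst x \<in> N b \<and> snd x \<in> N b}" for b
    using Bad by (auto simp: R_def cn_def N_def)
  have "sum bad B = real (card R)"
    using card_Sigma_sum(2)[OF finBad fin(2) R] by (simp add: r2 bad_def)
  also have "\<dots> = (\<Sum>x\<in>Bad. real (card (cn (fst x) (snd x))))"
    using card_Sigma_sum(1)[OF finBad fin(2) R] by (simp add: r1)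
  also have "\<dots> \<le> (\<Sum>x\<in>Bad. \<delta> * M)" by (intro sum_mono) (auto simp: Bad_def)
  also have "\<dots> \<le> M * M * (\<delta> * M)"
  proof -
    have "real (card Bad) \<le> real (card (A1 \<times> A1))" using finA1 by (intro of_nat_mono card_mono Bad) auto
    also have "\<dots> \<le> M * M" using cA1 by (simp add: card_cartesian_product mult_mono)
    finally show ?thesis using \<delta> M by (simp add: mult_right_mono)
  qed
  finally have bad: "sum bad B \<le> M ^ 3 / (128 * K\<^sup>2)" by (simp add: \<delta>_def power3_eq_cube)
  \<comment> \<open>The weight 16 lets one choice of \<open>b0\<close> do two jobs: the difference
    being nonnegative leaves at most n^2 / 16 bad pairs, and its size makes \<open>n\<close> at
    least M / (3 K).\<close>
  have "card B * (M\<^sup>2 / (8 * K\<^sup>2)) \<le> M * (M\<^sup>2 / (8 * K\<^sup>2))" using cB K by (intro mult_right_mono) auto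
  also have "\<dots> = M ^ 3 / (4 * K\<^sup>2) - 16 * (M ^ 3 / (128 * K\<^sup>2))"
    using K by (simp add: field_simps power2_eq_square power3_eq_cube)
  also have "\<dots> \<le> (\<Sum>b\<in>B. (real (card (N b)))\<^sup>2 - 16 * bad b)"
    using sq bad by (simp add: sum_subtractf flip: sum_distrib_left)
  finally have pg: "card B * (M\<^sup>2 / (8 * K\<^sup>2)) \<le> (\<Sum>b\<in>B. (real (card (N b)))\<^sup>2 - 16 * bad b)" .
  have "B \<noteq> {}"
  proof
    assume "B = {}"
    then have "E = {}" using E by auto
    then have "M\<^sup>2 / K \<le> 0" using cE by simp
    moreover have "0 < M\<^sup>2 / K" using M K by simp
    ultimately show False by linarith
  qed
  from pigeonhole_sum[OF fin(2) this pg] obtain b0 where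
    b0: "M\<^sup>2 / (8 * K\<^sup>2) \<le> (real (card (N b0)))\<^sup>2 - 16 * bad b0" by blast
  define n where "n = real (card (N b0))"
  have bad0: "0 \<le> bad b0" by (simp add: bad_def)
  have "(M / (3 * K))\<^sup>2 \<le> M\<^sup>2 / (8 * K\<^sup>2)" using M K by (simp add: field_simps)
  then have "(M / (3 * K))\<^sup>2 \<le> n\<^sup>2" using b0 bad0 by (simp add: n_def)
  then have n: "M / (3 * K) \<le> n" by (rule power2_le_imp_le) (simp add: n_def)
  have "0 < M / (3 * K)" using M K by simp
  then have n0: "0 < n" using n by linarith
  have badn: "bad b0 \<le> n\<^sup>2 / 16" proof -
    have "0 \<le> M\<^sup>2 / (8 * K\<^sup>2)" by simp
    then show ?thesis using b0 unfolding n_def by linarith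
  qed
  define f where "f a = real (card {c\<in>N b0. (a, c) \<in> Bad})" for a
  \<comment> \<open>Vertices with more than n / 4 bad partners number at most n / 4, so 3 n / 4
    survive.\<close>
  define A' where "A' = {a\<in>N b0. f a \<le> n / 4}"
  define A'' where "A'' = {a\<in>N b0. \<not> f a \<le> n / 4}"
  have "bad b0 = sum f (N b0)"
  proof -
    have "{x\<in>Bad. fst x \<in> N b0 \<and> snd x \<in> N b0} \<subseteq> N b0 \<times> N b0" by auto
    from card_Sigma_sum(1)[OF finN finN this]
    have "bad b0 = (\<Sum>a\<in>N b0. real (card {c. (a, c) \<in> Bad \<and> a \<in> N b0 \<and> c \<in> N b0}))"
      by (simp add: bad_def)
    also have "\<dots> = sum f (N b0)"
      unfolding f_def by (intro sum.cong refl arg_cong[where f="\<lambda>x. real (card x)"]) auto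
    finally show ?thesis .
  qed
  also have "\<dots> \<ge> sum f A''" unfolding A''_def f_def by (intro sum_mono2) (auto simp: finN)
  moreover have "sum f A'' \<ge> card A'' * (n / 4)"
    using sum_mono[of A'' "\<lambda>_. n / 4" f] by (auto simp: A''_def)
  ultimately have "card A'' * (n / 4) \<le> n\<^sup>2 / 16" using badn by linarith
  then have A'': "card A'' \<le> n / 4" using n0 by (simp add: field_simps power2_eq_square)
  have "N b0 = A' \<union> A''" by (auto simp: A'_def A''_def)
  then have "n \<le> card A' + card A''" unfolding n_def by (metis card_Un_le of_nat_mono of_nat_add)
  then have cA': "3 * n / 4 \<le> card A'" using A'' by simp
  have K3: "4 * K \<le> K ^ 3" using K power_absorb[of K 4 2] by (simp add: power3_eq_cube power2_eq_square)
  have "M / K ^ 3 \<le> M / (4 * K)" using K3 M K by (intro divide_left_mono) auto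
  also have "\<dots> = 3 * (M / (3 * K)) / 4" using K by simp
  also have "\<dots> \<le> 3 * n / 4" using n by (intro divide_right_mono mult_left_mono) auto
  also note cA'
  finally have 1: "M / K ^ 3 \<le> card A'" .
  have A'A1: "A' \<subseteq> A1" by (auto simp: A'_def N_def)
  have 2: "M / K\<^sup>2 \<le> card {b. (a, b) \<in> E}" if "a \<in> A'" for a
  proof -
    have "M / K\<^sup>2 \<le> M / (2 * K)" using M K by (intro divide_left_mono) (auto simp: power2_eq_square)
    then show ?thesis using that A'A1 unfolding A1_def deg_def by auto
  qed
  have 3: "M ^ 3 / K ^ 22 \<le> card {(b, c, b'). (a, b) \<in> E \<and> (c, b) \<in> E \<and> (c, b') \<in> E \<and> (a', b') \<in> E}"
    (is "_ \<le> real (card ?P)") if a: "a \<in> A'" "a' \<in> A'" for a a'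
  proof -
    \<comment> \<open>At most n / 4 vertices are bad for \<open>a\<close> and as many for
      \<open>a'\<close>, so half of \<open>N b0\<close> can serve as middle vertex.\<close>
    define C where "C = {c\<in>N b0. (a, c) \<notin> Bad \<and> (a', c) \<notin> Bad}"
    have finC: "finite C" using finN by (simp add: C_def)
    have "N b0 = C \<union> {c\<in>N b0. (a, c) \<in> Bad} \<union> {c\<in>N b0. (a', c) \<in> Bad}" by (auto simp: C_def)
    then have "card (N b0) \<le> card C + card {c\<in>N b0. (a, c) \<in> Bad} + card {c\<in>N b0. (a', c) \<in> Bad}"
      by (metis (no_types, lifting) card_Un_le add_le_mono1 order_trans)
    then have "n \<le> card C + f a + f a'" unfolding n_def f_def by linarith
    then have cC: "n / 2 \<le> card C" using a by (simp add: A'_def)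
    have good: "\<delta> * M \<le> card (cn x c)" if "x \<in> {a, a'}" "c \<in> C" for x c
    proof -
      have "x \<in> A1" "c \<in> A1" "(x, c) \<notin> Bad" using that a A'A1 by (auto simp: C_def N_def)
      then show ?thesis by (auto simp: Bad_def)
    qed
    \<comment> \<open>22 = 5 + 17: the count is M^3 / (6 * 128^2 * K^5), and 6 * 128^2 <
      2^17.\<close>
    have "M ^ 3 / K ^ 22 = M / K * (M\<^sup>2 / K ^ 4) / K ^ 17"
      using K by (simp add: field_simps power2_eq_square power3_eq_cube flip: power_add power_Suc)
    also have "\<dots> \<le> M / K * (M\<^sup>2 / K ^ 4) / (6 * 128\<^sup>2)"
      using power_absorb[of K "6 * 128\<^sup>2" 17] K M by (intro divide_left_mono) auto
    also have "\<dots> = M / (3 * K) / 2 * (\<delta> * M)\<^sup>2"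
      by (simp add: \<delta>_def power_mult_distrib power_divide)
    also have "\<dots> \<le> card C * (\<delta> * M)\<^sup>2" using n cC by (intro mult_right_mono) auto
    also have "\<dots> = (\<Sum>c\<in>C. (\<delta> * M)\<^sup>2)" by simp
    also have "\<dots> \<le> (\<Sum>c\<in>C. real (card (cn a c \<times> cn a' c)))"
      using good M \<delta> by (intro sum_mono) (auto simp: card_cartesian_product power2_eq_square intro!: mult_mono)
    also have "\<dots> = card (Sigma C (\<lambda>c. cn a c \<times> cn a' c))"
      using finC fincn by (subst card_SigmaI) auto
    also have "\<dots> = card ((\<lambda>(c, b, b'). (b, c, b')) ` Sigma C (\<lambda>c. cn a c \<times> cn a' c))"
      by (subst card_image) (auto simp: inj_on_def)
    also have "\<dots> \<le> card ?P"
    proof -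
      have "?P \<subseteq> B \<times> A \<times> B" using E by auto
      then have "finite ?P" using fin by (meson finite_SigmaI finite_subset)
      then show ?thesis by (intro of_nat_mono card_mono) (auto simp: cn_def)
    qed
    finally show ?thesis .
  qed
  have "A' \<subseteq> A" using A'A1 by (auto simp: A1_def)
  then show ?thesis using 1 2 3 by blast
qed

text \<open>A path gives a - a' = (a + b) - (c + b) + (c + b') - (a' + b') with four terms in
  \<open>C\<close>, so each difference has many representations by the at most M^4 quadruples. The
  degree clause is kept for the covering of the other side in \<open>bsg_cover\<close>.\<close>

lemma bsg:
  fixes A B C :: "'a::ab_group_add set" and M K :: real
  assumes fin: "finite A" "finite B" "finite C" and E: "E \<subseteq> A \<times> B"
    and cA: "card A \<le> M" and cB: "card B \<le> M" and cC: "card C \<le> M" and cE: "M\<^sup>2 / K \<le> card E"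
    and EC: "\<And>a b. (a, b) \<in> E \<Longrightarrow> a + b \<in> C"
    and K: "2 \<le> K" and M: "0 < M"
  shows "\<exists>A'\<subseteq>A. M / K ^ 3 \<le> card A' \<and> (\<forall>a\<in>A'. M / K\<^sup>2 \<le> card {b. (a, b) \<in> E}) \<and>
     card (dset A' A') \<le> K ^ 22 * M"
proof -
  obtain A' where A': "A' \<subseteq> A" "M / K ^ 3 \<le> card A'" "\<forall>a\<in>A'. M / K\<^sup>2 \<le> card {b. (a, b) \<in> E}"
    and path: "\<And>a a'. a \<in> A' \<Longrightarrow> a' \<in> A' \<Longrightarrow> M ^ 3 / K ^ 22 \<le>
        card {(b, c, b'). (a, b) \<in> E \<and> (c, b) \<in> E \<and> (c, b') \<in> E \<and> (a', b') \<in> E}"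
    using bsg_graph[OF fin(1,2) E cA cB cE K M] by blast
  have finA': "finite A'" using A' fin finite_subset by blast
  have "card (dset A' A') * (M ^ 3 / K ^ 22) \<le> card (C \<times> C \<times> C \<times> C)"
  proof (rule card_fibres_le[where f = "\<lambda>(x, y, z, w). x - y + z - w"])
    fix d assume d: "d \<in> dset A' A'"
    then obtain a a' where a: "a \<in> A'" "a' \<in> A'" "d = a - a'" by (auto simp: dset_iff)
    let ?P = "{(b, c, b'). (a, b) \<in> E \<and> (c, b) \<in> E \<and> (c, b') \<in> E \<and> (a', b') \<in> E}"
    let ?Q = "{u \<in> C \<times> C \<times> C \<times> C. (\<lambda>(x, y, z, w). x - y + z - w) u = d}"
    let ?g = "\<lambda>(b, c, b'). (a + b, c + b, c + b', a' + b')"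
    have "inj_on ?g ?P" by (auto simp: inj_on_def)
    then have "real (card ?P) = card (?g ` ?P)" by (simp add: card_image)
    also have "\<dots> \<le> card ?Q"
    proof (intro of_nat_mono card_mono)
      show "finite ?Q" using fin by auto
      show "?g ` ?P \<subseteq> ?Q" using a(3) by (auto intro: EC)
    qed
    finally show "M ^ 3 / K ^ 22 \<le> card ?Q" using path[OF a(1,2)] by linarith
  qed (use fin finA' in auto)
  also have "\<dots> = (real (card C)) ^ 4" by (simp add: card_cartesian_product power4_eq_xxxx)
  also have "\<dots> \<le> M ^ 4" using cC by (intro power_mono) auto
  finally have "card (dset A' A') \<le> K ^ 22 * M"
    using M K by (simp add: field_simps power4_eq_xxxx power3_eq_cube)
  then show ?thesis using A' by blast
qed

section \<open>Approximate groups\<close>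

text \<open>Each representation s = u - v of a popular difference splits x + s - c as (x - v) + (u -
  c), so every element of the left-hand set is such a sum in at least \<open>m\<close> ways.\<close>

lemma card_dset_popular_sum:
  fixes A S X :: "'a::ab_group_add set" and m :: real
  assumes fin: "finite A" "finite S" "finite X"
    and m: "\<And>s. s \<in> S \<Longrightarrow> m \<le> card {u\<in>A \<times> A. fst u - snd u = s}"
  shows "card (dset (X + S) A) * m \<le> card (dset X A) * card (dset A A)"
proof -
  have "card (dset (X + S) A) * m \<le> card (dset X A \<times> dset A A)"
  proof (rule card_fibres_le[where f = "\<lambda>u. fst u + snd u"])
    fix y assume "y \<in> dset (X + S) A"
    then obtain x s c where h: "x \<in> X" "s \<in> S" "c \<in> A" "y = x + s - c"
      by (auto simp: dset_iff elim!: set_plus_elim)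
    let ?g = "\<lambda>u. (x - snd u, fst u - c)"
    have "real (card {u\<in>A \<times> A. fst u - snd u = s}) = card (?g ` {u\<in>A \<times> A. fst u - snd u = s})"
      by (subst card_image) (auto simp: inj_on_def)
    also have "\<dots> \<le> card {u\<in>dset X A \<times> dset A A. fst u + snd u = y}"
    proof (intro of_nat_mono card_mono)
      show "finite {u\<in>dset X A \<times> dset A A. fst u + snd u = y}" using fin by auto
      show "?g ` {u\<in>A \<times> A. fst u - snd u = s} \<subseteq> {u\<in>dset X A \<times> dset A A. fst u + snd u = y}"
        using h by (auto intro: dset_diffI)
    qed
    finally show "m \<le> card {u\<in>dset X A \<times> dset A A. fst u + snd u = y}" using m[OF h(2)] by linarith
  qed (use fin in \<open>auto intro!: finite_dset finite_set_plus\<close>)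
  then show ?thesis by (simp add: card_cartesian_product)
qed

text \<open>The set of popular differences of a set with small doubling plays the role that iterated
  sumsets play in Plunnecke's inequality.\<close>

lemma popular_differences:
  fixes A :: "'a::ab_group_add set" and L :: real
  assumes fin: "finite A" "A \<noteq> {}" and L: "card (dset A A) \<le> L * card A"
  shows "\<exists>S\<subseteq>dset A A. 0 \<in> S \<and> (\<forall>s\<in>S. - s \<in> S) \<and> card A / 2 \<le> card S \<and>
    (\<forall>X. finite X \<longrightarrow> card (dset (X + S) A) \<le> 2 * L\<^sup>2 * card (dset X A))"
proof -
  define r where "r s = real (card {u\<in>A \<times> A. fst u - snd u = s})" for s
  define D where "D = dset A A"
  \<comment> \<open>Half of the average number of representations of a difference.\<close>
  define m where "m = (card A)\<^sup>2 / (2 * card D)"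
  define S where "S = {s\<in>D. m \<le> r s}"
  have finD: "finite D" using fin by (simp add: D_def)
  have cA: "card A > 0" using fin by (simp add: card_gt_0_iff)
  obtain a0 where a0: "a0 \<in> A" using fin by auto
  have "0 \<in> D" using a0 by (force simp: D_def dset_iff)
  then have cD: "card D > 0" using finD by (auto simp: card_gt_0_iff)
  have LD: "real (card D) \<le> L * card A" using L by (simp add: D_def)
  have cAD: "card A \<le> card D" unfolding D_def using fin by (intro card_le_dset) auto
  have rA: "r s \<le> card A" for s
  proof -
    have "inj_on fst {u\<in>A \<times> A. fst u - snd u = s}" by (auto simp: inj_on_def)
    then have "card {u\<in>A \<times> A. fst u - snd u = s} \<le> card A"
      by (rule card_inj_on_le) (use fin in auto)
    then show ?thesis by (simp add: r_def)
  qed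
  have "(\<lambda>u. fst u - snd u) ` (A \<times> A) = D" by (auto simp: D_def dset_def case_prod_beta)
  then have "card A * card A = (\<Sum>s\<in>D. card {u\<in>A \<times> A. fst u - snd u = s})"
    using sum.image_gen[of "A \<times> A" "\<lambda>_. 1::nat" "\<lambda>u. fst u - snd u"] fin by simp
  then have "real (card A * card A) = sum r D" unfolding r_def by (simp only: of_nat_sum)
  then have rD: "(real (card A))\<^sup>2 = sum r D" by (simp add: power2_eq_square)
  have m0: "0 \<le> m" by (simp add: m_def)
  have "card D * m \<le> (real (card A))\<^sup>2 / 2" using cD by (simp add: m_def)
  then have "(real (card A))\<^sup>2 / 2 \<le> sum r S"
    unfolding S_def using finD rD m0 by (intro popular_sum) auto
  also have "\<dots> \<le> (\<Sum>s\<in>S. real (card A))" using rA by (intro sum_mono) auto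
  finally have 1: "card A / 2 \<le> card S" using cA by (simp add: power2_eq_square)
  have r0: "r 0 = card A"
  proof -
    have "{u\<in>A \<times> A. fst u - snd u = 0} = (\<lambda>a. (a, a)) ` A" by auto
    then show ?thesis by (simp add: r_def card_image inj_on_def)
  qed
  have "(real (card A))\<^sup>2 \<le> card A * (2 * real (card D))"
    unfolding power2_eq_square using cAD by (intro mult_left_mono) auto
  then have "m \<le> r 0" unfolding r0 m_def using cD by (simp add: field_simps)
  then have 2: "0 \<in> S" using \<open>0 \<in> D\<close> by (simp add: S_def)
  have "r (- s) = r s" for s
  proof -
    have *: "a - b = - s \<longleftrightarrow> b - a = s" for a b
      using minus_diff_eq[of b a] neg_equal_iff_equal[of "b - a" s] by simp
    have "prod.swap ` {u\<in>A \<times> A. fst u - snd u = s} = {u\<in>A \<times> A. fst u - snd u = - s}"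
      by (auto simp: image_iff *)
    moreover have "card (prod.swap ` {u\<in>A \<times> A. fst u - snd u = s}) = card {u\<in>A \<times> A. fst u - snd u = s}"
      by (rule card_image) simp
    ultimately show ?thesis by (simp add: r_def)
  qed
  moreover have "- s \<in> D" if s: "s \<in> D" for s
  proof -
    obtain a b where "a \<in> A" "b \<in> A" "s = a - b" using s by (auto simp: D_def dset_iff)
    then have "b - a \<in> D" "- s = b - a" by (auto simp: D_def intro: dset_diffI)
    then show ?thesis by simp
  qed
  ultimately have 3: "\<forall>s\<in>S. - s \<in> S" by (auto simp: S_def)
  have 4: "card (dset (X + S) A) \<le> 2 * L\<^sup>2 * card (dset X A)" if X: "finite X" for X
  proof -
    have m0: "m > 0" using cA cD by (simp add: m_def)
    have "card (dset (X + S) A) * m \<le> card (dset X A) * card D"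
      unfolding D_def using fin finD X by (intro card_dset_popular_sum) (auto simp: S_def r_def)
    then have "card (dset (X + S) A) \<le> card (dset X A) * (card D / m)"
      using m0 by (simp add: field_simps)
    also have "\<dots> \<le> card (dset X A) * (2 * L\<^sup>2)"
    proof (intro mult_left_mono)
      have "card D / m = 2 * (card D / card A)\<^sup>2" by (simp add: m_def field_simps power2_eq_square)
      also have "\<dots> \<le> 2 * L\<^sup>2"
        using LD cA by (intro mult_left_mono power_mono) (auto simp: field_simps)
      finally show "card D / m \<le> 2 * L\<^sup>2" .
    qed simp
    finally show ?thesis by (simp add: mult.commute)
  qed
  have "S \<subseteq> dset A A" by (auto simp: S_def D_def)
  then show ?thesis using 1 2 3 4 by blast
qed

text \<open>\<open>H\<close> is S + S for the popular differences \<open>S\<close>. The doubling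
  constant is K^2, so adding a copy of \<open>S\<close> costs 2 * (K^2)^2 \<le> K^5, and five copies
  take K M to K^26 M. Ruzsa covering with \<open>S\<close> produces translates of S - S, which is
  \<open>H\<close> by symmetry, and divides by \<open>card S\<close>, at least M / K^2: hence 8 = 6
  + 2 and 28 = 26 + 2.\<close>

lemma approx_group:
  fixes A :: "'a::ab_group_add set" and K M :: real
  assumes fin: "finite A" and M: "0 < M" and K: "2 \<le> K"
    and cA: "M / K \<le> card A" and AA: "card (dset A A) \<le> K * M"
  shows "\<exists>H X Z. finite H \<and> finite X \<and> finite Z \<and> 0 \<in> H \<and> (\<forall>h\<in>H. - h \<in> H) \<and>
    H \<subseteq> dset A A + dset A A \<and> A \<subseteq> Z + H \<and> H + H \<subseteq> X + H \<and>
    card Z \<le> K ^ 8 \<and> card X \<le> K ^ 28 \<and> M / K\<^sup>2 \<le> card H \<and> card H \<le> K ^ 11 * M"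
proof -
  have ne: "A \<noteq> {}"
  proof
    assume "A = {}"
    then show False using cA M K by (simp add: divide_le_0_iff)
  qed
  have "K * M \<le> K\<^sup>2 * card A"
    using cA K by (simp add: field_simps power2_eq_square)
  then have "card (dset A A) \<le> K\<^sup>2 * card A" using AA by simp
  from popular_differences[OF fin ne this] obtain S where
    S: "S \<subseteq> dset A A" "0 \<in> S" "\<forall>s\<in>S. - s \<in> S" "card A / 2 \<le> card S"
    and grow: "\<And>X. finite X \<Longrightarrow> card (dset (X + S) A) \<le> 2 * (K\<^sup>2)\<^sup>2 * card (dset X A)" by blast
  have finS: "finite S" using S fin by (meson finite_dset finite_subset)
  have grow': "card (dset (X + S) A) \<le> K ^ 5 * c" if "finite X" "card (dset X A) \<le> c" for X and c :: real
  proof -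
    have "card (dset (X + S) A) \<le> 2 * (K\<^sup>2)\<^sup>2 * card (dset X A)" using grow that by simp
    also have "\<dots> \<le> K ^ 5 * c"
      using that K by (intro mult_mono) (auto simp: eval_nat_numeral)
    finally show ?thesis .
  qed
  note fs = finite_set_plus
  have g1: "card (dset (A + S) A) \<le> K ^ 6 * M"
    using grow'[OF fin AA] by (simp add: eval_nat_numeral mult.assoc)
  have g2: "card (dset (A + S + S) A) \<le> K ^ 11 * M"
    using grow'[OF _ g1] fin finS by (simp add: eval_nat_numeral mult.assoc fs)
  have g3: "card (dset (A + S + S + S) A) \<le> K ^ 16 * M"
    using grow'[OF _ g2] fin finS by (simp add: eval_nat_numeral mult.assoc fs)
  have g4: "card (dset (A + S + S + S + S) A) \<le> K ^ 21 * M"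
    using grow'[OF _ g3] fin finS by (simp add: eval_nat_numeral mult.assoc fs)
  have g5: "card (dset (A + S + S + S + S + S) A) \<le> K ^ 26 * M"
    using grow'[OF _ g4] fin finS by (simp add: eval_nat_numeral mult.assoc fs)
  define H where "H = S + S"
  have finH: "finite H" using finS by (simp add: H_def fs)
  have "dset S S = H"
  proof (intro equalityI subsetI)
    fix x assume "x \<in> dset S S"
    then obtain a b where "a \<in> S" "b \<in> S" "x = a + (- b)" by (auto simp: dset_iff)
    then show "x \<in> H" unfolding H_def using S(3) by (metis set_plus_intro)
  next
    fix x assume "x \<in> H"
    then obtain a b where "a \<in> S" "b \<in> S" "x = a - (- b)" by (auto simp: H_def elim!: set_plus_elim)
    then show "x \<in> dset S S" using S(3) by (metis dset_diffI)
  qed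
  note H = this
  have cS: "M / K\<^sup>2 \<le> card S"
  proof -
    have "M / K\<^sup>2 \<le> M / K / 2" using K M by (simp add: field_simps power2_eq_square)
    then show ?thesis using cA S(4) by (meson order_trans divide_right_mono zero_le_numeral)
  qed
  have bound: "card X \<le> K ^ (n + 2)" if "card X * card S \<le> card Y" "card Y \<le> K ^ n * M" for X Y :: "'a set" and n
  proof -
    have "card X * (M / K\<^sup>2) \<le> real (card X) * real (card S)" using cS by (intro mult_left_mono) auto
    also have "\<dots> \<le> K ^ n * M" using that by (metis of_nat_mono of_nat_mult order_trans)
    finally show ?thesis using M K by (simp add: field_simps power_add power2_eq_square)
  qed
  have small: "real (card Y) \<le> c" if "card (dset (A + Y) A) \<le> c" "finite Y" for Y and c :: real
    using card_le_sumset[of A Y] card_le_dset[of A "A + Y"] that fin ne by (simp add: fs)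
  obtain Z where Z: "Z \<subseteq> A" "card Z * card S \<le> card (A + S)" "A \<subseteq> Z + H"
    using ruzsa_cover[OF fin finS] S(2) unfolding H by blast
  have "real (card (A + S)) \<le> K ^ 6 * M"
    using g1 card_le_dset[of A "A + S"] fin finS ne by (simp add: fs)
  from bound[OF Z(2) this] have cZ: "card Z \<le> K ^ 8" by simp
  obtain X where X: "X \<subseteq> H + H" "card X * card S \<le> card (H + H + S)" "H + H \<subseteq> X + H"
    using ruzsa_cover[of "H + H" S] finH finS S(2) unfolding H by (auto simp: fs)
  have "real (card (H + H + S)) \<le> K ^ 26 * M"
    using small[of "H + H + S" "K ^ 26 * M"] g5 finH finS by (simp add: H_def add.assoc fs)
  from bound[OF X(2) this] have cX: "card X \<le> K ^ 28" by simp
  have "S \<subseteq> H" unfolding H_def using S(2) by (rule set_zero_plus2)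
  then have "card S \<le> card H" using finH card_mono by blast
  then have cH1: "M / K\<^sup>2 \<le> card H" using cS by linarith
  have cH2: "card H \<le> K ^ 11 * M"
    using small[of H] g2 finH by (simp add: H_def add.assoc)
  have "0 \<in> H" using S(2) \<open>S \<subseteq> H\<close> by auto
  moreover have "\<forall>h\<in>H. - h \<in> H"
  proof
    fix h assume "h \<in> H"
    then obtain a b where "a \<in> S" "b \<in> S" "- h = (- a) + (- b)" by (auto simp: H_def elim!: set_plus_elim)
    then show "- h \<in> H" unfolding H_def using S(3) by (metis set_plus_intro)
  qed
  moreover have "H \<subseteq> dset A A + dset A A" unfolding H_def using S(1) by (intro set_plus_mono2)
  moreover have "finite X" "finite Z" using X Z finH fin by (auto intro: finite_subset fs)
  ultimately show ?thesis using finH Z(3) X(3) cZ cX cH1 cH2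
    by (intro exI[of _ H] exI[of _ X] exI[of _ Z] conjI)
qed

text \<open>Only \<open>A'\<close> comes from the graph argument. For \<open>b\<close> with many
  neighbours in \<open>A'\<close> the sums a + b fill a large subset of \<open>C\<close>, so few of
  these subsets meet all the others, and a + b = a' + x puts \<open>b\<close> in x + (A' - A'). Thus
  \<open>B'\<close> is controlled by \<open>A'\<close> without a second application of
  \<open>bsg\<close>.\<close>

lemma bsg_cover:
  fixes A B C :: "'a::ab_group_add set" and M K :: real
  assumes fin: "finite A" "finite B" "finite C" and E: "E \<subseteq> A \<times> B"
    and cA: "card A \<le> M" and cB: "card B \<le> M" and cC: "card C \<le> M" and cE: "M\<^sup>2 / K \<le> card E"
    and EC: "\<And>a b. (a, b) \<in> E \<Longrightarrow> a + b \<in> C"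
    and K: "2 \<le> K" and M: "0 < M"
  shows "\<exists>A'\<subseteq>A. \<exists>B'\<subseteq>B. \<exists>X\<subseteq>B. M / K ^ 3 \<le> card A' \<and> M / K ^ 6 \<le> card B' \<and>
     card (dset A' A') \<le> K ^ 22 * M \<and> card X \<le> K ^ 6 \<and> B' \<subseteq> X + dset A' A'"
proof -
  obtain A' where A': "A' \<subseteq> A" "M / K ^ 3 \<le> card A'" "\<And>a. a \<in> A' \<Longrightarrow> M / K\<^sup>2 \<le> card {b. (a, b) \<in> E}"
    and D: "card (dset A' A') \<le> K ^ 22 * M"
    using bsg[OF fin E cA cB cC cE EC K M] by blast
  have finA': "finite A'" using A' fin finite_subset by blast
  have cA': "card A' \<le> M" using card_mono[OF fin(1) A'(1)] cA by linarith
  define E' where "E' = E \<inter> A' \<times> B"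
  have E': "E' \<subseteq> A' \<times> B" by (auto simp: E'_def)
  define f where "f b = real (card {a. (a, b) \<in> E'})" for b
  define m where "m = M / K ^ 6"
  have m: "0 < m" using M K by (simp add: m_def)
  have "M\<^sup>2 / K ^ 5 = M / K ^ 3 * (M / K\<^sup>2)" using K by (simp add: eval_nat_numeral)
  also have "\<dots> \<le> card A' * (M / K\<^sup>2)" using A'(2) M K by (intro mult_right_mono) auto
  also have "\<dots> = (\<Sum>a\<in>A'. M / K\<^sup>2)" by simp
  also have "\<dots> \<le> (\<Sum>a\<in>A'. real (card {b. (a, b) \<in> E'}))"
  proof (intro sum_mono)
    fix a assume a: "a \<in> A'"
    then have "{b. (a, b) \<in> E'} = {b. (a, b) \<in> E}" using E by (auto simp: E'_def)
    then show "M / K\<^sup>2 \<le> real (card {b. (a, b) \<in> E'})" using A'(3)[OF a] by simp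
  qed
  also have "\<dots> = sum f B"
    using card_Sigma_sum[OF finA' fin(2) E'] by (simp add: f_def flip: of_nat_sum)
  finally have s: "M\<^sup>2 / K ^ 5 \<le> sum f B" .
  define B' where "B' = {b\<in>B. m \<le> f b}"
  have finB': "finite B'" using fin by (simp add: B'_def)
  have "card B * m \<le> M * m" using cB m by simp
  also have "M * m \<le> M\<^sup>2 / K ^ 5 / 2"
    using M K by (simp add: m_def field_simps power2_eq_square flip: power_Suc)
      (simp add: eval_nat_numeral)
  finally have "M\<^sup>2 / K ^ 5 / 2 \<le> sum f B'"
    unfolding B'_def using m fin s by (intro popular_sum) auto
  also have "\<dots> \<le> (\<Sum>b\<in>B'. M)"
  proof (intro sum_mono)
    fix b
    have "card {a. (a, b) \<in> E'} \<le> card A'" using finA' by (intro card_mono) (auto simp: E'_def)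
    then show "f b \<le> M" using cA' unfolding f_def by linarith
  qed
  finally have "M * (M / K ^ 5 / 2) \<le> M * card B'" by (simp add: power2_eq_square mult.commute)
  then have "M / K ^ 5 / 2 \<le> card B'" using M by (rule mult_left_le_imp_le)
  moreover have "m \<le> M / K ^ 5 / 2"
    using M K by (simp add: m_def field_simps) (simp add: eval_nat_numeral)
  ultimately have cB': "M / K ^ 6 \<le> card B'" unfolding m_def by linarith
  define Z where "Z b = (\<lambda>a. a + b) ` {a. (a, b) \<in> E'}" for b
  have "\<exists>X\<subseteq>B'. card X * m \<le> card C \<and> (\<forall>b\<in>B'. \<exists>x\<in>X. Z b \<inter> Z x \<noteq> {})"
  proof (rule greedy_cover[OF finB' fin(3)])
    show "Z b \<subseteq> C" for b using EC by (auto simp: Z_def E'_def)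
    show "m \<le> card (Z b)" if "b \<in> B'" for b
      using that by (simp add: Z_def B'_def f_def card_image)
  qed (rule m)
  then obtain X where X: "X \<subseteq> B'" "card X * m \<le> card C" "\<And>b. b \<in> B' \<Longrightarrow> \<exists>x\<in>X. Z b \<inter> Z x \<noteq> {}" by blast
  have "card X * m \<le> M" using X(2) cC by linarith
  then have cX: "card X \<le> K ^ 6" using M K by (simp add: m_def field_simps)
  have "B' \<subseteq> X + dset A' A'"
  proof
    fix b assume "b \<in> B'"
    then obtain x where x: "x \<in> X" "Z b \<inter> Z x \<noteq> {}" using X(3) by blast
    then obtain a a' where h: "a \<in> A'" "a' \<in> A'" "a + b = a' + x"
      unfolding Z_def E'_def by auto
    then have "b = x + (a' - a)" by (simp add: algebra_simps)
    moreover have "a' - a \<in> dset A' A'" using h by (intro dset_diffI)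
    ultimately show "b \<in> X + dset A' A'" using x(1) by (simp add: set_plus_intro)
  qed
  moreover have "B' \<subseteq> B" "X \<subseteq> B" using X(1) by (auto simp: B'_def)
  ultimately show ?thesis using A'(1,2) D cB' cX
    by (intro exI[of _ A'] exI[of _ B'] exI[of _ X] conjI)
qed

section \<open>Common intersections and commensurable sets\<close>

lemma real_card_Int:
  assumes "finite U"
  shows "real (card (U \<inter> S)) = (\<Sum>u\<in>U. of_bool (u \<in> S))"
  using sum.inter_restrict[OF assms, of "\<lambda>_. 1::real" S] by (simp add: of_bool_def)

text \<open>By Cauchy-Schwarz the average size of \<open>R l \<inter> R l0\<close> over all pairs is
  at least W / k^2. Some \<open>l0\<close> attains the average over its partners, and the partners
  meeting it in at least half of that are kept.\<close>

lemma common_intersection: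
  fixes W k :: real
  assumes fin: "finite L" "L \<noteq> {}" "finite U" and U: "card U \<le> W" and W: "0 < W" and k: "0 < k"
    and R: "\<And>l. l \<in> L \<Longrightarrow> R l \<subseteq> U" "\<And>l. l \<in> L \<Longrightarrow> W / k \<le> card (R l)"
  shows "\<exists>l0\<in>L. \<exists>L'\<subseteq>L. card L / (2 * k\<^sup>2) \<le> card L' \<and> (\<forall>l\<in>L'. W / (2 * k\<^sup>2) \<le> card (R l \<inter> R l0))"
proof -
  define i :: "_ \<Rightarrow> _ \<Rightarrow> real" where "i l u = of_bool (u \<in> R l)" for l u
  define d where "d u = (\<Sum>l\<in>L. i l u)" for u
  have cR: "real (card (R l)) = (\<Sum>u\<in>U. i l u)" if "l \<in> L" for l
  proof -
    have "U \<inter> R l = R l" using R(1)[OF that] by blast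
    then show ?thesis using real_card_Int[OF fin(3), of "R l"] by (simp add: i_def)
  qed
  have cRR: "real (card (R l \<inter> R l')) = (\<Sum>u\<in>U. i l u * i l' u)" if "l \<in> L" for l l'
  proof -
    have *: "U \<inter> (R l \<inter> R l') = R l \<inter> R l'" using R(1)[OF that] by blast
    have "(\<Sum>u\<in>U. i l u * i l' u) = (\<Sum>u\<in>U. of_bool (u \<in> R l \<inter> R l'))"
      by (intro sum.cong) (auto simp: i_def)
    also have "\<dots> = card (U \<inter> (R l \<inter> R l'))" by (rule real_card_Int[OF fin(3), symmetric])
    finally show ?thesis using * by simp
  qed
  have "card L * (W / k) = (\<Sum>l\<in>L. W / k)" by simp
  also have "\<dots> \<le> (\<Sum>l\<in>L. \<Sum>u\<in>U. i l u)" using R(2) by (intro sum_mono) (simp flip: cR)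
  also have "\<dots> = sum d U" unfolding d_def by (rule sum.swap)
  finally have "(card L * (W / k))\<^sup>2 \<le> (sum d U)\<^sup>2" using W k by (intro power_mono) auto
  also have "\<dots> \<le> card U * (\<Sum>u\<in>U. (d u)\<^sup>2)" by (rule sum_square_ge)
  also have "\<dots> \<le> W * (\<Sum>u\<in>U. (d u)\<^sup>2)" using U by (intro mult_right_mono sum_nonneg) auto
  also have "(\<Sum>u\<in>U. (d u)\<^sup>2) = (\<Sum>l0\<in>L. \<Sum>l\<in>L. real (card (R l \<inter> R l0)))"
  proof -
    have "(\<Sum>l0\<in>L. \<Sum>l\<in>L. real (card (R l \<inter> R l0))) = (\<Sum>l0\<in>L. \<Sum>l\<in>L. \<Sum>u\<in>U. i l0 u * i l u)"
      by (intro sum.cong refl) (simp add: cRR mult.commute)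
    also have "\<dots> = (\<Sum>l0\<in>L. \<Sum>u\<in>U. \<Sum>l\<in>L. i l0 u * i l u)"
      by (intro sum.cong refl sum.swap)
    also have "\<dots> = (\<Sum>u\<in>U. \<Sum>l0\<in>L. \<Sum>l\<in>L. i l0 u * i l u)" by (rule sum.swap)
    also have "\<dots> = (\<Sum>u\<in>U. (d u)\<^sup>2)" by (simp add: d_def power2_eq_square sum_product)
    finally show ?thesis by simp
  qed
  finally have "card L * (card L * W / k\<^sup>2) \<le> (\<Sum>l0\<in>L. \<Sum>l\<in>L. real (card (R l \<inter> R l0)))"
    using W k by (simp add: field_simps power2_eq_square)
  from pigeonhole_sum[OF fin(1,2) this]
  obtain l0 where l0: "l0 \<in> L" "card L * W / k\<^sup>2 \<le> (\<Sum>l\<in>L. real (card (R l \<inter> R l0)))" by blast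
  define L' where "L' = {l\<in>L. W / (2 * k\<^sup>2) \<le> real (card (R l \<inter> R l0))}"
  have "card L * W / k\<^sup>2 / 2 \<le> (\<Sum>l\<in>L'. real (card (R l \<inter> R l0)))"
    unfolding L'_def using l0(2) fin W k by (intro popular_sum) auto
  also have "\<dots> \<le> (\<Sum>l\<in>L'. W)"
  proof (intro sum_mono)
    fix l
    have "card (R l \<inter> R l0) \<le> card U" using R(1)[OF l0(1)] fin by (intro card_mono) auto
    then show "real (card (R l \<inter> R l0)) \<le> W" using U by linarith
  qed
  finally have "card L / (2 * k\<^sup>2) \<le> card L'" using W k by (simp add: field_simps)
  moreover have "L' \<subseteq> L" by (auto simp: L'_def)
  moreover have "\<forall>l\<in>L'. W / (2 * k\<^sup>2) \<le> card (R l \<inter> R l0)" by (auto simp: L'_def)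
  ultimately show ?thesis using l0(1) by blast
qed

text \<open>Ruzsa covering by translates of - V, using that (- V) - (- V) lies in V - V.\<close>

lemma ruzsa_cover_diff:
  fixes U V :: "'a::ab_group_add set"
  assumes fin: "finite U" "finite V" "V \<noteq> {}"
  shows "\<exists>X\<subseteq>U. card X * card V \<le> card (dset U V) \<and> U \<subseteq> X + dset V V"
proof -
  have 1: "U + uminus ` V = dset U V"
  proof (intro equalityI subsetI)
    fix x assume "x \<in> U + uminus ` V"
    then obtain u v where "u \<in> U" "v \<in> V" "x = u + - v" by (auto elim!: set_plus_elim)
    then show "x \<in> dset U V" by (simp add: dset_diffI)
  next
    fix x assume "x \<in> dset U V"
    then obtain u v where "u \<in> U" "v \<in> V" "x = u + - v" by (auto simp: dset_iff)
    then show "x \<in> U + uminus ` V" by (metis imageI set_plus_intro)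
  qed
  have 2: "dset (uminus ` V) (uminus ` V) \<subseteq> dset V V"
  proof
    fix x assume "x \<in> dset (uminus ` V) (uminus ` V)"
    then obtain u v where "u \<in> V" "v \<in> V" "x = v - u" by (auto simp: dset_iff)
    then show "x \<in> dset V V" by (simp add: dset_diffI)
  qed
  obtain X where X: "X \<subseteq> U" "card X * card (uminus ` V) \<le> card (dset U V)"
      "U \<subseteq> X + dset (uminus ` V) (uminus ` V)"
    using ruzsa_cover[of U "uminus ` V"] fin unfolding 1 by auto
  have "U \<subseteq> X + dset V V" using X(3) set_plus_mono2[OF order_refl 2] by (rule order_trans)
  moreover have "card (uminus ` V) = card V" by (simp add: card_image)
  ultimately show ?thesis using X by auto
qed

text \<open>\<open>W\<close> splits into at most k^2 pieces, each in one translate of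
  \<open>P\<close> and one of \<open>Q\<close>; the largest, \<open>V\<close>, has at least M / k^3
  elements. Ruzsa covering gives P \<subseteq> Y + (V - V), and V - V \<subseteq> Q + Q \<subseteq>
  X + Q by symmetry. The exponent is 2 + 3 for \<open>Y\<close> and 1 for \<open>X\<close>.\<close>

lemma commensurable:
  fixes P Q W X X1 X2 :: "'a::ab_group_add set" and M k :: real
  assumes fin: "finite P" "finite Q" "finite X" "finite X1" "finite X2"
    and W: "W \<subseteq> X1 + P" "W \<subseteq> X2 + Q" "M / k \<le> card W" and c: "card X1 \<le> k" "card X2 \<le> k" "card X \<le> k"
    and P: "card (P + P) \<le> k\<^sup>2 * M" and Q: "Q + Q \<subseteq> X + Q" "\<And>q. q \<in> Q \<Longrightarrow> - q \<in> Q"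
    and M: "0 < M" and k: "0 < k"
  shows "\<exists>Y. finite Y \<and> card Y \<le> k ^ 6 \<and> P \<subseteq> Y + Q"
proof -
  have finW: "finite W" using W(1) fin by (meson finite_set_plus finite_subset)
  define w where "w x = {y\<in>W. y \<in> (+) (fst x) ` P \<and> y \<in> (+) (snd x) ` Q}" for x
  have finw: "finite (w x)" for x using finW by (simp add: w_def)
  have "W \<subseteq> (\<Union>x\<in>X1 \<times> X2. w x)"
  proof
    fix y assume y: "y \<in> W"
    then obtain x1 p x2 q where "x1 \<in> X1" "p \<in> P" "x2 \<in> X2" "q \<in> Q" "y = x1 + p" "y = x2 + q"
      using W by (meson set_plus_elim subsetD)
    then have "y \<in> (+) x1 ` P" "y \<in> (+) x2 ` Q" by blast+
    then have "y \<in> w (x1, x2)" by (simp add: w_def y)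
    moreover have "(x1, x2) \<in> X1 \<times> X2" using \<open>x1 \<in> X1\<close> \<open>x2 \<in> X2\<close> by simp
    ultimately show "y \<in> (\<Union>x\<in>X1 \<times> X2. w x)" by blast
  qed
  then have "card W \<le> card (\<Union>x\<in>X1 \<times> X2. w x)" using fin finw by (intro card_mono) auto
  also have "\<dots> \<le> (\<Sum>x\<in>X1 \<times> X2. card (w x))" using fin by (intro card_UN_le) auto
  finally have s: "card W \<le> (\<Sum>x\<in>X1 \<times> X2. real (card (w x)))" by (simp flip: of_nat_sum)
  have W0: "0 < M / k" using M k by simp
  have "real (card (X1 \<times> X2)) \<le> k\<^sup>2"
    using c k by (simp add: card_cartesian_product power2_eq_square mult_mono)
  then have "card (X1 \<times> X2) * (M / k ^ 3) \<le> k\<^sup>2 * (M / k ^ 3)"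
    using M k by (intro mult_right_mono) auto
  also have "\<dots> = M / k" using k by (simp add: field_simps power2_eq_square power3_eq_cube)
  finally have s2: "card (X1 \<times> X2) * (M / k ^ 3) \<le> (\<Sum>x\<in>X1 \<times> X2. real (card (w x)))"
    using s W(3) by linarith
  have "W \<noteq> {}" using W(3) W0 by auto
  then have "X1 \<times> X2 \<noteq> {}" using W(1,2) by (auto elim!: set_plus_elim)
  from pigeonhole_sum[OF _ this s2] fin obtain x1 x2 where
    x: "M / k ^ 3 \<le> card (w (x1, x2))" by auto
  define V where "V = w (x1, x2)"
  have V1: "V \<subseteq> (+) x1 ` P" "V \<subseteq> (+) x2 ` Q" by (auto simp: V_def w_def)
  have cV: "M / k ^ 3 \<le> card V" using x by (simp add: V_def)
  have V0: "0 < M / k ^ 3" using M k by simp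
  have neV: "V \<noteq> {}" using cV V0 by auto
  have finV: "finite V" by (simp add: V_def finw)
  obtain Y where Y: "Y \<subseteq> P" "card Y * card V \<le> card (P + V)" "P \<subseteq> Y + dset V V"
    using ruzsa_cover[OF fin(1) finV neV] by blast
  have "P + V \<subseteq> (+) x1 ` (P + P)"
  proof
    fix y assume "y \<in> P + V"
    then obtain p q where "p \<in> P" "q \<in> P" "y = p + (x1 + q)" using V1(1) by (auto elim!: set_plus_elim)
    then have "p + q \<in> P + P" "y = x1 + (p + q)" by (auto simp: algebra_simps)
    then show "y \<in> (+) x1 ` (P + P)" by blast
  qed
  then have "card (P + V) \<le> card ((+) x1 ` (P + P))" using fin by (intro card_mono finite_imageI finite_set_plus)
  also have "\<dots> = card (P + P)" by (simp add: card_image)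
  finally have "real (card (P + V)) \<le> k\<^sup>2 * M" using P by linarith
  moreover have "real (card Y) * real (card V) \<le> card (P + V)" using Y(2) by (metis of_nat_mono of_nat_mult)
  moreover have "card Y * (M / k ^ 3) \<le> real (card Y) * real (card V)" using cV by (intro mult_left_mono) auto
  ultimately have "card Y * (M / k ^ 3) \<le> k\<^sup>2 * M" by linarith
  then have cY: "card Y \<le> k ^ 5" using M k by (simp add: field_simps eval_nat_numeral)
  have "dset V V \<subseteq> Q + Q"
  proof
    fix y assume "y \<in> dset V V"
    then obtain u v where uv: "u \<in> V" "v \<in> V" "y = u - v" by (auto simp: dset_iff)
    then obtain a b where "a \<in> Q" "b \<in> Q" "u = x2 + a" "v = x2 + b" using V1(2) by blast
    then have "y = a + (- b)" "a \<in> Q" "- b \<in> Q" using uv Q(2) by auto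
    then show "y \<in> Q + Q" by blast
  qed
  then have "dset V V \<subseteq> X + Q" using Q(1) by blast
  then have "Y + dset V V \<subseteq> Y + (X + Q)" by (intro set_plus_mono2) auto
  then have PYX: "P \<subseteq> (Y + X) + Q" using Y(3) by (simp add: add.assoc)
  have finY: "finite Y" using Y fin finite_subset by blast
  have "card (Y + X) \<le> card Y * card X" using finY fin by (intro card_sumset_le)
  then have "real (card (Y + X)) \<le> real (card Y) * real (card X)" by (metis of_nat_mono of_nat_mult)
  also have "\<dots> \<le> k ^ 5 * k" using cY c k by (intro mult_mono) auto
  also have "\<dots> = k ^ 6" by (simp add: eval_nat_numeral)
  finally show ?thesis using PYX finY fin by (intro exI[of _ "Y + X"]) (auto intro: finite_set_plus)
qed

section \<open>Prime fields inside a ring\<close>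

text \<open>The field is a finite subset of a ring, with a unit \<open>e\<close> of its own, so that
  sumset lemmas about the ambient type apply while the field varies. \<open>generated\<close> says
  that \<open>e\<close> generates the field additively, which rules out proper subfields.\<close>

locale prime_field =
  fixes F :: "'a::comm_ring_1 set" and e :: 'a
  assumes fin_F [simp]: "finite F" and e_F: "e \<in> F" and e_nz: "e \<noteq> 0"
    and add_F: "x \<in> F \<Longrightarrow> y \<in> F \<Longrightarrow> x + y \<in> F" and neg_F: "x \<in> F \<Longrightarrow> - x \<in> F"
    and mult_F: "x \<in> F \<Longrightarrow> y \<in> F \<Longrightarrow> x * y \<in> F" and unit: "x \<in> F \<Longrightarrow> e * x = x"
    and inverse_ex: "x \<in> F \<Longrightarrow> x \<noteq> 0 \<Longrightarrow> \<exists>y\<in>F. x * y = e"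
    and generated: "x \<in> F \<Longrightarrow> \<exists>n::nat. x = of_nat n * e"
begin

lemma diff_F: "x \<in> F \<Longrightarrow> y \<in> F \<Longrightarrow> x - y \<in> F"
  using add_F[of x "- y"] neg_F[of y] by simp

definition iv :: "'a \<Rightarrow> 'a" where "iv x = (SOME y. y \<in> F \<and> x * y = e)"

lemma iv:
  assumes "x \<in> F" "x \<noteq> 0"
  shows "iv x \<in> F" and "x * iv x = e" and "iv x * x = e" and "iv x \<noteq> 0"
proof -
  have *: "iv x \<in> F \<and> x * iv x = e"
    unfolding iv_def using inverse_ex[OF assms] by (rule someI2_bex) blast
  then show "iv x \<in> F" "x * iv x = e" by auto
  then show "iv x * x = e" by (simp only: mult.commute)
  show "iv x \<noteq> 0"
  proof
    assume "iv x = 0"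
    then show False using * e_nz by simp
  qed
qed

lemma iv_cancel:
  assumes "x \<in> F" "x \<noteq> 0" "y \<in> F"
  shows "iv x * (x * y) = y" and "x * (iv x * y) = y"
proof -
  have "iv x * (x * y) = (iv x * x) * y" "x * (iv x * y) = (x * iv x) * y" by (simp_all only: mult.assoc)
  then show "iv x * (x * y) = y" "x * (iv x * y) = y"
    using iv[OF assms(1,2)] unit[OF assms(3)] by simp_all
qed

lemma mult_eq_zero:
  assumes "x \<in> F" "y \<in> F" "x * y = 0"
  shows "x = 0 \<or> y = 0"
  using iv_cancel(1)[of x y] assms by auto

lemma mult_cancel:
  assumes "l \<in> F" "l \<noteq> 0" "x \<in> F" "y \<in> F" "l * x = l * y"
  shows "x = y"
proof -
  have "x = iv l * (l * x)" using iv_cancel(1)[OF assms(1-3)] by (rule sym)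
  also have "\<dots> = iv l * (l * y)" by (simp only: assms(5))
  also have "\<dots> = y" by (rule iv_cancel(1)[OF assms(1,2,4)])
  finally show ?thesis .
qed

lemma inj_on_mult: "l \<in> F \<Longrightarrow> l \<noteq> 0 \<Longrightarrow> A \<subseteq> F \<Longrightarrow> inj_on ((*) l) A"
  by (rule inj_onI) (rule mult_cancel[of l], auto)

lemma card_dilate: "l \<in> F \<Longrightarrow> l \<noteq> 0 \<Longrightarrow> A \<subseteq> F \<Longrightarrow> card ((*) l ` A) = card A"
  by (rule card_image) (rule inj_on_mult)

lemma sumset_F: "A \<subseteq> F \<Longrightarrow> B \<subseteq> F \<Longrightarrow> A + B \<subseteq> F"
  by (auto elim!: set_plus_elim intro!: add_F)

lemma dset_F: "A \<subseteq> F \<Longrightarrow> B \<subseteq> F \<Longrightarrow> dset A B \<subseteq> F"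
  by (auto simp: dset_iff intro!: diff_F)

lemma finite_sub_F: "A \<subseteq> F \<Longrightarrow> finite A"
  using fin_F finite_subset by blast

end

lemma dilate_sumset: "(*) l ` (A + B) = (*) l ` A + (*) l ` (B :: 'a::comm_ring set)"
proof (intro equalityI subsetI)
  fix x assume "x \<in> (*) l ` (A + B)"
  then obtain a b where "a \<in> A" "b \<in> B" "x = l * a + l * b" by (auto elim!: set_plus_elim simp: distrib_left)
  then show "x \<in> (*) l ` A + (*) l ` B" by (simp add: set_plus_intro)
next
  fix x assume "x \<in> (*) l ` A + (*) l ` B"
  then obtain a b where "a \<in> A" "b \<in> B" "x = l * (a + b)" by (auto elim!: set_plus_elim simp: distrib_left)
  then show "x \<in> (*) l ` (A + B)" by (simp add: set_plus_intro)
qed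

lemma dilate_dset: "(*) l ` dset A B = dset ((*) l ` A) ((*) l ` (B :: 'a::comm_ring set))"
proof (intro equalityI subsetI)
  fix x assume "x \<in> (*) l ` dset A B"
  then obtain a b where "a \<in> A" "b \<in> B" "x = l * a - l * b" by (auto simp: dset_iff right_diff_distrib)
  then show "x \<in> dset ((*) l ` A) ((*) l ` B)" by (simp add: dset_diffI)
next
  fix x assume "x \<in> dset ((*) l ` A) ((*) l ` B)"
  then obtain a b where "a \<in> A" "b \<in> B" "x = l * (a - b)" by (auto simp: dset_iff right_diff_distrib)
  then show "x \<in> (*) l ` dset A B" by (simp add: dset_diffI)
qed

lemma card_sumset_le_real:
  fixes A B :: "'a::ab_group_add set" and a b :: real
  assumes "finite A" "finite B" "card A \<le> a" "card B \<le> b"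
  shows "card (A + B) \<le> a * b"
proof -
  have "real (card (A + B)) \<le> real (card A) * real (card B)"
    using card_sumset_le[OF assms(1,2)] by (metis of_nat_mono of_nat_mult)
  also have "\<dots> \<le> a * b" using assms by (intro mult_mono) auto
  finally show ?thesis .
qed

lemma card_dset_le_real:
  fixes A B :: "'a::ab_group_add set" and a b :: real
  assumes "finite A" "finite B" "card A \<le> a" "card B \<le> b"
  shows "card (dset A B) \<le> a * b"
proof -
  have "real (card (dset A B)) \<le> real (card A) * real (card B)"
    using card_dset_le[OF assms(1,2)] by (metis of_nat_mono of_nat_mult)
  also have "\<dots> \<le> a * b" using assms by (intro mult_mono) auto
  finally show ?thesis .
qed

lemma dset_sumset_subset: "dset (A + B) (C + D) \<subseteq> dset A C + dset B (D :: 'a::ab_group_add set)"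
proof
  fix x assume "x \<in> dset (A + B) (C + D)"
  then obtain a b c d where h: "a \<in> A" "b \<in> B" "c \<in> C" "d \<in> D" "x = a + b - (c + d)"
    by (auto simp: dset_iff elim!: set_plus_elim)
  then have "x = (a - c) + (b - d)" by (simp add: algebra_simps)
  moreover have "a - c \<in> dset A C" "b - d \<in> dset B D" using h by (auto intro: dset_diffI)
  ultimately show "x \<in> dset A C + dset B D" by (simp add: set_plus_intro)
qed

lemma dset_symmetric:
  fixes H :: "'a::ab_group_add set"
  assumes "\<And>h. h \<in> H \<Longrightarrow> - h \<in> H"
  shows "dset H H \<subseteq> H + H"
proof
  fix x assume "x \<in> dset H H"
  then obtain a b where "a \<in> H" "b \<in> H" "x = a + - b" by (auto simp: dset_iff)
  then show "x \<in> H + H" using assms by (metis set_plus_intro)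
qed

section \<open>One approximate group for many dilates\<close>

context prime_field
begin

text \<open>The edges are the pairs \<open>(l * x, y)\<close>, so that the hypothesis speaks of
  sums; since \<open>l\<close> is invertible, the resulting subset of l B is pulled back to
  \<open>A'\<close> in \<open>B\<close>.\<close>

lemma dilate_bsg:
  fixes M K :: real
  assumes B: "B \<subseteq> F" and l: "l \<in> F" "l \<noteq> 0" and C: "finite C"
    and cB: "card B \<le> M" and cC: "card C \<le> M"
    and cE: "M\<^sup>2 / K \<le> card {(x, y). x \<in> B \<and> y \<in> B \<and> l * x + y \<in> C}"
    and K: "2 \<le> K" and M: "0 < M"
  shows "\<exists>A'\<subseteq>B. \<exists>B'\<subseteq>B. \<exists>X\<subseteq>B. M / K ^ 3 \<le> card A' \<and> M / K ^ 6 \<le> card B' \<and>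
     card (dset A' A') \<le> K ^ 22 * M \<and> card X \<le> K ^ 6 \<and> B' \<subseteq> X + (*) l ` dset A' A'"
proof -
  define E where "E = (\<lambda>(x, y). (l * x, y)) ` {(x, y). x \<in> B \<and> y \<in> B \<and> l * x + y \<in> C}"
  have finB: "finite B" using B by (rule finite_sub_F)
  have "inj_on (\<lambda>(x, y). (l * x, y)) {(x, y). x \<in> B \<and> y \<in> B \<and> l * x + y \<in> C}"
    using inj_on_mult[OF l B] by (auto simp: inj_on_def)
  then have "card E = card {(x, y). x \<in> B \<and> y \<in> B \<and> l * x + y \<in> C}" by (simp add: E_def card_image)
  then have cE': "M\<^sup>2 / K \<le> card E" using cE by simp
  have EC: "\<And>a b. (a, b) \<in> E \<Longrightarrow> a + b \<in> C" by (auto simp: E_def)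
  have E: "E \<subseteq> (*) l ` B \<times> B" by (auto simp: E_def)
  have clB: "card ((*) l ` B) \<le> M" using card_dilate[OF l B] cB by simp
  obtain A'' B' X where h: "A'' \<subseteq> (*) l ` B" "B' \<subseteq> B" "X \<subseteq> B" "M / K ^ 3 \<le> card A''" "M / K ^ 6 \<le> card B'"
     "card (dset A'' A'') \<le> K ^ 22 * M" "card X \<le> K ^ 6" "B' \<subseteq> X + dset A'' A''"
    using bsg_cover[OF finite_imageI[OF finB] finB C E clB cB cC cE' EC K M] by blast
  from h(1) obtain A' where A': "A' \<subseteq> B" "A'' = (*) l ` A'" by (meson subset_imageE)
  have "A' \<subseteq> F" using A'(1) B by blast
  then have "card A'' = card A'" "card (dset A'' A'') = card (dset A' A')"
    using card_dilate[OF l] dset_F[of A' A'] by (auto simp: A'(2) simp flip: dilate_dset)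
  then show ?thesis using h A' unfolding dilate_dset
    by (intro exI[of _ A'] exI[of _ B'] exI[of _ X] conjI) auto
qed

text \<open>The sets \<open>A' l\<close> and \<open>B' l\<close> obtained for the various
  \<open>l\<close> need not be related. One \<open>l0\<close> is chosen such that
  \<open>A' l0 \<times> B' l0\<close> meets \<open>A' l \<times> B' l\<close> largely for many
  \<open>l\<close>, and \<open>H\<close> is made from \<open>A' l0\<close>. Overlap of the first
  factors compares \<open>A' l\<close> with \<open>H\<close>, hence \<open>B' l\<close> with l H;
  overlap of the second factors compares l H with l0 H. The dilators are the quotients of such
  \<open>l\<close> by \<open>l0\<close>.\<close>

lemma many_dilates:
  fixes M K :: real
  assumes B: "B \<subseteq> F" and L: "L \<subseteq> F" "0 \<notin> L" and cL: "M / K \<le> card L"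
    and C: "\<And>l. l \<in> L \<Longrightarrow> finite (C l)" "\<And>l. l \<in> L \<Longrightarrow> card (C l) \<le> M"
    and cB: "card B \<le> M"
    and cE: "\<And>l. l \<in> L \<Longrightarrow> M\<^sup>2 / K \<le> card {(x, y). x \<in> B \<and> y \<in> B \<and> l * x + y \<in> C l}"
    and K: "2 \<le> K" and M: "0 < M"
  shows "\<exists>H X L'. H \<subseteq> F \<and> L' \<subseteq> F \<and> finite X \<and> 0 \<in> H \<and> (\<forall>h\<in>H. - h \<in> H) \<and> H + H \<subseteq> X + H \<and>
    card X \<le> K ^ 616 \<and> M / K ^ 44 \<le> card H \<and> card H \<le> K ^ 242 * M \<and> M / K ^ 20 \<le> card L' \<and>
    (\<forall>l\<in>L'. \<exists>Y. finite Y \<and> card Y \<le> K ^ 15840 \<and> (*) l ` H \<subseteq> Y + H)"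
proof -
  have K1: "1 \<le> K" using K by simp
  have finB: "finite B" and finL: "finite L" using B L by (auto intro: finite_sub_F)
  define good where "good l A' B' X \<longleftrightarrow> A' \<subseteq> B \<and> B' \<subseteq> B \<and> X \<subseteq> B \<and> M / K ^ 3 \<le> card A' \<and> M / K ^ 6 \<le> card B' \<and>
     card (dset A' A') \<le> K ^ 22 * M \<and> card X \<le> K ^ 6 \<and> B' \<subseteq> X + (*) l ` dset A' A'" for l A' B' X
  have "\<exists>A' B' X. good l A' B' X" if l: "l \<in> L" for l
  proof -
    have "l \<in> F" "l \<noteq> 0" using l L by auto
    from dilate_bsg[OF B this C(1)[OF l] cB C(2)[OF l] cE[OF l] K M]
    show ?thesis unfolding good_def by blast
  qed
  then obtain A' B' X' where "\<And>l. l \<in> L \<Longrightarrow> good l (A' l) (B' l) (X' l)" by metis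
  then have g: "A' l \<subseteq> B" "B' l \<subseteq> B" "X' l \<subseteq> B" "M / K ^ 3 \<le> card (A' l)" "M / K ^ 6 \<le> card (B' l)"
     "card (dset (A' l) (A' l)) \<le> K ^ 22 * M" "card (X' l) \<le> K ^ 6" "B' l \<subseteq> X' l + (*) l ` dset (A' l) (A' l)"
    if "l \<in> L" for l using that unfolding good_def by auto
  have fin: "finite (A' l)" "finite (B' l)" "finite (X' l)" if "l \<in> L" for l
    using g[OF that] finB by (auto intro: finite_subset)
  have "0 < M / K" using M K by simp
  then have neL: "L \<noteq> {}" using cL by auto
  have cBB: "card (B \<times> B) \<le> M\<^sup>2" using cB by (simp add: card_cartesian_product power2_eq_square mult_mono)
  \<comment> \<open>Products are intersected so that one selection controls both factors; relative
    to M^2 their size is at least K^-9, from the exponents 3 and 6.\<close>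
  have "\<exists>l0\<in>L. \<exists>L'\<subseteq>L. card L / (2 * (K ^ 9)\<^sup>2) \<le> card L' \<and>
     (\<forall>l\<in>L'. M\<^sup>2 / (2 * (K ^ 9)\<^sup>2) \<le> card ((A' l \<times> B' l) \<inter> (A' l0 \<times> B' l0)))"
  proof (rule common_intersection[OF finL neL _ cBB])
    fix l assume l: "l \<in> L"
    show "A' l \<times> B' l \<subseteq> B \<times> B" using g[OF l] by auto
    have "M\<^sup>2 / K ^ 9 = (M / K ^ 3) * (M / K ^ 6)" by (simp add: power2_eq_square flip: power_add)
    also have "\<dots> \<le> real (card (A' l)) * real (card (B' l))" using g(4,5)[OF l] M K by (intro mult_mono) auto
    finally show "M\<^sup>2 / K ^ 9 \<le> card (A' l \<times> B' l)" by (simp add: card_cartesian_product)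
  qed (use finB M K in auto)
  then obtain l0 L0 where l0: "l0 \<in> L" and L0: "L0 \<subseteq> L" "card L / (2 * (K ^ 9)\<^sup>2) \<le> card L0"
    and inter: "\<And>l. l \<in> L0 \<Longrightarrow> M\<^sup>2 / (2 * (K ^ 9)\<^sup>2) \<le> card ((A' l \<times> B' l) \<inter> (A' l0 \<times> B' l0))" by blast
  have K19: "2 * (K ^ 9)\<^sup>2 \<le> K ^ 19"
  proof -
    have "2 * (K ^ 9)\<^sup>2 = 2 * K ^ 18" by (simp flip: power_mult)
    also have "\<dots> \<le> K * K ^ 18" using K by (intro mult_right_mono) auto
    finally show ?thesis by (simp flip: power_Suc)
  qed
  have iA: "M / K ^ 19 \<le> card (A' l \<inter> A' l0)" and iB: "M / K ^ 19 \<le> card (B' l \<inter> B' l0)" if l: "l \<in> L0" for l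
  proof -
    have lL: "l \<in> L" using l L0 by auto
    have cA: "card (A' l \<inter> A' l0) \<le> M" and cB': "card (B' l \<inter> B' l0) \<le> M"
    proof -
      have "card (A' l \<inter> A' l0) \<le> card B" "card (B' l \<inter> B' l0) \<le> card B"
        using g(1,2)[OF lL] finB by (auto intro!: card_mono)
      then show "card (A' l \<inter> A' l0) \<le> M" "card (B' l \<inter> B' l0) \<le> M" using cB by auto
    qed
    have "M\<^sup>2 / K ^ 19 \<le> M\<^sup>2 / (2 * (K ^ 9)\<^sup>2)" using K K19 by (intro divide_left_mono) auto
    also have "\<dots> \<le> card (A' l \<inter> A' l0) * real (card (B' l \<inter> B' l0))"
      using inter[OF l] by (simp add: Times_Int_Times card_cartesian_product)
    finally have *: "M * (M / K ^ 19) \<le> card (A' l \<inter> A' l0) * real (card (B' l \<inter> B' l0))"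
      by (simp add: power2_eq_square)
    have "M * (M / K ^ 19) \<le> M * real (card (B' l \<inter> B' l0))"
      using * mult_right_mono[OF cA, of "real (card (B' l \<inter> B' l0))"] by simp
    then show "M / K ^ 19 \<le> card (B' l \<inter> B' l0)" using M by (rule mult_left_le_imp_le)
    have "M * (M / K ^ 19) \<le> M * real (card (A' l \<inter> A' l0))"
      using * mult_left_mono[OF cB', of "real (card (A' l \<inter> A' l0))"] by (simp add: mult.commute)
    then show "M / K ^ 19 \<le> card (A' l \<inter> A' l0)" using M by (rule mult_left_le_imp_le)
  qed
  have KK: "2 \<le> K ^ 22" using K power_increasing[of 1 22 K] by simp
  have cA0: "M / K ^ 22 \<le> card (A' l0)"
  proof -
    have "M / K ^ 22 \<le> M / K ^ 3" using M K1 by (intro divide_left_mono power_increasing) auto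
    then show ?thesis using g(4)[OF l0] by linarith
  qed
  obtain H X Z where H: "finite H" "finite X" "finite Z" "0 \<in> H" "\<forall>h\<in>H. - h \<in> H"
    "H \<subseteq> dset (A' l0) (A' l0) + dset (A' l0) (A' l0)" "A' l0 \<subseteq> Z + H" "H + H \<subseteq> X + H"
    "card Z \<le> (K ^ 22) ^ 8" "card X \<le> (K ^ 22) ^ 28" "M / (K ^ 22)\<^sup>2 \<le> card H" "card H \<le> (K ^ 22) ^ 11 * M"
    using approx_group[OF fin(1)[OF l0] M KK cA0 g(6)[OF l0]] by blast
  \<comment> \<open>The parameter of \<open>approx_group\<close> is K^22, the doubling loss of
    \<open>bsg\<close>; its exponents 8, 28, 2 and 11 are multiplied by 22.\<close>
  have cZ: "card Z \<le> K ^ 176" and cX: "card X \<le> K ^ 616" and cH: "M / K ^ 44 \<le> card H" "card H \<le> K ^ 242 * M"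
    using H(9-12) by (simp_all flip: power_mult)
  have HF: "H \<subseteq> F"
  proof -
    have "A' l0 \<subseteq> F" using g(1)[OF l0] B by auto
    then have "dset (A' l0) (A' l0) + dset (A' l0) (A' l0) \<subseteq> F" by (intro sumset_F dset_F)
    then show ?thesis using H(6) by (rule order_trans[rotated])
  qed
  have HH: "dset H H \<subseteq> X + H" using dset_symmetric[of H] H(5,8) by blast
  \<comment> \<open>\<open>A' l\<close> is covered by translates of V - V for V =
    \<open>A' l \<inter> A' l0\<close>, and V lies in few translates of \<open>H\<close>. Exponents:
    41 = 22 + 19, 1009 = 41 + 2 * 176 + 616, 2634 = 2 * 1009 + 616, and 6 more for
    \<open>X' l\<close>.\<close>
  have cover: "\<exists>Y. finite Y \<and> card Y \<le> K ^ 2640 \<and> B' l \<subseteq> Y + (*) l ` H"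
    if l: "l \<in> L" and V: "M / K ^ 19 \<le> card (A' l \<inter> A' l0)" for l
  proof -
    let ?V = "A' l \<inter> A' l0"
    have "0 < M / K ^ 19" using M K by simp
    then have neV: "?V \<noteq> {}" using V by (metis card.empty of_nat_0 not_less)
    obtain Y where Y: "Y \<subseteq> A' l" "card Y * card ?V \<le> card (dset (A' l) ?V)" "A' l \<subseteq> Y + dset ?V ?V"
      using ruzsa_cover_diff[OF fin(1)[OF l] _ neV] fin(1)[OF l] by auto
    have finY: "finite Y" using Y fin(1)[OF l] finite_subset by blast
    have "card (dset (A' l) ?V) \<le> card (dset (A' l) (A' l))"
      using fin(1)[OF l] by (intro card_mono dset_mono finite_dset) auto
    then have "real (card Y) * real (card ?V) \<le> K ^ 22 * M" using Y(2) g(6)[OF l]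
      by (metis of_nat_mono of_nat_mult order_trans)
    moreover have "card Y * (M / K ^ 19) \<le> real (card Y) * real (card ?V)" using V by (intro mult_left_mono) auto
    ultimately have "card Y * (M / K ^ 19) \<le> K ^ 22 * M" by linarith
    then have "card Y \<le> K ^ 22 * K ^ 19" using M K by (simp add: field_simps)
    then have cY: "card Y \<le> K ^ 41" by (simp flip: power_add)
    have "dset ?V ?V \<subseteq> dset (Z + H) (Z + H)" using H(7) by (intro dset_mono) auto
    also have "\<dots> \<subseteq> dset Z Z + dset H H" by (rule dset_sumset_subset)
    also have "\<dots> \<subseteq> dset Z Z + (X + H)" using HH by (intro set_plus_mono2) auto
    finally have "Y + dset ?V ?V \<subseteq> Y + (dset Z Z + (X + H))" by (intro set_plus_mono2) auto
    then have A1: "A' l \<subseteq> (Y + (dset Z Z + X)) + H" using Y(3) by (simp add: add.assoc)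
    define Y1 where "Y1 = Y + (dset Z Z + X)"
    have finY1: "finite Y1" unfolding Y1_def using finY H by (intro finite_set_plus finite_dset)
    have "card Y1 \<le> K ^ 41 * ((K ^ 176 * K ^ 176) * K ^ 616)"
      unfolding Y1_def using finY H(2,3) cY cZ cX
      by (intro card_sumset_le_real card_dset_le_real finite_set_plus finite_dset)
    then have cY1: "card Y1 \<le> K ^ 1009" by (simp flip: power_add)
    have "dset (A' l) (A' l) \<subseteq> dset (Y1 + H) (Y1 + H)" using A1 unfolding Y1_def by (intro dset_mono)
    also have "\<dots> \<subseteq> dset Y1 Y1 + dset H H" by (rule dset_sumset_subset)
    also have "\<dots> \<subseteq> dset Y1 Y1 + (X + H)" using HH by (intro set_plus_mono2) auto
    finally have D: "dset (A' l) (A' l) \<subseteq> (dset Y1 Y1 + X) + H" by (simp add: add.assoc)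
    define Y2 where "Y2 = dset Y1 Y1 + X"
    have finY2: "finite Y2" unfolding Y2_def using finY1 H by (intro finite_set_plus finite_dset)
    have "card Y2 \<le> (K ^ 1009 * K ^ 1009) * K ^ 616"
      unfolding Y2_def using finY1 H(2) cY1 cX
      by (intro card_sumset_le_real card_dset_le_real finite_dset)
    then have cY2: "card Y2 \<le> K ^ 2634" by (simp flip: power_add)
    have "(*) l ` dset (A' l) (A' l) \<subseteq> (*) l ` (Y2 + H)" using D unfolding Y2_def by (rule image_mono)
    also have "\<dots> = (*) l ` Y2 + (*) l ` H" by (rule dilate_sumset)
    finally have "X' l + (*) l ` dset (A' l) (A' l) \<subseteq> X' l + ((*) l ` Y2 + (*) l ` H)" by (intro set_plus_mono2) auto
    then have "B' l \<subseteq> (X' l + (*) l ` Y2) + (*) l ` H" using g(8)[OF l] by (simp add: add.assoc)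
    moreover have "card (X' l + (*) l ` Y2) \<le> K ^ 6 * K ^ 2634"
    proof (intro card_sumset_le_real)
      have "card ((*) l ` Y2) \<le> card Y2" using finY2 by (rule card_image_le)
      then show "card ((*) l ` Y2) \<le> K ^ 2634" using cY2 by linarith
    qed (use fin(3)[OF l] finY2 g(7)[OF l] in auto)
    moreover have "K ^ 6 * K ^ 2634 = K ^ 2640" by (simp flip: power_add)
    ultimately show ?thesis using fin(3)[OF l] finY2
      by (intro exI[of _ "X' l + (*) l ` Y2"]) (auto intro!: finite_set_plus)
  qed
  have "M / K ^ 19 \<le> card (A' l0 \<inter> A' l0)"
  proof -
    have "M / K ^ 19 \<le> M / K ^ 3" using M K1 by (intro divide_left_mono power_increasing) auto
    then show ?thesis using g(4)[OF l0] by simp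
  qed
  from cover[OF l0 this] obtain Y0 where Y0: "finite Y0" "card Y0 \<le> K ^ 2640" "B' l0 \<subseteq> Y0 + (*) l0 ` H" by blast
  have l0F: "l0 \<in> F" "l0 \<noteq> 0" using l0 L by auto
  \<comment> \<open>The common part of \<open>B' l\<close> and \<open>B' l0\<close> makes l H and l0
    H commensurable, with 15840 = 6 * 2640; division by \<open>l0\<close> keeps the number of
    translates.\<close>
  have comm: "\<exists>Y. finite Y \<and> card Y \<le> K ^ 15840 \<and> (*) (iv l0 * l) ` H \<subseteq> Y + H" if l: "l \<in> L0" for l
  proof -
    have lL: "l \<in> L" using l L0 by auto
    then have lF: "l \<in> F" "l \<noteq> 0" using L by auto
    from cover[OF lL iA[OF l]] obtain Y1 where
      Y1: "finite Y1" "card Y1 \<le> K ^ 2640" "B' l \<subseteq> Y1 + (*) l ` H" by blast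
    have "\<exists>Y. finite Y \<and> card Y \<le> (K ^ 2640) ^ 6 \<and> (*) l ` H \<subseteq> Y + (*) l0 ` H"
    proof (rule commensurable[where M = M and X = "(*) l0 ` X" and ?X1.0 = Y1 and ?X2.0 = Y0 and W = "B' l \<inter> B' l0"])
      show "M / K ^ 2640 \<le> card (B' l \<inter> B' l0)"
      proof -
        have "M / K ^ 2640 \<le> M / K ^ 19" using M K1 by (intro divide_left_mono power_increasing) auto
        then show ?thesis using iB[OF l] by linarith
      qed
      have "card ((*) l0 ` X) \<le> card X" using H(2) by (rule card_image_le)
      moreover have "card X \<le> K ^ 2640" using cX power_increasing[of 616 2640 K] K1 by simp
      ultimately show "real (card ((*) l0 ` X)) \<le> K ^ 2640" by linarith
      have "(*) l ` H + (*) l ` H = (*) l ` (H + H)" by (rule dilate_sumset[symmetric])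
      then have "card ((*) l ` H + (*) l ` H) = card (H + H)"
        using card_dilate[OF lF] sumset_F[OF HF HF] by simp
      also have "\<dots> \<le> card (X + H)" using H by (intro card_mono finite_set_plus)
      finally have "real (card ((*) l ` H + (*) l ` H)) \<le> card (X + H)" by simp
      also have "\<dots> \<le> K ^ 616 * (K ^ 242 * M)" using H(1,2) cX cH(2) by (intro card_sumset_le_real)
      also have "\<dots> = K ^ 858 * M" by (simp flip: power_add mult.assoc)
      also have "\<dots> \<le> (K ^ 2640)\<^sup>2 * M"
      proof -
        have "K ^ 858 \<le> K ^ (2640 * 2)" using K1 by (intro power_increasing) auto
        then show ?thesis using M by (simp add: power_mult)
      qed
      finally show "real (card ((*) l ` H + (*) l ` H)) \<le> (K ^ 2640)\<^sup>2 * M" .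
      have "(*) l0 ` (H + H) \<subseteq> (*) l0 ` (X + H)" using H(8) by (rule image_mono)
      then show "(*) l0 ` H + (*) l0 ` H \<subseteq> (*) l0 ` X + (*) l0 ` H" by (simp add: dilate_sumset)
      show "- q \<in> (*) l0 ` H" if "q \<in> (*) l0 ` H" for q
      proof -
        from that obtain h where "h \<in> H" "q = l0 * h" by auto
        then have "- q = l0 * (- h)" "- h \<in> H" using H(5) by auto
        then show ?thesis by blast
      qed
      show "B' l \<inter> B' l0 \<subseteq> Y1 + (*) l ` H" using Y1 by auto
      show "B' l \<inter> B' l0 \<subseteq> Y0 + (*) l0 ` H" using Y0 by auto
    qed (use H Y1 Y0 M K in auto)
    then obtain Y where Y: "finite Y" "card Y \<le> K ^ 15840" "(*) l ` H \<subseteq> Y + (*) l0 ` H"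
      by (auto simp flip: power_mult)
    have "(*) (iv l0 * l) ` H = (*) (iv l0) ` ((*) l ` H)" by (simp add: image_image mult.assoc)
    also have "\<dots> \<subseteq> (*) (iv l0) ` (Y + (*) l0 ` H)" using Y(3) by (rule image_mono)
    also have "\<dots> = (*) (iv l0) ` Y + (*) (iv l0) ` ((*) l0 ` H)" by (rule dilate_sumset)
    also have "(*) (iv l0) ` ((*) l0 ` H) = H"
    proof -
      have "iv l0 * (l0 * h) = h" if "h \<in> H" for h using iv_cancel(1)[OF l0F] that HF by auto
      then show ?thesis by (simp add: image_image)
    qed
    finally have "(*) (iv l0 * l) ` H \<subseteq> (*) (iv l0) ` Y + H" .
    moreover have "card ((*) (iv l0) ` Y) \<le> card Y" using Y(1) by (rule card_image_le)
    ultimately show ?thesis using Y(1,2) by (intro exI[of _ "(*) (iv l0) ` Y"]) auto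
  qed
  define L' where "L' = (*) (iv l0) ` L0"
  have L0F: "L0 \<subseteq> F" using L0 L by auto
  have L'F: "L' \<subseteq> F" unfolding L'_def using iv(1)[OF l0F] L0F by (auto intro: mult_F)
  have "card L' = card L0" unfolding L'_def using iv[OF l0F] L0F by (intro card_dilate)
  moreover have "M / K ^ 20 \<le> card L0"
  proof -
    have "M / K ^ 20 = M / K / K ^ 19" by (simp flip: power_Suc)
    also have "\<dots> \<le> card L / K ^ 19" using cL K by (intro divide_right_mono) auto
    also have "\<dots> \<le> card L / (2 * (K ^ 9)\<^sup>2)" using K19 K by (intro divide_left_mono) auto
    finally show ?thesis using L0(2) by linarith
  qed
  ultimately have cL': "M / K ^ 20 \<le> card L'" by simp
  have "\<forall>l\<in>L'. \<exists>Y. finite Y \<and> card Y \<le> K ^ 15840 \<and> (*) l ` H \<subseteq> Y + H" using comm by (auto simp: L'_def)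
  then show ?thesis using HF L'F H cX cH cL'
    by (intro exI[of _ H] exI[of _ X] exI[of _ L'] conjI)
qed

end

section \<open>Dilators of an approximate group\<close>

locale approx_group_in = prime_field +
  fixes H X :: "'a set" and k :: real
  assumes H_F: "H \<subseteq> F" and zero_H: "0 \<in> H" and neg_H: "h \<in> H \<Longrightarrow> - h \<in> H"
    and H_plus: "H + H \<subseteq> X + H" and fin_X: "finite X" and card_X: "card X \<le> k" and k1: "1 \<le> k"
begin

text \<open>Closure under the field operations holds only approximately; the index counts the
  factors \<open>k\<close> lost, so that every operation has a definite cost.\<close>

definition dilators :: "nat \<Rightarrow> 'a set" where
  "dilators i = {l\<in>F. \<exists>Y. finite Y \<and> card Y \<le> k ^ i \<and> (*) l ` H \<subseteq> Y + H}"

lemma fin_H: "finite H"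
  using H_F by (rule finite_sub_F)

lemma dilatorsI: "l \<in> F \<Longrightarrow> finite Y \<Longrightarrow> card Y \<le> k ^ i \<Longrightarrow> (*) l ` H \<subseteq> Y + H \<Longrightarrow> l \<in> dilators i"
  unfolding dilators_def by blast

lemma dilatorsE:
  assumes "l \<in> dilators i"
  obtains Y where "l \<in> F" "finite Y" "card Y \<le> k ^ i" "(*) l ` H \<subseteq> Y + H"
  using assms unfolding dilators_def by blast

lemma dilators_F: "dilators i \<subseteq> F"
  by (auto simp: dilators_def)

lemma dilators_mono:
  assumes "i \<le> j" shows "dilators i \<subseteq> dilators j"
proof
  fix l assume "l \<in> dilators i"
  then obtain Y where Y: "l \<in> F" "finite Y" "card Y \<le> k ^ i" "(*) l ` H \<subseteq> Y + H" by (rule dilatorsE)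
  have "k ^ i \<le> k ^ j" using k1 assms by (intro power_increasing)
  then have "card Y \<le> k ^ j" using Y(3) by linarith
  then show "l \<in> dilators j" using Y by (intro dilatorsI)
qed

lemma dilators_unit: "e \<in> dilators 0"
proof (rule dilatorsI)
  have "e * h = h" if "h \<in> H" for h using that H_F unit by auto
  then show "(*) e ` H \<subseteq> {0} + H" by (simp add: set_add_0 image_subset_iff)
qed (use e_F in auto)

text \<open>(l + m) H lies in l H + m H, hence in translates of H + H; the return to
  \<open>H\<close> costs one more factor \<open>k\<close>.\<close>

lemma dilators_add:
  assumes "l \<in> dilators i" "m \<in> dilators j"
  shows "l + m \<in> dilators (i + j + 1)"
proof -
  obtain Y where Y: "l \<in> F" "finite Y" "card Y \<le> k ^ i" "(*) l ` H \<subseteq> Y + H" using assms(1) by (rule dilatorsE)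
  obtain Z where Z: "m \<in> F" "finite Z" "card Z \<le> k ^ j" "(*) m ` H \<subseteq> Z + H" using assms(2) by (rule dilatorsE)
  have "(*) (l + m) ` H \<subseteq> (*) l ` H + (*) m ` H"
    by (auto simp: distrib_right intro: set_plus_intro)
  also have "\<dots> \<subseteq> (Y + H) + (Z + H)" using Y Z by (intro set_plus_mono2)
  also have "\<dots> = (Y + Z) + (H + H)" by (simp add: ac_simps)
  also have "\<dots> \<subseteq> (Y + Z) + (X + H)" by (rule set_plus_mono2[OF order_refl H_plus])
  also have "\<dots> = (Y + Z + X) + H" by (simp add: add.assoc)
  finally have 1: "(*) (l + m) ` H \<subseteq> (Y + Z + X) + H" .
  have "card (Y + Z + X) \<le> k ^ i * k ^ j * k"
    using Y Z fin_X card_X by (intro card_sumset_le_real finite_set_plus)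
  then have "card (Y + Z + X) \<le> k ^ (i + j + 1)" by (simp add: power_add mult_ac)
  then show ?thesis using 1 Y Z fin_X add_F by (intro dilatorsI[of _ "Y + Z + X"] finite_set_plus)
qed

lemma dilators_neg:
  assumes "l \<in> dilators i"
  shows "- l \<in> dilators i"
proof -
  obtain Y where Y: "l \<in> F" "finite Y" "card Y \<le> k ^ i" "(*) l ` H \<subseteq> Y + H" using assms(1) by (rule dilatorsE)
  have "(*) (- l) ` H \<subseteq> (*) l ` H"
  proof
    fix x assume "x \<in> (*) (- l) ` H"
    then obtain h where "h \<in> H" "x = l * (- h)" by auto
    then show "x \<in> (*) l ` H" using neg_H by blast
  qed
  then have "(*) (- l) ` H \<subseteq> Y + H" using Y(4) by (rule order_trans)
  then show ?thesis using Y neg_F by (intro dilatorsI)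
qed

lemma dilators_diff: "l \<in> dilators i \<Longrightarrow> m \<in> dilators j \<Longrightarrow> l - m \<in> dilators (i + j + 1)"
  using dilators_add[of l i "- m" j] dilators_neg[of m j] by simp

lemma dilators_mult:
  assumes "l \<in> dilators i" "m \<in> dilators j"
  shows "l * m \<in> dilators (i + j)"
proof -
  obtain Y where Y: "l \<in> F" "finite Y" "card Y \<le> k ^ i" "(*) l ` H \<subseteq> Y + H" using assms(1) by (rule dilatorsE)
  obtain Z where Z: "m \<in> F" "finite Z" "card Z \<le> k ^ j" "(*) m ` H \<subseteq> Z + H" using assms(2) by (rule dilatorsE)
  have "(*) (l * m) ` H = (*) l ` ((*) m ` H)" by (simp add: image_image mult.assoc)
  also have "\<dots> \<subseteq> (*) l ` (Z + H)" using Z(4) by (rule image_mono)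
  also have "\<dots> = (*) l ` Z + (*) l ` H" by (rule dilate_sumset)
  also have "\<dots> \<subseteq> (*) l ` Z + (Y + H)" using Y by (intro set_plus_mono2) auto
  also have "\<dots> = ((*) l ` Z + Y) + H" by (simp add: add.assoc)
  finally have 1: "(*) (l * m) ` H \<subseteq> ((*) l ` Z + Y) + H" .
  have "card ((*) l ` Z) \<le> card Z" using Z(2) by (rule card_image_le)
  then have "card ((*) l ` Z) \<le> k ^ j" using Z(3) by linarith
  then have "card ((*) l ` Z + Y) \<le> k ^ j * k ^ i"
    using Y Z by (intro card_sumset_le_real finite_imageI)
  then have "card ((*) l ` Z + Y) \<le> k ^ (i + j)" by (simp add: power_add mult.commute)
  then show ?thesis using 1 Y Z mult_F by (intro dilatorsI[of _ "(*) l ` Z + Y"] finite_set_plus finite_imageI)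
qed

lemma dilator_sumset:
  assumes "l \<in> dilators i"
  shows "card (H + (*) l ` H) \<le> k ^ (i + 1) * card H"
proof -
  obtain Y where Y: "l \<in> F" "finite Y" "card Y \<le> k ^ i" "(*) l ` H \<subseteq> Y + H" using assms(1) by (rule dilatorsE)
  have "H + (*) l ` H \<subseteq> H + (Y + H)" using Y by (intro set_plus_mono2) auto
  also have "\<dots> = Y + (H + H)" by (simp add: ac_simps)
  also have "\<dots> \<subseteq> Y + (X + H)" by (rule set_plus_mono2[OF order_refl H_plus])
  finally have "card (H + (*) l ` H) \<le> card (Y + (X + H))"
    using Y(2) fin_X fin_H by (intro card_mono finite_set_plus)
  also have "\<dots> \<le> k ^ i * (k * card H)"
    using Y fin_X fin_H card_X by (intro card_sumset_le_real finite_set_plus order_refl)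
  finally show ?thesis by (simp add: mult_ac)
qed

text \<open>A covering of l H by translates of \<open>H\<close>, divided by \<open>l\<close>, would
  cover \<open>H\<close> by dilates and not conversely. Instead, the inverse dilate of
  \<open>H\<close> plus \<open>H\<close> is a dilate of H + l H, hence small, and Ruzsa covering
  applies.\<close>

lemma dilators_iv:
  assumes "l \<in> dilators i" "l \<noteq> 0"
  shows "iv l \<in> dilators (i + 2)"
proof -
  have lF: "l \<in> F" using assms(1) dilators_F by blast
  note iv = iv[OF lF assms(2)]
  obtain Y where Y: "Y \<subseteq> (*) (iv l) ` H" "card Y * card H \<le> card ((*) (iv l) ` H + H)"
    "(*) (iv l) ` H \<subseteq> Y + dset H H"
    using ruzsa_cover[of "(*) (iv l) ` H" H] fin_H zero_H by auto
  have finY: "finite Y" using Y(1) fin_H finite_subset by blast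
  have "(*) (iv l) ` H + H = (*) (iv l) ` (H + (*) l ` H)"
  proof -
    have "iv l * (l * h) = h" if "h \<in> H" for h using iv_cancel(1)[OF lF assms(2)] that H_F by auto
    then have "(*) (iv l) ` ((*) l ` H) = H" by (simp add: image_image)
    then show ?thesis by (simp add: dilate_sumset)
  qed
  then have "card ((*) (iv l) ` H + H) \<le> card (H + (*) l ` H)"
    using fin_H by (simp add: card_image_le finite_set_plus)
  then have "real (card Y) * real (card H) \<le> card (H + (*) l ` H)"
    using Y(2) by (metis of_nat_mono of_nat_mult order_trans)
  then have "real (card Y) * real (card H) \<le> k ^ (i + 1) * card H"
    using dilator_sumset[OF assms(1)] by linarith
  moreover have "0 < card H" using fin_H zero_H by (auto simp: card_gt_0_iff)
  ultimately have cY: "card Y \<le> k ^ (i + 1)" by simp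
  have "dset H H \<subseteq> X + H" using dset_symmetric[OF neg_H] H_plus by blast
  then have "Y + dset H H \<subseteq> Y + (X + H)" by (intro set_plus_mono2) auto
  then have 1: "(*) (iv l) ` H \<subseteq> (Y + X) + H" using Y(3) by (simp add: add.assoc)
  have "card (Y + X) \<le> k ^ (i + 1) * k" using finY fin_X cY card_X by (intro card_sumset_le_real)
  then have "card (Y + X) \<le> k ^ (i + 2)" by (simp add: mult.commute)
  then show ?thesis using 1 iv(1) finY fin_X by (intro dilatorsI[of _ "Y + X"] finite_set_plus)
qed

text \<open>Here primality enters: a subset of a prime field containing 0 and closed under adding the unit
  is everything, so the quotient set of differences is either all of the field or not closed.\<close>

lemma dilators_grow:
  assumes L: "L \<subseteq> dilators i" and c: "2 \<le> card L"
  shows "F \<subseteq> dilators (6 * i + 6) \<or> (\<exists>L'\<subseteq>dilators (6 * i + 6). card L' = (card L)\<^sup>2)"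
proof -
  define Q where "Q = {(a - b) * iv (c - d) | a b c d. a \<in> L \<and> b \<in> L \<and> c \<in> L \<and> d \<in> L \<and> c \<noteq> d}"
  have LF: "L \<subseteq> F" using L dilators_F by blast
  have finL: "finite L" using LF by (rule finite_sub_F)
  \<comment> \<open>A difference costs 2 i + 1 and an inverted difference 2 i + 3.\<close>
  have Q: "Q \<subseteq> dilators (4 * i + 4)"
  proof
    fix q assume "q \<in> Q"
    then obtain a b c d where h: "a \<in> L" "b \<in> L" "c \<in> L" "d \<in> L" "c \<noteq> d" "q = (a - b) * iv (c - d)"
      unfolding Q_def by blast
    have "a - b \<in> dilators (i + i + 1)" "c - d \<in> dilators (i + i + 1)"
      using h L by (intro dilators_diff; auto)+
    then have "q \<in> dilators ((i + i + 1) + ((i + i + 1) + 2))"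
      unfolding h(6) using h(5) by (intro dilators_mult dilators_iv) auto
    moreover have "(i + i + 1) + ((i + i + 1) + 2) = 4 * i + 4" by simp
    ultimately show "q \<in> dilators (4 * i + 4)" by (simp only:)
  qed
  obtain c0 d0 where cd: "c0 \<in> L" "d0 \<in> L" "c0 \<noteq> d0"
    using c by (metis card_2_iff' card_le_Suc0_iff_eq finL not_less_eq_eq numeral_2_eq_2)
  show ?thesis
  proof (cases "\<forall>r\<in>Q. r + e \<in> Q")
    case True
    have 0: "0 \<in> Q" unfolding Q_def using cd by force
    have n: "of_nat n * e \<in> Q" for n
    proof (induction n)
      case (Suc n)
      then have "of_nat n * e + e \<in> Q" using True by blast
      then show ?case by (simp add: distrib_right add.commute)
    qed (use 0 in simp)
    have "F \<subseteq> Q" using generated n by blast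
    also have "\<dots> \<subseteq> dilators (6 * i + 6)" using Q dilators_mono[of "4 * i + 4" "6 * i + 6"] by auto
    finally show ?thesis by blast
  next
    case False
    then obtain r where r: "r \<in> Q" "r + e \<notin> Q" by blast
    define s where "s = r + e"
    have "s \<in> dilators (4 * i + 4 + 0 + 1)"
      unfolding s_def using r(1) Q by (intro dilators_add dilators_unit) auto
    moreover have "4 * i + 4 + 0 + 1 = 4 * i + 5" by simp
    ultimately have s: "s \<in> dilators (4 * i + 5)" by (simp only:)
    have sF: "s \<in> F" using s dilators_F by blast
    define f where "f = (\<lambda>(a, b). a + s * b)"
    \<comment> \<open>A coincidence a + s b = c + s d with b \<noteq> d would exhibit
      \<open>s\<close> as a quotient of differences.\<close>
    have inj: "inj_on f (L \<times> L)"
    proof (rule inj_onI)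
      fix u v assume uv: "u \<in> L \<times> L" "v \<in> L \<times> L" "f u = f v"
      obtain a b c d where ab: "u = (a, b)" "v = (c, d)" by (metis surj_pair)
      have L4: "a \<in> L" "b \<in> L" "c \<in> L" "d \<in> L" using uv ab by auto
      have eq: "(b - d) * s = c - a" using uv(3) by (simp add: ab f_def algebra_simps)
      have "b = d"
      proof (rule ccontr)
        assume bd: "b \<noteq> d"
        have "b - d \<in> F" "b - d \<noteq> 0" using L4 LF bd by (auto intro: diff_F)
        then have "s = iv (b - d) * ((b - d) * s)" using iv_cancel(1)[of "b - d" s] sF by simp
        then have "s = (c - a) * iv (b - d)" using eq by (simp add: mult.commute)
        then have "s \<in> Q" unfolding Q_def using L4 bd by blast
        then show False using r(2) by (simp add: s_def)
      qed
      then show "u = v" using eq ab by simp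
    qed
    have "f ` (L \<times> L) \<subseteq> dilators (6 * i + 6)"
    proof
      fix x assume "x \<in> f ` (L \<times> L)"
      then obtain a b where ab: "a \<in> L" "b \<in> L" "x = a + s * b" by (auto simp: f_def)
      then have "x \<in> dilators (i + (4 * i + 5 + i) + 1)"
        unfolding ab(3) using L s by (intro dilators_add dilators_mult) auto
      moreover have "i + (4 * i + 5 + i) + 1 = 6 * i + 6" by simp
      ultimately show "x \<in> dilators (6 * i + 6)" by (simp only:)
    qed
    moreover have "card (f ` (L \<times> L)) = (card L)\<^sup>2"
      using inj by (simp add: card_image card_cartesian_product power2_eq_square)
    ultimately show ?thesis by blast
  qed
qed

end

text \<open>The index reached after that many rounds of \<open>dilators_grow\<close>, starting from
  dilators of index 1.\<close>

primrec growth_exponent :: "nat \<Rightarrow> nat" where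
  "growth_exponent 0 = 1"
| "growth_exponent (Suc j) = 6 * growth_exponent j + 6"

context approx_group_in
begin

lemma dilators_iterate:
  assumes L: "L \<subseteq> dilators 1" and c: "2 \<le> card L"
  shows "F \<subseteq> dilators (growth_exponent j) \<or>
    (\<exists>L'\<subseteq>dilators (growth_exponent j). card L' = (card L) ^ (2 ^ j))"
proof (induction j)
  case 0
  then show ?case using L by auto
next
  case (Suc j)
  let ?n = "growth_exponent j"
  have mono: "dilators ?n \<subseteq> dilators (6 * ?n + 6)" by (rule dilators_mono) simp
  from Suc show ?case
  proof
    assume "F \<subseteq> dilators ?n"
    then show ?case using mono by auto
  next
    assume "\<exists>L'\<subseteq>dilators ?n. card L' = (card L) ^ (2 ^ j)"
    then obtain L' where L': "L' \<subseteq> dilators ?n" "card L' = (card L) ^ (2 ^ j)" by blast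
    have "2 \<le> card L'" using L'(2) c self_le_power[of "card L" "2 ^ j"] by auto
    from dilators_grow[OF L'(1) this] show ?case
      by (simp add: L'(2) mult.commute flip: power_mult)
  qed
qed

text \<open>Cauchy-Schwarz bounds |H|^4 by |H + r H| times the number of solutions of a + r b = c +
  r d in \<open>H\<close>. Summed over \<open>r\<close>, each of the |H|^2 trivial solutions counts
  |F| times and any other at most once, since it determines \<open>r\<close>.\<close>

lemma average_dilate:
  fixes T :: real
  assumes T: "\<And>r. r \<in> F \<Longrightarrow> card (H + (*) r ` H) \<le> T * card H" and T0: "0 \<le> T"
  shows "card F * card H \<le> T * (card F + (real (card H))\<^sup>2)"
proof -
  define coll where "coll r = {(u, v). u \<in> H \<times> H \<and> v \<in> H \<times> H \<and> fst u + r * snd u = fst v + r * snd v}" for r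
  have H0: "0 < card H" using fin_H zero_H by (auto simp: card_gt_0_iff)
  have c1: "(real (card H)) ^ 3 \<le> T * card (coll r)" if r: "r \<in> F" for r
  proof -
    have im: "(\<lambda>u. fst u + r * snd u) ` (H \<times> H) = H + (*) r ` H"
      by (force simp: set_plus_def image_iff)
    have "(real (card (H \<times> H)))\<^sup>2 \<le> real (card (H + (*) r ` H)) * card (coll r)"
      using card_collisions_ge[of "H \<times> H" "\<lambda>u. fst u + r * snd u"] fin_H by (simp only: im coll_def finite_SigmaI of_nat_mult)
    also have "\<dots> \<le> (T * card H) * card (coll r)" using T[OF r] by (intro mult_right_mono) auto
    finally have "card H * (real (card H)) ^ 3 \<le> card H * (T * card (coll r))"
      by (simp add: card_cartesian_product power2_eq_square eval_nat_numeral mult_ac)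
    then show ?thesis using H0 by (simp only: mult_le_cancel_left_pos of_nat_0_less_iff)
  qed
  define U where "U = (H \<times> H) \<times> (H \<times> H)"
  define R where "R = {(r, w). r \<in> F \<and> w \<in> coll r}"
  have R: "R \<subseteq> F \<times> U" by (auto simp: R_def coll_def U_def)
  have finU: "finite U" using fin_H by (simp add: U_def)
  have f1: "card {r. (r, w) \<in> R} \<le> 1" if w: "w \<in> U" "fst w \<noteq> snd w" for w
  proof -
    obtain a b c d where w': "w = ((a, b), (c, d))" by (metis surj_pair)
    have abF: "a \<in> F" "b \<in> F" "c \<in> F" "d \<in> F" using w H_F by (auto simp: U_def w')
    have "x = y" if "x \<in> {r. (r, w) \<in> R}" "y \<in> {r. (r, w) \<in> R}" for x y
    proof -
      have xy: "x \<in> F" "y \<in> F" "a + x * b = c + x * d" "a + y * b = c + y * d"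
        using that by (auto simp: R_def coll_def w')
      have "b \<noteq> d" using xy(3) w(2) by (auto simp: w')
      moreover have "(b - d) * x = c - a" "(b - d) * y = c - a" using xy(3,4) by (simp_all add: algebra_simps)
      ultimately show "x = y" using mult_cancel[of "b - d" x y] xy abF by (auto intro: diff_F)
    qed
    then have "finite {r. (r, w) \<in> R}" "\<forall>x\<in>{r. (r, w) \<in> R}. \<forall>y\<in>{r. (r, w) \<in> R}. x = y"
      using finite_subset[of "{r. (r, w) \<in> R}" F] by (auto simp: R_def)
    then show ?thesis by (simp add: card_le_Suc0_iff_eq)
  qed
  have f2: "card {r. (r, w) \<in> R} \<le> card F" for w
    by (intro card_mono) (auto simp: R_def)
  have "card F * (real (card H)) ^ 3 = (\<Sum>r\<in>F. (real (card H)) ^ 3)" by simp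
  also have "\<dots> \<le> (\<Sum>r\<in>F. T * card (coll r))" using c1 by (rule sum_mono)
  also have "\<dots> = T * (\<Sum>r\<in>F. real (card {w. (r, w) \<in> R}))"
    by (simp add: R_def flip: sum_distrib_left)
  also have "(\<Sum>r\<in>F. real (card {w. (r, w) \<in> R})) = (\<Sum>w\<in>U. real (card {r. (r, w) \<in> R}))"
    using card_Sigma_sum[OF fin_F finU R] by (simp flip: of_nat_sum)
  also have "\<dots> \<le> (\<Sum>w\<in>U. (if w \<in> (\<lambda>u. (u, u)) ` (H \<times> H) then real (card F) else 0) + 1)"
  proof (rule sum_mono)
    fix w assume w: "w \<in> U"
    show "real (card {r. (r, w) \<in> R}) \<le> (if w \<in> (\<lambda>u. (u, u)) ` (H \<times> H) then real (card F) else 0) + 1"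
    proof (cases "fst w = snd w")
      case True
      then have "w \<in> (\<lambda>u. (u, u)) ` (H \<times> H)" using w by (auto simp: U_def)
      then show ?thesis using f2[of w] by simp
    next
      case False
      then show ?thesis using f1[OF w False] by simp
    qed
  qed
  also have "\<dots> = card F * (real (card H))\<^sup>2 + (real (card H)) ^ 4"
  proof -
    have "U \<inter> (\<lambda>u. (u, u)) ` (H \<times> H) = (\<lambda>u. (u, u)) ` (H \<times> H)" by (auto simp: U_def)
    then have "(\<Sum>w\<in>U. if w \<in> (\<lambda>u. (u, u)) ` (H \<times> H) then real (card F) else 0) = (\<Sum>w\<in>(\<lambda>u. (u, u)) ` (H \<times> H). real (card F))"
      using sum.inter_restrict[OF finU, of "\<lambda>_. real (card F)" "(\<lambda>u. (u, u)) ` (H \<times> H)"] by simp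
    also have "\<dots> = card F * (real (card H))\<^sup>2"
      by (simp add: card_image inj_on_def card_cartesian_product power2_eq_square)
    finally show ?thesis
      by (simp add: sum.distrib) (simp add: U_def card_cartesian_product eval_nat_numeral)
  qed
  finally have "card F * (real (card H)) ^ 3 \<le> T * (card F * (real (card H))\<^sup>2 + (real (card H)) ^ 4)"
    using T0 by (simp add: mult_left_mono)
  then have "(real (card H))\<^sup>2 * (card F * card H) \<le> (real (card H))\<^sup>2 * (T * (card F + (real (card H))\<^sup>2))"
    by (simp add: eval_nat_numeral algebra_simps)
  moreover have "0 < (real (card H))\<^sup>2" using H0 by simp
  ultimately show ?thesis by (rule mult_left_le_imp_le)
qed

end

section \<open>The sum-product theorem\<close>

context prime_field
begin

text \<open>By hypothesis \<open>j\<close>, squaring the number of dilators \<open>j\<close> times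
  would exceed |F|, so growth can only end with every element a dilator. Then H + r H is small for
  all \<open>r\<close>, and \<open>average_dilate\<close> leaves two cases: |F| \<le> |H|^2 gives
  |F| \<le> 2 T |H|, and otherwise |H| \<le> 2 T.\<close>

theorem sum_product_core:
  fixes M K :: real
  assumes B: "B \<subseteq> F" and L: "L \<subseteq> F" "0 \<notin> L" and cL: "M / K \<le> card L"
    and C: "\<And>l. l \<in> L \<Longrightarrow> finite (C l)" "\<And>l. l \<in> L \<Longrightarrow> card (C l) \<le> M"
    and cB: "card B \<le> M"
    and cE: "\<And>l. l \<in> L \<Longrightarrow> M\<^sup>2 / K \<le> card {(x, y). x \<in> B \<and> y \<in> B \<and> l * x + y \<in> C l}"
    and K: "2 \<le> K" and M: "0 < M" and j: "card F < (M / K ^ 20) ^ (2 ^ j)"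
  defines "n \<equiv> 15840 * (growth_exponent j + 1) + 243"
  shows "M \<le> K ^ n \<or> card F \<le> K ^ n * M"
proof -
  obtain H X L' where H: "H \<subseteq> F" "L' \<subseteq> F" "finite X" "0 \<in> H" "\<forall>h\<in>H. - h \<in> H" "H + H \<subseteq> X + H"
    "card X \<le> K ^ 616" "M / K ^ 44 \<le> card H" "card H \<le> K ^ 242 * M" "M / K ^ 20 \<le> card L'"
    "\<forall>l\<in>L'. \<exists>Y. finite Y \<and> card Y \<le> K ^ 15840 \<and> (*) l ` H \<subseteq> Y + H"
  proof -
    have "\<exists>H X L'. H \<subseteq> F \<and> L' \<subseteq> F \<and> finite X \<and> 0 \<in> H \<and> (\<forall>h\<in>H. - h \<in> H) \<and> H + H \<subseteq> X + H \<and>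
      card X \<le> K ^ 616 \<and> M / K ^ 44 \<le> card H \<and> card H \<le> K ^ 242 * M \<and> M / K ^ 20 \<le> card L' \<and>
      (\<forall>l\<in>L'. \<exists>Y. finite Y \<and> card Y \<le> K ^ 15840 \<and> (*) l ` H \<subseteq> Y + H)"
      by (rule many_dilates[OF B L cL C cB cE K M])
    then show ?thesis by (elim exE conjE) (rule that)
  qed
  have K1: "1 \<le> K" using K by simp
  interpret approx_group_in F e H X "K ^ 15840"
  proof
    have "K ^ 616 \<le> K ^ 15840" using K1 by (intro power_increasing) auto
    then show "card X \<le> K ^ 15840" using H(7) by linarith
    show "1 \<le> K ^ 15840" using K1 by (rule one_le_power)
  qed (use H in auto)
  let ?n = "growth_exponent j"
  have L'1: "L' \<subseteq> dilators 1"
  proof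
    fix l assume "l \<in> L'"
    then obtain Y where "finite Y" "card Y \<le> K ^ 15840" "(*) l ` H \<subseteq> Y + H" using H(11) by blast
    then show "l \<in> dilators 1" using \<open>l \<in> L'\<close> H(2) by (intro dilatorsI) auto
  qed
  have F0: "1 \<le> card F" using e_F by (auto simp: Suc_le_eq card_gt_0_iff)
  have big: "card F < (card L') ^ (2 ^ j)"
  proof -
    have "(M / K ^ 20) ^ (2 ^ j) \<le> (real (card L')) ^ (2 ^ j)" using H(10) M K by (intro power_mono) auto
    with j have "real (card F) < (real (card L')) ^ (2 ^ j)" by (rule less_le_trans)
    then show ?thesis by (simp only: of_nat_less_iff flip: of_nat_power)
  qed
  have "2 \<le> card L'"
  proof (rule ccontr)
    assume "\<not> 2 \<le> card L'"
    then have "card L' \<le> 1" by simp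
    then have "(card L') ^ (2 ^ j) \<le> 1 ^ (2 ^ j)" by (intro power_mono) auto
    then have "(card L') ^ (2 ^ j) \<le> 1" by simp
    then show False using big F0 by linarith
  qed
  have "F \<subseteq> dilators ?n"
    using dilators_iterate[OF L'1 \<open>2 \<le> card L'\<close>, of j]
  proof
    assume "\<exists>L''\<subseteq>dilators ?n. card L'' = (card L') ^ (2 ^ j)"
    then obtain L'' where "L'' \<subseteq> dilators ?n" "card L'' = (card L') ^ (2 ^ j)" by blast
    moreover from this have "card L'' \<le> card F" using dilators_F by (intro card_mono) auto
    ultimately show ?thesis using big by simp
  qed
  then have sm: "card (H + (*) r ` H) \<le> (K ^ 15840) ^ (?n + 1) * card H" if "r \<in> F" for r
    using dilator_sumset[of r ?n] that by blast
  define T where "T = K ^ (15840 * (?n + 1))"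
  have T: "T = (K ^ 15840) ^ (?n + 1)" unfolding T_def by (rule power_mult)
  have T0: "0 < T" using K by (simp add: T_def)
  have av: "card F * card H \<le> T * (card F + (real (card H))\<^sup>2)"
    using average_dilate[of T] sm T0 unfolding T by auto
  \<comment> \<open>243 = 242 + 1: the bound of |H| by K^242 M, and one factor \<open>K\<close> to
    absorb 2.\<close>
  have n2: "K ^ n = T * (K ^ 242 * K)"
  proof -
    have "n = 15840 * (?n + 1) + (242 + 1)" by (simp add: n_def)
    then show ?thesis unfolding T_def by (simp only: power_add power_one_right)
  qed
  have H0: "0 < real (card H)" using fin_H zero_H by (auto simp: card_gt_0_iff)
  show ?thesis
  proof (cases "real (card F) \<le> (real (card H))\<^sup>2")
    case True
    have "card F * card H \<le> T * (2 * (real (card H))\<^sup>2)"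
      by (rule order_trans[OF av]) (use True T0 in \<open>intro mult_left_mono; simp\<close>)
    then have "real (card F) * card H \<le> (2 * T * card H) * card H" by (simp add: power2_eq_square mult_ac)
    then have "real (card F) \<le> 2 * T * card H" using H0 by (simp only: mult_le_cancel_right_pos)
    also have "\<dots> \<le> 2 * T * (K ^ 242 * M)" using H(9) T0 by (intro mult_left_mono) auto
    also have "\<dots> \<le> K * T * (K ^ 242 * M)" using K T0 M by (intro mult_right_mono) auto
    also have "\<dots> = K ^ n * M" unfolding n2 by (simp only: mult_ac)
    finally show ?thesis by blast
  next
    case False
    have "card F * card H \<le> T * (2 * real (card F))"
      by (rule order_trans[OF av]) (use False T0 in \<open>intro mult_left_mono; simp\<close>)
    then have "card F * real (card H) \<le> card F * (2 * T)" by (simp only: of_nat_mult mult_ac)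
    then have "real (card H) \<le> 2 * T" using F0 by simp
    then have "M / K ^ 44 \<le> 2 * T" using H(8) by linarith
    then have "M \<le> 2 * T * K ^ 44" using K by (simp add: pos_divide_le_eq)
    also have "\<dots> \<le> K * T * K ^ 242"
      using K K1 T0 by (intro mult_mono power_increasing) auto
    also have "\<dots> = K ^ n" unfolding n2 by (simp only: mult_ac)
    finally show ?thesis by blast
  qed
qed

end

section \<open>Lines and pencils\<close>

lemma card_le_functional:
  assumes "finite S" and ex: "\<And>x. x \<in> A \<Longrightarrow> \<exists>y\<in>S. R x y"
    and fn: "\<And>x x' y. x \<in> A \<Longrightarrow> x' \<in> A \<Longrightarrow> y \<in> S \<Longrightarrow> R x y \<Longrightarrow> R x' y \<Longrightarrow> x = x'"
  shows "card A \<le> card S"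
proof -
  define f where "f x = (SOME y. y \<in> S \<and> R x y)" for x
  have f: "f x \<in> S" "R x (f x)" if "x \<in> A" for x
    using someI_ex[of "\<lambda>y. y \<in> S \<and> R x y"] ex[OF that] unfolding f_def by auto
  have "inj_on f A"
  proof (rule inj_onI)
    fix x y assume xy: "x \<in> A" "y \<in> A" "f x = f y"
    have "R y (f x)" using f(2)[OF xy(2)] xy(3) by simp
    then show "x = y" using fn[OF xy(1,2) f(1)[OF xy(1)] f(2)[OF xy(1)]] by simp
  qed
  then show ?thesis using f(1) assms(1) by (intro card_inj_on_le) auto
qed

text \<open>An average over pairs (p1, p2) of the number of \<open>q\<close> joined to both by
  different rich lines. The degree bound gives the pencils through \<open>p1\<close> and
  \<open>p2\<close> only about \<open>s\<close> lines each, so that they form a small grid; l1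
  \<noteq> l2 will keep \<open>q\<close> off the line through \<open>p1\<close> and
  \<open>p2\<close>.\<close>

lemma rich_pair:
  fixes P :: "'a set" and L :: "'a set set" and s K :: real
  assumes fin: "finite P" "finite L" and cP: "card P = s\<^sup>2" and cL: "card L \<le> s\<^sup>2"
    and uniq: "\<And>l l' w w'. l \<in> L \<Longrightarrow> l' \<in> L \<Longrightarrow> w \<noteq> w' \<Longrightarrow> w \<in> l \<Longrightarrow> w \<in> l' \<Longrightarrow> w' \<in> l \<Longrightarrow> w' \<in> l' \<Longrightarrow> l = l'"
    and inc: "s ^ 3 / K \<le> (\<Sum>l\<in>L. real (card (l \<inter> P)))"
    and K: "2 \<le> K" and s: "8 * K \<le> s"
  shows "\<exists>L1\<subseteq>L. \<exists>p1\<in>P. \<exists>p2\<in>P. \<exists>Q\<subseteq>P. (\<forall>p\<in>P. card {l\<in>L1. p \<in> l} \<le> 4 * K * s) \<and>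
    s\<^sup>2 / K ^ 19 \<le> card Q \<and> (\<forall>q\<in>Q. s / (4 * K) \<le> card {l\<in>L1. q \<in> l}) \<and>
    (\<forall>q\<in>Q. q \<noteq> p1 \<and> q \<noteq> p2 \<and> (\<exists>l1\<in>L1. \<exists>l2\<in>L1. l1 \<noteq> l2 \<and> q \<in> l1 \<and> p1 \<in> l1 \<and> q \<in> l2 \<and> p2 \<in> l2))"
proof -
  have s0: "0 < s" using s K by linarith
  \<comment> \<open>Half of the richness s / (2 K) of the lines kept, so that such a line has at
    least \<open>m\<close> points besides any given one. The same \<open>m\<close> is the threshold
    for rich points.\<close>
  define m where "m = s / (4 * K)"
  have m2: "2 \<le> m" using s K by (simp add: m_def field_simps)
  have mm: "s / (2 * K) = 2 * m" by (simp add: m_def)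
  define L1 where "L1 = {l\<in>L. 2 * m \<le> real (card (l \<inter> P))}"
  have finL1: "finite L1" using fin by (simp add: L1_def)
  have L1L: "L1 \<subseteq> L" by (auto simp: L1_def)
  have "card L * (2 * m) \<le> s\<^sup>2 * (2 * m)" using cL m2 by (intro mult_right_mono) auto
  also have "\<dots> = s ^ 3 / K / 2" using K by (simp add: m_def power2_eq_square power3_eq_cube)
  finally have i1: "s ^ 3 / K / 2 \<le> (\<Sum>l\<in>L1. real (card (l \<inter> P)))"
    unfolding L1_def using fin inc m2 by (intro popular_sum) auto
  define deg where "deg p = real (card {l\<in>L1. p \<in> l})" for p
  define nb where "nb q l = l \<inter> P - {q}" for q :: 'a and l
  have finnb: "finite (nb q l)" for q l using fin by (simp add: nb_def)
  have cnb: "m \<le> card (nb q l)" if "l \<in> L1" for q l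
  proof -
    have "card (l \<inter> P) \<le> card (nb q l) + 1"
      unfolding nb_def using diff_card_le_card_Diff[of "{q}" "l \<inter> P"] by simp
    moreover have "2 * m \<le> real (card (l \<inter> P))" using that by (simp add: L1_def)
    ultimately show ?thesis using m2 by linarith
  qed
  \<comment> \<open>The lines through \<open>p\<close> are disjoint away from \<open>p\<close>, and
    each has \<open>m\<close> further points, so at most s^2 / m of them fit.\<close>
  have deg: "deg p \<le> 4 * K * s" if p: "p \<in> P" for p
  proof -
    have "deg p * m = (\<Sum>l\<in>{l\<in>L1. p \<in> l}. m)" by (simp add: deg_def)
    also have "\<dots> \<le> (\<Sum>l\<in>{l\<in>L1. p \<in> l}. real (card (nb p l)))" using cnb by (intro sum_mono) auto
    also have "\<dots> = card (\<Union>l\<in>{l\<in>L1. p \<in> l}. nb p l)"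
    proof -
      have "nb p l \<inter> nb p l' = {}" if "l \<in> L1" "l' \<in> L1" "p \<in> l" "p \<in> l'" "l \<noteq> l'" for l l'
      proof (rule ccontr)
        assume "\<not> ?thesis"
        then obtain w where w: "w \<in> l" "w \<in> l'" "p \<noteq> w" by (auto simp: nb_def)
        have "l \<in> L" "l' \<in> L" using that L1L by auto
        then have "l = l'" using that(3,4) w by (intro uniq[of l l' p w])
        then show False using that(5) by simp
      qed
      then show ?thesis using finL1 finnb by (subst card_UN_disjoint) auto
    qed
    also have "\<dots> \<le> card P" using fin by (intro of_nat_mono card_mono) (auto simp: nb_def)
    also have "\<dots> = (4 * K * s) * m" unfolding cP using K by (simp add: m_def power2_eq_square)
    finally show ?thesis using m2 by (simp only: mult_le_cancel_right_pos)
  qed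
  define I where "I = {(p, l). p \<in> P \<and> l \<in> L1 \<and> p \<in> l}"
  have I: "I \<subseteq> P \<times> L1" by (auto simp: I_def)
  have "(\<Sum>l\<in>L1. real (card (l \<inter> P))) = sum deg P"
  proof -
    have "(\<Sum>l\<in>L1. real (card (l \<inter> P))) = (\<Sum>l\<in>L1. real (card {p. (p, l) \<in> I}))"
      by (intro sum.cong refl arg_cong[where f = "\<lambda>x. real (card x)"]) (auto simp: I_def)
    also have "\<dots> = (\<Sum>p\<in>P. real (card {l. (p, l) \<in> I}))"
      using card_Sigma_sum[OF fin(1) finL1 I] by (simp flip: of_nat_sum)
    also have "\<dots> = sum deg P" unfolding deg_def
      by (intro sum.cong refl arg_cong[where f = "\<lambda>x. real (card x)"]) (auto simp: I_def)
    finally show ?thesis .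
  qed
  with i1 have i2: "s ^ 3 / K / 2 \<le> sum deg P" by simp
  define P1 where "P1 = {p\<in>P. m \<le> deg p}"
  have finP1: "finite P1" using fin by (simp add: P1_def)
  have "card P * m = s ^ 3 / K / 2 / 2" unfolding cP by (simp add: m_def power2_eq_square power3_eq_cube)
  then have "s ^ 3 / K / 2 / 2 \<le> sum deg P1"
    unfolding P1_def using fin i2 m2 by (intro popular_sum) auto
  also have "\<dots> \<le> (\<Sum>p\<in>P1. 4 * K * s)" using deg by (intro sum_mono) (auto simp: P1_def)
  finally have "s ^ 3 / K / 2 / 2 \<le> card P1 * (4 * K * s)" by simp
  moreover have "s ^ 3 / K / 2 / 2 = (s\<^sup>2 / (16 * K\<^sup>2)) * (4 * K * s)"
    using K by (simp add: power2_eq_square power3_eq_cube)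
  ultimately have "(s\<^sup>2 / (16 * K\<^sup>2)) * (4 * K * s) \<le> card P1 * (4 * K * s)" by linarith
  moreover have "0 < 4 * K * s" using K s0 by simp
  ultimately have cP1: "s\<^sup>2 / (16 * K\<^sup>2) \<le> card P1" by (rule mult_right_le_imp_le)
  define R where "R = {(q, (p1, p2)). q \<in> P1 \<and> p1 \<in> P \<and> p2 \<in> P \<and> q \<noteq> p1 \<and> q \<noteq> p2 \<and>
      (\<exists>l1\<in>L1. \<exists>l2\<in>L1. l1 \<noteq> l2 \<and> q \<in> l1 \<and> p1 \<in> l1 \<and> q \<in> l2 \<and> p2 \<in> l2)}"
  have R: "R \<subseteq> P1 \<times> (P \<times> P)" by (auto simp: R_def)
  have finPP: "finite (P \<times> P)" using fin by simp
  \<comment> \<open>At least \<open>m\<close> choices of \<open>l1\<close>, m / 2 of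
    \<open>l2\<close>, and \<open>m\<close> points other than \<open>q\<close> on each.\<close>
  have Rq: "m ^ 4 / 2 \<le> card {x. (q, x) \<in> R}" if q: "q \<in> P1" for q
  proof -
    define Lq where "Lq = {l\<in>L1. q \<in> l}"
    have finLq: "finite Lq" using finL1 by (simp add: Lq_def)
    have cLq: "m \<le> card Lq" using q by (simp add: P1_def Lq_def deg_def)
    define W where "W = (SIGMA l1:Lq. SIGMA l2:Lq - {l1}. nb q l1 \<times> nb q l2)"
    have "m ^ 4 / 2 = m * (m / 2 * (m * m))" by (simp add: eval_nat_numeral)
    also have "\<dots> \<le> card Lq * (m / 2 * (m * m))" using cLq m2 by (intro mult_right_mono) auto
    also have "\<dots> = (\<Sum>l1\<in>Lq. m / 2 * (m * m))" by simp
    also have "\<dots> \<le> (\<Sum>l1\<in>Lq. \<Sum>l2\<in>Lq - {l1}. m * m)"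
    proof (intro sum_mono)
      fix l1 assume "l1 \<in> Lq"
      then have "card (Lq - {l1}) = card Lq - 1" using finLq by simp
      moreover have "m / 2 \<le> real (card Lq) - 1" using cLq m2 by linarith
      ultimately have "m / 2 \<le> card (Lq - {l1})" using cLq m2 by linarith
      then have "m / 2 * (m * m) \<le> card (Lq - {l1}) * (m * m)" using m2 by (intro mult_right_mono) auto
      then show "m / 2 * (m * m) \<le> (\<Sum>l2\<in>Lq - {l1}. m * m)" by simp
    qed
    also have "\<dots> \<le> (\<Sum>l1\<in>Lq. \<Sum>l2\<in>Lq - {l1}. real (card (nb q l1 \<times> nb q l2)))"
      using cnb m2 by (intro sum_mono) (auto simp: card_cartesian_product Lq_def intro!: mult_mono)
    also have "\<dots> = card W"
      unfolding W_def using finLq finnb by (simp add: card_SigmaI)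
    also have "\<dots> = card ((\<lambda>(l1, l2, x). x) ` W)"
    proof (subst card_image)
      show "inj_on (\<lambda>(l1, l2, x). x) W"
      proof (rule inj_onI)
        fix u v assume uv: "u \<in> W" "v \<in> W" "(\<lambda>(l1, l2, x). x) u = (\<lambda>(l1, l2, x). x) v"
        obtain l1 l2 a b where u: "u = (l1, l2, a, b)" by (metis prod_cases4)
        obtain l1' l2' where v: "v = (l1', l2', a, b)" using uv(3) u by (cases v) auto
        have "l1 \<in> L" "l1' \<in> L" "l2 \<in> L" "l2' \<in> L" "q \<in> l1" "q \<in> l1'" "q \<in> l2" "q \<in> l2'"
          "a \<in> l1" "a \<in> l1'" "b \<in> l2" "b \<in> l2'" "q \<noteq> a" "q \<noteq> b"
          using uv(1,2) L1L unfolding u v by (auto simp: W_def Lq_def nb_def)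
        then show "u = v" unfolding u v using uniq[of l1 l1' q a] uniq[of l2 l2' q b] by simp
      qed
    qed simp
    also have "\<dots> \<le> card {x. (q, x) \<in> R}"
    proof (intro of_nat_mono card_mono)
      show "finite {x. (q, x) \<in> R}" by (rule finite_subset[OF _ finPP]) (use R in auto)
      show "(\<lambda>(l1, l2, x). x) ` W \<subseteq> {x. (q, x) \<in> R}"
      proof clarify
        fix l1 l2 a b assume "(l1, l2, a, b) \<in> W"
        then have "l1 \<in> L1" "l2 \<in> L1" "l1 \<noteq> l2" "q \<in> l1" "q \<in> l2" "a \<in> l1" "b \<in> l2" "a \<in> P" "b \<in> P" "q \<noteq> a" "q \<noteq> b"
          by (auto simp: W_def Lq_def nb_def)
        then show "(q, (a, b)) \<in> R" using q unfolding R_def by blast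
      qed
    qed
    finally show ?thesis .
  qed
  have "s\<^sup>2 / (16 * K\<^sup>2) * (m ^ 4 / 2) \<le> card P1 * (m ^ 4 / 2)" using cP1 by (intro mult_right_mono) auto
  also have "\<dots> = (\<Sum>q\<in>P1. m ^ 4 / 2)" by simp
  also have "\<dots> \<le> (\<Sum>q\<in>P1. real (card {x. (q, x) \<in> R}))" using Rq by (rule sum_mono)
  also have "\<dots> = (\<Sum>x\<in>P \<times> P. real (card {q. (q, x) \<in> R}))"
    using card_Sigma_sum[OF finP1 finPP R] by (simp flip: of_nat_sum)
  finally have sum: "s\<^sup>2 / (16 * K\<^sup>2) * (m ^ 4 / 2) \<le> (\<Sum>x\<in>P \<times> P. real (card {q. (q, x) \<in> R}))" .
  \<comment> \<open>The average found is s^2 / (2^13 K^6), where 2^13 = 16 * 2 * 4^4 comes from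
    \<open>cP1\<close> and the fourth power of \<open>m\<close>; 19 = 13 + 6.\<close>
  have K6: "2 ^ 13 * K ^ 6 \<le> K ^ 19"
  proof -
    have "2 ^ 13 * K ^ 6 \<le> K ^ 13 * K ^ 6" using K by (intro mult_right_mono power_mono) auto
    then show ?thesis by (simp flip: power_add)
  qed
  have "card (P \<times> P) * (s\<^sup>2 / K ^ 19) \<le> card (P \<times> P) * (s\<^sup>2 / (2 ^ 13 * K ^ 6))"
    using K K6 by (intro mult_left_mono divide_left_mono) auto
  also have "\<dots> = s ^ 4 * (s\<^sup>2 / (2 ^ 13 * K ^ 6))"
    using cP by (simp add: card_cartesian_product power2_eq_square eval_nat_numeral mult_ac)
  also have "\<dots> = s\<^sup>2 / (16 * K\<^sup>2) * (m ^ 4 / 2)"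
    using K by (simp add: m_def power_divide power_mult_distrib eval_nat_numeral)
  finally have "card (P \<times> P) * (s\<^sup>2 / K ^ 19) \<le> (\<Sum>x\<in>P \<times> P. real (card {q. (q, x) \<in> R}))" using sum by linarith
  moreover have "P \<noteq> {}" using cP s0 by auto
  ultimately obtain x where x: "x \<in> P \<times> P" "s\<^sup>2 / K ^ 19 \<le> card {q. (q, x) \<in> R}"
    using pigeonhole_sum[OF finPP, of "s\<^sup>2 / K ^ 19" "\<lambda>x. real (card {q. (q, x) \<in> R})"] by auto
  obtain p1 p2 where p: "x = (p1, p2)" by (metis surj_pair)
  define Q where "Q = {q. (q, x) \<in> R}"
  have QP: "Q \<subseteq> P1" by (auto simp: Q_def R_def)
  have "\<forall>p\<in>P. card {l\<in>L1. p \<in> l} \<le> 4 * K * s" using deg by (simp add: deg_def)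
  moreover have "s\<^sup>2 / K ^ 19 \<le> card Q" using x by (simp add: Q_def)
  moreover have "\<forall>q\<in>Q. s / (4 * K) \<le> card {l\<in>L1. q \<in> l}"
    using QP by (auto simp: P1_def deg_def m_def)
  moreover have "\<forall>q\<in>Q. q \<noteq> p1 \<and> q \<noteq> p2 \<and> (\<exists>l1\<in>L1. \<exists>l2\<in>L1. l1 \<noteq> l2 \<and> q \<in> l1 \<and> p1 \<in> l1 \<and> q \<in> l2 \<and> p2 \<in> l2)"
    by (simp add: Q_def R_def p)
  moreover have "p1 \<in> P" "p2 \<in> P" using x by (auto simp: p)
  moreover have "Q \<subseteq> P" using QP by (auto simp: P1_def)
  ultimately show ?thesis using L1L
    by (intro exI[of _ L1] bexI[of _ p1] bexI[of _ p2] exI[of _ Q] conjI)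
qed

section \<open>Collinearity, lines and projective coordinates\<close>

definition det3 :: "'a::comm_ring \<times> 'a \<Rightarrow> 'a \<times> 'a \<Rightarrow> 'a \<times> 'a \<Rightarrow> 'a" where
  "det3 u v w = (fst v - fst u) * (snd w - snd u) - (fst w - fst u) * (snd v - snd u)"

text \<open>A description by collinearity alone, so that lines of every direction are treated alike.
  The empty set and single points of the plane satisfy it too; only sets with two distinct points
  are determined by them, as in \<open>line_unique\<close>.\<close>

definition is_line :: "'a::comm_ring set \<Rightarrow> ('a \<times> 'a) set \<Rightarrow> bool" where
  "is_line F l \<longleftrightarrow> l \<subseteq> F \<times> F \<and> (\<forall>u\<in>l. \<forall>v\<in>l. \<forall>w\<in>l. det3 u v w = 0) \<and>
     (\<forall>u\<in>l. \<forall>v\<in>l. u \<noteq> v \<longrightarrow> (\<forall>w\<in>F \<times> F. det3 u v w = 0 \<longrightarrow> w \<in> l))"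

lemma line_subset: "is_line F l \<Longrightarrow> u \<in> l \<Longrightarrow> u \<in> F \<times> F"
  by (auto simp: is_line_def)

lemma line_collinear: "is_line F l \<Longrightarrow> u \<in> l \<Longrightarrow> v \<in> l \<Longrightarrow> w \<in> l \<Longrightarrow> det3 u v w = 0"
  unfolding is_line_def by blast

lemma line_mem: "is_line F l \<Longrightarrow> u \<in> l \<Longrightarrow> v \<in> l \<Longrightarrow> u \<noteq> v \<Longrightarrow> w \<in> F \<times> F \<Longrightarrow> det3 u v w = 0 \<Longrightarrow> w \<in> l"
  unfolding is_line_def by blast

lemma line_unique:
  assumes "is_line F l" "is_line F l'" "u \<noteq> v" "u \<in> l" "u \<in> l'" "v \<in> l" "v \<in> l'"
  shows "l = l'"
proof (intro equalityI subsetI)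
  fix w assume w: "w \<in> l"
  have "det3 u v w = 0" using assms(1,4,6) w by (rule line_collinear)
  with assms(2,5,7,3) line_subset[OF assms(1) w] show "w \<in> l'" by (rule line_mem)
next
  fix w assume w: "w \<in> l'"
  have "det3 u v w = 0" using assms(2,5,7) w by (rule line_collinear)
  with assms(1,4,6,3) line_subset[OF assms(2) w] show "w \<in> l" by (rule line_mem)
qed

lemma det3_rotate: "det3 v w u = det3 u v w"
  by (simp add: det3_def algebra_simps)

context prime_field
begin

lemma frac_eq_iff:
  assumes "x \<in> F" "x' \<in> F" "y \<in> F" "y' \<in> F" "y \<noteq> 0" "y' \<noteq> 0"
  shows "x * iv y = x' * iv y' \<longleftrightarrow> x * y' = x' * y"
proof
  assume h: "x * iv y = x' * iv y'"
  have "x * y' = y * (iv y * x) * y'" using iv_cancel(2)[of y x] assms by simp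
  also have "\<dots> = (x * iv y) * y * y'" by (simp only: mult_ac)
  also have "\<dots> = (x' * iv y') * y * y'" by (simp only: h)
  also have "\<dots> = y' * (iv y' * x') * y" by (simp only: mult_ac)
  also have "\<dots> = x' * y" using iv_cancel(2)[of y' x'] assms by simp
  finally show "x * y' = x' * y" .
next
  assume h: "x * y' = x' * y"
  have m: "x * iv y \<in> F" "x' * iv y' \<in> F" using assms iv by (auto intro: mult_F)
  have "x * iv y = iv y' * (y' * (x * iv y))" using iv_cancel(1)[of y' "x * iv y"] assms m by simp
  also have "\<dots> = iv y' * (iv y * (x * y'))" by (simp only: mult_ac)
  also have "\<dots> = iv y' * (iv y * (x' * y))" by (simp only: h)
  also have "\<dots> = iv y * (y * (x' * iv y'))" by (simp only: mult_ac)
  also have "\<dots> = x' * iv y'" using iv_cancel(1)[of y "x' * iv y'"] assms m by simp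
  finally show "x * iv y = x' * iv y'" .
qed

end

text \<open>Anisotropy of x^2 + y^2 is the form in which the congruence of the prime modulo 4
  enters. It also excludes characteristic 2, where e^2 + e^2 = 0.\<close>

locale anisotropic_field = prime_field +
  assumes anisotropic: "x \<in> F \<Longrightarrow> y \<in> F \<Longrightarrow> x * x + y * y = 0 \<Longrightarrow> x = 0 \<and> y = 0"

text \<open>Since $-1$ is a nonresidue, multiplication by a nonzero ``complex number'' of the plane is an
  invertible similarity. It moves \<open>p1\<close> to the origin and \<open>p2\<close> onto the first axis; \<open>a\<close> and \<open>b\<close> are then
  the projective coordinates for which the pencils through \<open>p1\<close> and \<open>p2\<close> become the two families of
  axis-parallel lines.\<close>

locale pencils = anisotropic_field +
  fixes p1 p2 :: "'a \<times> 'a"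
  assumes p1: "p1 \<in> F \<times> F" and p2: "p2 \<in> F \<times> F" and p12: "p1 \<noteq> p2"
begin

definition c1 where "c1 = fst p2 - fst p1"
definition c2 where "c2 = snd p2 - snd p1"
definition n where "n = c1 * c1 + c2 * c2"
definition X where "X q = (fst q - fst p1) * c1 + (snd q - snd p1) * c2"
definition Y where "Y q = (fst q - fst p1) * c2 - (snd q - snd p1) * c1"
text \<open>The map (X, Y) takes \<open>p1\<close> to (0, 0) and \<open>p2\<close> to (n, 0);
  \<open>a\<close> and \<open>b\<close> are the inverse slopes of the lines joining the image of
  \<open>q\<close> to these two points.\<close>

definition a where "a q = X q * iv (Y q)"
definition b where "b q = (X q - n) * iv (Y q)"

lemmas pdefs = c1_def c2_def n_def X_def Y_def det3_def

lemma c_F: "c1 \<in> F" "c2 \<in> F" "n \<in> F"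
  using p1 p2 by (auto simp: c1_def c2_def n_def intro!: diff_F add_F mult_F)

lemma n_nz: "n \<noteq> 0"
proof
  assume "n = 0"
  then have "c1 = 0 \<and> c2 = 0" using anisotropic c_F by (auto simp: n_def)
  then show False using p12 by (auto simp: c1_def c2_def prod_eq_iff)
qed

lemma XY_F: "q \<in> F \<times> F \<Longrightarrow> X q \<in> F" "q \<in> F \<times> F \<Longrightarrow> Y q \<in> F"
  using p1 c_F by (auto simp: X_def Y_def intro!: diff_F add_F mult_F)

lemma det3_F: "u \<in> F \<times> F \<Longrightarrow> v \<in> F \<times> F \<Longrightarrow> w \<in> F \<times> F \<Longrightarrow> det3 u v w \<in> F"
  by (auto simp: det3_def intro!: diff_F mult_F)

lemma Y_eq: "Y q = - det3 p1 p2 q"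
  by (simp add: pdefs algebra_simps)

lemma cross1: "X q * Y q' - X q' * Y q = - (n * det3 p1 q q')"
  by (simp add: pdefs algebra_simps)

lemma cross2: "(X q - n) * Y q' - (X q' - n) * Y q = - (n * det3 p2 q q')"
  by (simp add: pdefs algebra_simps)

lemma cross3: "(X v - X u) * (Y w - Y u) - (X w - X u) * (Y v - Y u) = - (n * det3 u v w)"
  by (simp add: pdefs algebra_simps)

definition good where "good = {q \<in> F \<times> F. det3 p1 p2 q \<noteq> 0}"

lemma goodD: "q \<in> good \<Longrightarrow> q \<in> F \<times> F" "q \<in> good \<Longrightarrow> Y q \<noteq> 0"
  by (auto simp: good_def Y_eq)

lemma ab_F: "q \<in> good \<Longrightarrow> a q \<in> F" "q \<in> good \<Longrightarrow> b q \<in> F"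
proof -
  assume q: "q \<in> good"
  have "X q \<in> F" "Y q \<in> F" "iv (Y q) \<in> F" using XY_F goodD[OF q] iv(1) by auto
  then show "a q \<in> F" "b q \<in> F" using c_F by (auto simp: a_def b_def intro!: mult_F diff_F)
qed

lemma n_det3_eq_0:
  assumes "u \<in> F \<times> F" "v \<in> F \<times> F" "w \<in> F \<times> F"
  shows "n * det3 u v w = 0 \<longleftrightarrow> det3 u v w = 0"
  using mult_eq_zero[OF c_F(3) det3_F[OF assms]] n_nz by auto

lemma a_eq_iff:
  assumes "q \<in> good" "q' \<in> good"
  shows "a q = a q' \<longleftrightarrow> det3 p1 q q' = 0"
proof -
  note g = goodD[OF assms(1)] goodD[OF assms(2)]
  have "a q = a q' \<longleftrightarrow> X q * Y q' = X q' * Y q"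
    unfolding a_def using g XY_F by (intro frac_eq_iff) auto
  also have "\<dots> \<longleftrightarrow> X q * Y q' - X q' * Y q = 0" by simp
  also have "\<dots> \<longleftrightarrow> n * det3 p1 q q' = 0" unfolding cross1 by simp
  also have "\<dots> \<longleftrightarrow> det3 p1 q q' = 0" using g p1 by (intro n_det3_eq_0) auto
  finally show ?thesis .
qed

lemma b_eq_iff:
  assumes "q \<in> good" "q' \<in> good"
  shows "b q = b q' \<longleftrightarrow> det3 p2 q q' = 0"
proof -
  note g = goodD[OF assms(1)] goodD[OF assms(2)]
  have "b q = b q' \<longleftrightarrow> (X q - n) * Y q' = (X q' - n) * Y q"
    unfolding b_def using g XY_F c_F by (intro frac_eq_iff diff_F) auto
  also have "\<dots> \<longleftrightarrow> (X q - n) * Y q' - (X q' - n) * Y q = 0" by simp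
  also have "\<dots> \<longleftrightarrow> n * det3 p2 q q' = 0" unfolding cross2 by simp
  also have "\<dots> \<longleftrightarrow> det3 p2 q q' = 0" using g p2 by (intro n_det3_eq_0) auto
  finally show ?thesis .
qed

text \<open>a - b = n / Y recovers \<open>Y\<close>, whereupon \<open>a\<close> recovers
  \<open>X\<close>; and (X, Y) determines \<open>q\<close> because the similarity factor
  \<open>n\<close> is nonzero.\<close>

lemma ab_inj:
  assumes "q \<in> good" "q' \<in> good" "a q = a q'" "b q = b q'"
  shows "q = q'"
proof -
  note g = goodD[OF assms(1)] goodD[OF assms(2)]
  note F = XY_F[OF g(1)] XY_F[OF g(3)] c_F
  have "n * iv (Y q) = a q - b q" by (simp add: a_def b_def algebra_simps)
  also have "\<dots> = n * iv (Y q')" unfolding assms(3,4) by (simp add: a_def b_def algebra_simps)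
  finally have "n * Y q' = n * Y q" using frac_eq_iff[of n n "Y q" "Y q'"] F g by simp
  then have Y: "Y q = Y q'" using mult_cancel[of n "Y q'" "Y q"] F n_nz by simp
  have "X q * iv (Y q) = X q' * iv (Y q')" using assms(3) by (simp add: a_def)
  then have "X q * Y q' = X q' * Y q" using frac_eq_iff[of "X q" "X q'" "Y q" "Y q'"] F g by simp
  then have "Y q * X q = Y q * X q'" by (simp add: Y mult.commute)
  then have X: "X q = X q'" using mult_cancel[of "Y q" "X q" "X q'"] F g by simp
  have e1: "n * fst r = n * fst p1 + X r * c1 + Y r * c2" for r by (simp add: pdefs algebra_simps)
  have e2: "n * snd r = n * snd p1 + X r * c2 - Y r * c1" for r by (simp add: pdefs algebra_simps)
  have "n * fst q = n * fst q'" "n * snd q = n * snd q'" unfolding e1[of q] e1[of q'] e2[of q] e2[of q'] X Y by simp_all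
  moreover have "fst q \<in> F" "fst q' \<in> F" "snd q \<in> F" "snd q' \<in> F" using g by auto
  ultimately have "fst q = fst q'" "snd q = snd q'"
    using mult_cancel[of n "fst q" "fst q'"] mult_cancel[of n "snd q" "snd q'"] F n_nz by auto
  then show ?thesis by (simp add: prod_eq_iff)
qed

text \<open>Passing from (X, Y) to (X / Y, 1 / Y) is projective and multiplies the collinearity
  determinant, up to sign, by the product of the three reciprocals; \<open>b\<close> is an affine
  function of the new coordinates. The conclusion is linear interpolation of \<open>b\<close>
  between \<open>u\<close> and \<open>v\<close> as a function of \<open>a\<close>.\<close>

lemma collinear_relation:
  assumes u: "u \<in> good" and v: "v \<in> good" and w: "w \<in> good" and d: "det3 u v w = 0"
  shows "(a v - a u) * b w = (a v - a w) * b u + (a w - a u) * b v"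
proof -
  define y1 y2 y3 where "y1 = iv (Y u)" and "y2 = iv (Y v)" and "y3 = iv (Y w)"
  define T where "T = y1 * y2 * y3"
  have yF: "y1 \<in> F" "y2 \<in> F" "y3 \<in> F" using goodD[OF u] goodD[OF v] goodD[OF w] XY_F iv(1) by (auto simp: y1_def y2_def y3_def)
  have Yy: "Y u * y1 = e" "Y v * y2 = e" "Y w * y3 = e"
    using goodD[OF u] goodD[OF v] goodD[OF w] XY_F iv(2) by (auto simp: y1_def y2_def y3_def)
  have "y2 * y3 = e * (y2 * y3)" using yF by (simp add: unit mult_F)
  also have "\<dots> = (Y u * y1) * (y2 * y3)" by (simp only: Yy)
  also have "\<dots> = T * Y u" by (simp only: T_def mult_ac)
  finally have t1: "y2 * y3 = T * Y u" .
  have "y1 * y3 = e * (y1 * y3)" using yF by (simp add: unit mult_F)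
  also have "\<dots> = (Y v * y2) * (y1 * y3)" by (simp only: Yy)
  also have "\<dots> = T * Y v" by (simp only: T_def mult_ac)
  finally have t2: "y1 * y3 = T * Y v" .
  have "y1 * y2 = e * (y1 * y2)" using yF by (simp add: unit mult_F)
  also have "\<dots> = (Y w * y3) * (y1 * y2)" by (simp only: Yy)
  also have "\<dots> = T * Y w" by (simp only: T_def mult_ac)
  finally have t3: "y1 * y2 = T * Y w" .
  have a: "a u = X u * y1" "a v = X v * y2" "a w = X w * y3" by (simp_all add: a_def y1_def y2_def y3_def)
  have b: "b u = a u - n * y1" "b v = a v - n * y2" "b w = a w - n * y3"
    by (simp_all add: a_def b_def y1_def y2_def y3_def left_diff_distrib)
  have "(a v - a u) * b w - ((a v - a w) * b u + (a w - a u) * b v)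
      = - (n * ((a v - a u) * y3 - (a v - a w) * y1 - (a w - a u) * y2))"
    unfolding b by (simp add: algebra_simps)
  also have "(a v - a u) * y3 - (a v - a w) * y1 - (a w - a u) * y2
      = X v * (y2 * y3) - X u * (y1 * y3) - X v * (y1 * y2) + X w * (y1 * y3) - X w * (y2 * y3) + X u * (y1 * y2)"
    unfolding a by (simp add: algebra_simps)
  also have "\<dots> = - (T * ((X v - X u) * (Y w - Y u) - (X w - X u) * (Y v - Y u)))"
    unfolding t1 t2 t3 by (simp add: algebra_simps)
  also have "\<dots> = 0" unfolding cross3 by (simp add: d)
  finally show ?thesis by simp
qed

end

section \<open>From rich lines to a relation on a grid\<close>

context pencils
begin

text \<open>The pencils bound \<open>A\<close> and \<open>B\<close> by about \<open>s\<close>. Up to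
  powers of \<open>K\<close>, some s^5 collinear triples (u, v, w) are distributed over s^2 pairs (a
  u, a v); for the best pair (x1, x2) \<open>collinear_relation\<close> involves only a w in
  \<open>A\<close> and the values of \<open>b\<close> at the three points.\<close>

lemma grid_relation:
  fixes s K :: real
  assumes L: "finite L" "\<And>l. l \<in> L \<Longrightarrow> is_line F l" "card L \<le> s\<^sup>2"
    and Q: "Q \<subseteq> good" "s\<^sup>2 / K ^ 19 \<le> card Q"
    and d1: "card {l\<in>L. p1 \<in> l} \<le> 4 * K * s" and d2: "card {l\<in>L. p2 \<in> l} \<le> 4 * K * s"
    and j1: "\<And>q. q \<in> Q \<Longrightarrow> \<exists>l\<in>L. q \<in> l \<and> p1 \<in> l" and j2: "\<And>q. q \<in> Q \<Longrightarrow> \<exists>l\<in>L. q \<in> l \<and> p2 \<in> l"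
    and dQ: "\<And>q. q \<in> Q \<Longrightarrow> s / (4 * K) \<le> card {l\<in>L. q \<in> l}"
    and K: "2 \<le> K" and s: "8 * K ^ 23 \<le> s"
  shows "\<exists>A B x1 x2. A \<subseteq> F \<and> B \<subseteq> F \<and> x1 \<in> F \<and> x2 \<in> F \<and> x1 \<noteq> x2 \<and> x1 \<notin> A \<and> x2 \<notin> A \<and>
    card A \<le> 4 * K * s \<and> card B \<le> 4 * K * s \<and> s ^ 3 / K ^ 80 \<le>
      card {(x, y1, y2). x \<in> A \<and> y1 \<in> B \<and> y2 \<in> B \<and> (x2 - x) * y1 + (x - x1) * y2 \<in> (*) (x2 - x1) ` B}"
proof -
  have K1: "1 \<le> K" using K by simp
  have K0: "0 < K" using K by simp
  have "2 * K \<le> K ^ 23"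
  proof -
    have "2 * K \<le> K * K" using K by simp
    also have "\<dots> = K ^ 2" by (simp add: power2_eq_square)
    also have "\<dots> \<le> K ^ 23" using K1 by (intro power_increasing) auto
    finally show ?thesis .
  qed
  then have s16: "16 * K \<le> s" using s by linarith
  have s0: "0 < s" using s16 K by linarith
  have Qg: "q \<in> good" if "q \<in> Q" for q using that Q by auto
  have QF: "q \<in> F \<times> F" if "q \<in> Q" for q using Qg[OF that] goodD by auto
  have "Q \<subseteq> F \<times> F" using QF by blast
  then have finQ: "finite Q" by (rule finite_subset) simp
  define A where "A = a ` Q"
  define B where "B = b ` Q"
  have finA: "finite A" and finB: "finite B" using finQ by (auto simp: A_def B_def)
  have AF: "A \<subseteq> F" and BF: "B \<subseteq> F" using Qg ab_F by (auto simp: A_def B_def)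
  have p1g: "det3 q q' p1 = det3 p1 q q'" "det3 q q' p2 = det3 p2 q q'" for q q'
    by (metis det3_rotate)+
  have cA: "card A \<le> 4 * K * s"
  proof -
    have "card A \<le> card {l\<in>L. p1 \<in> l}"
    proof (rule card_le_functional[where R = "\<lambda>x l. \<exists>q\<in>Q. q \<in> l \<and> a q = x"])
      fix x assume "x \<in> A"
      then obtain q where q: "q \<in> Q" "x = a q" by (auto simp: A_def)
      then show "\<exists>l\<in>{l \<in> L. p1 \<in> l}. \<exists>q\<in>Q. q \<in> l \<and> a q = x" using j1[OF q(1)] by auto
    next
      fix x x' l assume l: "l \<in> {l \<in> L. p1 \<in> l}" and "\<exists>q\<in>Q. q \<in> l \<and> a q = x" "\<exists>q\<in>Q. q \<in> l \<and> a q = x'"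
      then obtain q q' where q: "q \<in> Q" "q \<in> l" "a q = x" "q' \<in> Q" "q' \<in> l" "a q' = x'" by blast
      then have "det3 p1 q q' = 0" using line_collinear[OF L(2)] l by blast
      then show "x = x'" using a_eq_iff[OF Qg Qg, of q q'] q by simp
    qed (use L in auto)
    then show ?thesis using d1 by linarith
  qed
  have cB: "card B \<le> 4 * K * s"
  proof -
    have "card B \<le> card {l\<in>L. p2 \<in> l}"
    proof (rule card_le_functional[where R = "\<lambda>x l. \<exists>q\<in>Q. q \<in> l \<and> b q = x"])
      fix x assume "x \<in> B"
      then obtain q where q: "q \<in> Q" "x = b q" by (auto simp: B_def)
      then show "\<exists>l\<in>{l \<in> L. p2 \<in> l}. \<exists>q\<in>Q. q \<in> l \<and> b q = x" using j2[OF q(1)] by auto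
    next
      fix x x' l assume l: "l \<in> {l \<in> L. p2 \<in> l}" and "\<exists>q\<in>Q. q \<in> l \<and> b q = x" "\<exists>q\<in>Q. q \<in> l \<and> b q = x'"
      then obtain q q' where q: "q \<in> Q" "q \<in> l" "b q = x" "q' \<in> Q" "q' \<in> l" "b q' = x'" by blast
      then have "det3 p2 q q' = 0" using line_collinear[OF L(2)] l by blast
      then show "x = x'" using b_eq_iff[OF Qg Qg, of q q'] q by simp
    qed (use L in auto)
    then show ?thesis using d2 by linarith
  qed
  \<comment> \<open>Good points on a line through \<open>p1\<close> share their value of
    \<open>a\<close>, on a line through \<open>p2\<close> their value of \<open>b\<close>. On the
    other lines \<open>a\<close> is injective, and each \<open>q\<close> loses at most two
    lines.\<close>
  define L2 where "L2 = {l\<in>L. p1 \<notin> l \<and> p2 \<notin> l}"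
  have finL2: "finite L2" using L by (simp add: L2_def)
  have L2L: "L2 \<subseteq> L" by (auto simp: L2_def)
  have aL: "q = q'" if "l \<in> L2" "q \<in> Q" "q' \<in> Q" "q \<in> l" "q' \<in> l" "a q = a q'" for l q q'
  proof (rule ccontr)
    assume ne: "q \<noteq> q'"
    have "det3 q q' p1 = 0" using a_eq_iff[OF Qg Qg] that p1g by metis
    then have "p1 \<in> l" using line_mem[OF L(2) that(4,5) ne p1] that(1) L2L by blast
    then show False using that by (simp add: L2_def)
  qed
  have deg2: "s / (8 * K) \<le> card {l\<in>L2. q \<in> l}" if q: "q \<in> Q" for q
  proof -
    have one: "card {l\<in>L. q \<in> l \<and> p \<in> l} \<le> 1" if p: "p \<noteq> q" for p
    proof -
      have "l = l'" if "l \<in> {l\<in>L. q \<in> l \<and> p \<in> l}" "l' \<in> {l\<in>L. q \<in> l \<and> p \<in> l}" for l l'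
        using that p line_unique[OF L(2) L(2), of l l' p q] by simp
      then have "\<forall>l\<in>{l\<in>L. q \<in> l \<and> p \<in> l}. \<forall>l'\<in>{l\<in>L. q \<in> l \<and> p \<in> l}. l = l'" by blast
      then show ?thesis using L(1) card_le_Suc0_iff_eq[of "{l\<in>L. q \<in> l \<and> p \<in> l}"] by simp
    qed
    have "q \<noteq> p1" "q \<noteq> p2" using goodD(2)[OF Qg[OF q]] by (auto simp: Y_def c1_def c2_def algebra_simps)
    then have "card {l\<in>L. q \<in> l \<and> p1 \<in> l} \<le> 1" "card {l\<in>L. q \<in> l \<and> p2 \<in> l} \<le> 1" using one by auto
    moreover have "{l\<in>L. q \<in> l} \<subseteq> {l\<in>L2. q \<in> l} \<union> ({l\<in>L. q \<in> l \<and> p1 \<in> l} \<union> {l\<in>L. q \<in> l \<and> p2 \<in> l})"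
      by (auto simp: L2_def)
    then have "card {l\<in>L. q \<in> l} \<le> card ({l\<in>L2. q \<in> l} \<union> ({l\<in>L. q \<in> l \<and> p1 \<in> l} \<union> {l\<in>L. q \<in> l \<and> p2 \<in> l}))"
      using L(1) finL2 by (intro card_mono) auto
    moreover have "\<dots> \<le> card {l\<in>L2. q \<in> l} + card ({l\<in>L. q \<in> l \<and> p1 \<in> l} \<union> {l\<in>L. q \<in> l \<and> p2 \<in> l})"
      by (rule card_Un_le)
    moreover have "card ({l\<in>L. q \<in> l \<and> p1 \<in> l} \<union> {l\<in>L. q \<in> l \<and> p2 \<in> l}) \<le> card {l\<in>L. q \<in> l \<and> p1 \<in> l} + card {l\<in>L. q \<in> l \<and> p2 \<in> l}"
      by (rule card_Un_le)
    ultimately have "card {l\<in>L. q \<in> l} \<le> card {l\<in>L2. q \<in> l} + 2" by linarith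
    then have "s / (4 * K) - 2 \<le> card {l\<in>L2. q \<in> l}" using dQ[OF q] by linarith
    moreover have "2 \<le> s / (8 * K)" using s16 K by (simp add: field_simps)
    moreover have "s / (4 * K) = s / (8 * K) + s / (8 * K)" by simp
    ultimately show ?thesis by linarith
  qed
  define nl where "nl l = real (card (l \<inter> Q))" for l
  define I where "I = {(q, l). q \<in> Q \<and> l \<in> L2 \<and> q \<in> l}"
  have I: "I \<subseteq> Q \<times> L2" by (auto simp: I_def)
  have "s ^ 3 / K ^ 23 \<le> s\<^sup>2 / K ^ 19 * (s / (8 * K))"
  proof -
    have "8 * K \<le> K ^ 3 * K" using power_absorb[OF K, of 8 3] K by (intro mult_right_mono) auto
    then have "K ^ 19 * (8 * K) \<le> K ^ 19 * (K ^ 3 * K)" using K by (intro mult_left_mono) auto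
    also have "\<dots> = K ^ 23" by (simp flip: power_add power_Suc power_Suc2)
    finally have "s ^ 3 / K ^ 23 \<le> s ^ 3 / (K ^ 19 * (8 * K))" using s0 K0 by (intro divide_left_mono) auto
    also have "\<dots> = s\<^sup>2 / K ^ 19 * (s / (8 * K))" by (simp add: power2_eq_square power3_eq_cube)
    finally show ?thesis .
  qed
  also have "\<dots> \<le> card Q * (s / (8 * K))" using Q(2) s0 K0 by (intro mult_right_mono) auto
  also have "\<dots> = (\<Sum>q\<in>Q. s / (8 * K))" by simp
  also have "\<dots> \<le> (\<Sum>q\<in>Q. real (card {l. (q, l) \<in> I}))"
  proof (rule sum_mono)
    fix q assume q: "q \<in> Q"
    have "{l. (q, l) \<in> I} = {l\<in>L2. q \<in> l}" using q by (auto simp: I_def)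
    then show "s / (8 * K) \<le> real (card {l. (q, l) \<in> I})" using deg2[OF q] by simp
  qed
  also have "\<dots> = (\<Sum>l\<in>L2. real (card {q. (q, l) \<in> I}))"
    using card_Sigma_sum[OF finQ finL2 I] by (simp flip: of_nat_sum)
  also have "\<dots> = sum nl L2"
    unfolding nl_def by (intro sum.cong refl arg_cong[where f = "\<lambda>x. real (card x)"]) (auto simp: I_def)
  finally have snl: "s ^ 3 / K ^ 23 \<le> sum nl L2" .
  \<comment> \<open>Half of the guaranteed average richness. As s \<ge> 8 K^23, it is at least 4, so
    the factors nl - 1 and nl - 2 in the count of triples exceed c / 2 or equal it.\<close>
  define c where "c = s / (2 * K ^ 23)"
  have c4: "4 \<le> c" using s K0 by (simp add: c_def field_simps)
  define L3 where "L3 = {l\<in>L2. c \<le> nl l}"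
  have finL3: "finite L3" using finL2 by (simp add: L3_def)
  have "card L2 * c \<le> s\<^sup>2 * c"
    using card_mono[OF L(1) L2L] L(3) c4 by (intro mult_right_mono) linarith+
  also have "\<dots> = s ^ 3 / K ^ 23 / 2" by (simp add: c_def power2_eq_square power3_eq_cube)
  finally have s3: "s ^ 3 / K ^ 23 / 2 \<le> sum nl L3"
    unfolding L3_def using finL2 snl c4 by (intro popular_sum) auto
  define T where "T = {(u, v, w). u \<in> Q \<and> v \<in> Q \<and> w \<in> Q \<and> u \<noteq> v \<and> u \<noteq> w \<and> v \<noteq> w \<and> (\<exists>l\<in>L2. u \<in> l \<and> v \<in> l \<and> w \<in> l)}"
  have TQ: "T \<subseteq> Q \<times> Q \<times> Q" by (auto simp: T_def)
  then have finT: "finite T" using finQ by (meson finite_SigmaI finite_subset)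
  define W where "W = (SIGMA l:L3. SIGMA u:l \<inter> Q. SIGMA v:l \<inter> Q - {u}. l \<inter> Q - {u, v})"
  have cT: "s ^ 5 / K ^ 74 \<le> card T"
  proof -
    \<comment> \<open>\<open>c\<close> squared contributes K^46, and 2 * 4 * 4 = 32 is absorbed by
      K^5: 74 = 23 + 46 + 5.\<close>
    have "s ^ 5 / K ^ 74 \<le> s ^ 3 / K ^ 23 / 2 * (c\<^sup>2 / 4)"
    proof -
      have "32 * K ^ 69 \<le> K ^ 5 * K ^ 69" using power_absorb[OF K, of 32 5] K by (intro mult_right_mono) auto
      also have "\<dots> = K ^ 74" by (simp flip: power_add)
      finally have "s ^ 5 / K ^ 74 \<le> s ^ 5 / (32 * K ^ 69)" using s0 K0 by (intro divide_left_mono) auto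
      also have "\<dots> = s ^ 3 / K ^ 23 / 2 * (c\<^sup>2 / 4)"
        by (simp add: c_def power_divide power_mult_distrib flip: power_add power_mult)
      finally show ?thesis .
    qed
    also have "\<dots> \<le> sum nl L3 * (c\<^sup>2 / 4)" using s3 by (intro mult_right_mono) auto
    also have "\<dots> = (\<Sum>l\<in>L3. nl l * (c\<^sup>2 / 4))" by (rule sum_distrib_right)
    also have "\<dots> \<le> (\<Sum>l\<in>L3. real (card (SIGMA u:l \<inter> Q. SIGMA v:l \<inter> Q - {u}. l \<inter> Q - {u, v})))"
    proof (rule sum_mono)
      fix l assume l: "l \<in> L3"
      let ?S = "l \<inter> Q"
      have fS: "finite ?S" using finQ by simp
      have cS: "c \<le> card ?S" using l by (simp add: L3_def nl_def)
      then have c2: "4 \<le> card ?S" using c4 by linarith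
      have 1: "card (?S - {u, v}) = card ?S - 2" if "u \<in> ?S" "v \<in> ?S - {u}" for u v
      proof -
        have "u \<noteq> v" using that by auto
        then have "card {u, v} = 2" by simp
        then show ?thesis using that fS card_Diff_subset[of "{u, v}" ?S] by simp
      qed
      have 2: "card (SIGMA v:?S - {u}. ?S - {u, v}) = (card ?S - 1) * (card ?S - 2)" if u: "u \<in> ?S" for u
      proof -
        have "card (SIGMA v:?S - {u}. ?S - {u, v}) = (\<Sum>v\<in>?S - {u}. card (?S - {u, v}))"
          using fS by (simp add: card_SigmaI)
        also have "\<dots> = (\<Sum>v\<in>?S - {u}. card ?S - 2)" using 1[OF u] by (intro sum.cong) auto
        also have "\<dots> = (card ?S - 1) * (card ?S - 2)" using fS u by simp
        finally show ?thesis .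
      qed
      have "card (SIGMA u:?S. SIGMA v:?S - {u}. ?S - {u, v}) = (\<Sum>u\<in>?S. card (SIGMA v:?S - {u}. ?S - {u, v}))"
        using fS by (simp add: card_SigmaI)
      also have "\<dots> = (\<Sum>u\<in>?S. (card ?S - 1) * (card ?S - 2))" using 2 by (intro sum.cong) auto
      also have "\<dots> = card ?S * ((card ?S - 1) * (card ?S - 2))" by simp
      finally have 3: "real (card (SIGMA u:?S. SIGMA v:?S - {u}. ?S - {u, v})) = nl l * ((nl l - 1) * (nl l - 2))"
        using c2 by (simp add: nl_def of_nat_diff)
      have x: "c \<le> nl l" "4 \<le> nl l" using cS c4 by (auto simp: nl_def)
      have "c\<^sup>2 / 4 = (c / 2) * (c / 2)" by (simp add: power2_eq_square)
      also have "\<dots> \<le> (nl l - 1) * (nl l - 2)" using x c4 by (intro mult_mono) auto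
      finally show "nl l * (c\<^sup>2 / 4) \<le> real (card (SIGMA u:?S. SIGMA v:?S - {u}. ?S - {u, v}))"
        unfolding 3 using x by (intro mult_left_mono) auto
    qed
    also have "\<dots> = card W"
      unfolding W_def using finL3 finQ by (subst card_SigmaI) auto
    also have "\<dots> = card (snd ` W)"
    proof (subst card_image)
      show "inj_on snd W"
      proof (rule inj_onI)
        fix x y assume xy: "x \<in> W" "y \<in> W" "snd x = snd y"
        obtain l u v w where x: "x = (l, u, v, w)" by (metis prod_cases4)
        obtain l' where y: "y = (l', u, v, w)" using xy(3) x by (cases y) auto
        have "l \<in> L" "l' \<in> L" "u \<in> l" "u \<in> l'" "v \<in> l" "v \<in> l'" "u \<noteq> v"
          using xy(1,2) L2L by (auto simp: x y W_def L3_def)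
        then have "l = l'" by (intro line_unique[OF L(2) L(2), of l l' u v])
        then show "x = y" by (simp add: x y)
      qed
    qed simp
    also have "\<dots> \<le> card T"
    proof -
      have "snd ` W \<subseteq> T"
      proof
        fix t assume "t \<in> snd ` W"
        then obtain z where z: "z \<in> W" "t = snd z" by blast
        obtain l u v w where zl: "z = (l, u, v, w)" by (metis prod_cases4)
        have t: "(l, u, v, w) \<in> W" "t = (u, v, w)" using z by (simp_all add: zl)
        then have h: "l \<in> L2" "u \<in> l" "v \<in> l" "w \<in> l" "u \<in> Q" "v \<in> Q" "w \<in> Q" "u \<noteq> v" "u \<noteq> w" "v \<noteq> w"
          by (auto simp: W_def L3_def)
        then have "\<exists>l\<in>L2. u \<in> l \<and> v \<in> l \<and> w \<in> l" by blast
        then show "t \<in> T" unfolding T_def t(2) using h by simp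
      qed
      then show ?thesis using finT by (intro of_nat_mono card_mono)
    qed
    finally show ?thesis .
  qed
  define TT where "TT x = {t\<in>T. a (fst t) = fst x \<and> a (fst (snd t)) = snd x}" for x
  define R where "R = {(x, t). x \<in> A \<times> A \<and> t \<in> TT x}"
  have finAA: "finite (A \<times> A)" using finA by simp
  have R: "R \<subseteq> (A \<times> A) \<times> T" by (auto simp: R_def TT_def)
  have Tone: "card {x. (x, t) \<in> R} = 1" if t: "t \<in> T" for t
  proof -
    have "{x. (x, t) \<in> R} = {(a (fst t), a (fst (snd t)))}"
      using t TQ by (auto simp: R_def TT_def A_def)
    then show ?thesis by simp
  qed
  have "(\<Sum>x\<in>A \<times> A. real (card {t. (x, t) \<in> R})) = (\<Sum>t\<in>T. real (card {x. (x, t) \<in> R}))"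
    using card_Sigma_sum[OF finAA finT R] by (simp flip: of_nat_sum)
  also have "\<dots> = card T" using Tone by simp
  finally have sR: "(\<Sum>x\<in>A \<times> A. real (card {t. (x, t) \<in> R})) = card T" .
  \<comment> \<open>There are at most 16 K^2 s^2 pairs of values of \<open>a\<close>: 80 = 74 + 2 +
    4.\<close>
  have K80: "16 * K\<^sup>2 * s\<^sup>2 * (s ^ 3 / K ^ 80) \<le> s ^ 5 / K ^ 74"
  proof -
    have "16 * K\<^sup>2 * s\<^sup>2 * (s ^ 3 / K ^ 80) = 16 * (s ^ 5 / K ^ 78)"
      using K0 by (simp add: field_simps flip: power_add)
    also have "\<dots> \<le> K ^ 4 * (s ^ 5 / K ^ 78)"
      using power_absorb[OF K, of 16 4] s0 K0 by (intro mult_right_mono) auto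
    also have "\<dots> = s ^ 5 / K ^ 74" using K0 by (simp add: field_simps flip: power_add)
    finally show ?thesis .
  qed
  have "card (A \<times> A) * (s ^ 3 / K ^ 80) \<le> (4 * K * s) * (4 * K * s) * (s ^ 3 / K ^ 80)"
    unfolding card_cartesian_product of_nat_mult using cA s0 K0 by (intro mult_right_mono mult_mono) auto
  also have "\<dots> = 16 * K\<^sup>2 * s\<^sup>2 * (s ^ 3 / K ^ 80)" by (simp add: power2_eq_square)
  also have "\<dots> \<le> (\<Sum>x\<in>A \<times> A. real (card {t. (x, t) \<in> R}))" using K80 cT unfolding sR by linarith
  finally have pg: "card (A \<times> A) * (s ^ 3 / K ^ 80) \<le> (\<Sum>x\<in>A \<times> A. real (card {t. (x, t) \<in> R}))" .
  have "0 < s ^ 5 / K ^ 74" using s0 K0 by simp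
  then have "T \<noteq> {}" using cT by auto
  then have "A \<times> A \<noteq> {}" using TQ by (auto simp: A_def)
  from pigeonhole_sum[OF finAA this pg] obtain x where
    x: "x \<in> A \<times> A" "s ^ 3 / K ^ 80 \<le> card {t. (x, t) \<in> R}" by blast
  obtain x1 x2 where xx: "x = (x1, x2)" by (metis surj_pair)
  have Tx: "{t. (x, t) \<in> R} = TT x" using x(1) by (auto simp: R_def)
  have "0 < s ^ 3 / K ^ 80" using s0 K0 by simp
  then have "TT x \<noteq> {}" using x(2) unfolding Tx by auto
  have TTd: "u \<in> Q" "v \<in> Q" "w \<in> Q" "u \<noteq> v" "u \<noteq> w" "v \<noteq> w" "a u = x1" "a v = x2"
    "\<exists>l\<in>L2. u \<in> l \<and> v \<in> l \<and> w \<in> l" if "(u, v, w) \<in> TT x" for u v w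
    using that by (auto simp: TT_def T_def xx)
  have ne: "x1 \<noteq> x2" "a w \<noteq> x1" "a w \<noteq> x2" if t: "(u, v, w) \<in> TT x" for u v w
  proof -
    obtain l where "l \<in> L2" "u \<in> l" "v \<in> l" "w \<in> l" using TTd(9)[OF t] by blast
    then show "x1 \<noteq> x2" "a w \<noteq> x1" "a w \<noteq> x2" using aL TTd[OF t] by metis+
  qed
  \<comment> \<open>\<open>w\<close> differs from \<open>u\<close> and \<open>v\<close> on a line
    where \<open>a\<close> is injective, so x1 and x2 can be removed. This makes the later quotients
    of x2 - x by x - x1 defined and nonzero.\<close>
  define A0 where "A0 = A - {x1, x2}"
  define G where "G = {(x, y1, y2). x \<in> A0 \<and> y1 \<in> B \<and> y2 \<in> B \<and> (x2 - x) * y1 + (x - x1) * y2 \<in> (*) (x2 - x1) ` B}"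
  define g where "g = (\<lambda>(u, v, w). (a w, b u, b v))"
  \<comment> \<open>The values of \<open>a\<close> and \<open>b\<close> recover \<open>u\<close> and
    \<open>v\<close>; these determine the line, and a w determines \<open>w\<close> on it.\<close>
  have "inj_on g (TT x)"
  proof (rule inj_onI)
    fix t t' assume t: "t \<in> TT x" "t' \<in> TT x" "g t = g t'"
    obtain u v w where tt: "t = (u, v, w)" by (metis prod_cases3)
    obtain u' v' w' where tt': "t' = (u', v', w')" by (metis prod_cases3)
    note h = TTd[OF t(1)[unfolded tt]] TTd[OF t(2)[unfolded tt']]
    have eq: "a w = a w'" "b u = b u'" "b v = b v'" using t(3) by (auto simp: g_def tt tt')
    have u: "u = u'" using ab_inj[of u u'] h eq Qg by simp
    have v: "v = v'" using ab_inj[of v v'] h eq Qg by simp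
    obtain l where l: "l \<in> L2" "u \<in> l" "v \<in> l" "w \<in> l" using h(9) by blast
    obtain l' where l': "l' \<in> L2" "u' \<in> l'" "v' \<in> l'" "w' \<in> l'" using h(18) by blast
    have "l \<in> L" "l' \<in> L" using l l' L2L by auto
    then have "l = l'" using line_unique[OF L(2) L(2) h(4), of l l'] l l' u v by simp
    then have "w = w'" using aL[OF l(1), of w w'] h l l' eq by simp
    then show "t = t'" by (simp add: tt tt' u v)
  qed
  moreover have "g ` TT x \<subseteq> G"
  proof
    fix z assume "z \<in> g ` TT x"
    then obtain u v w where t: "(u, v, w) \<in> TT x" "z = (a w, b u, b v)" by (auto simp: g_def)
    note h = TTd[OF t(1)]
    obtain l where l: "l \<in> L2" "u \<in> l" "v \<in> l" "w \<in> l" using h(9) by blast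
    have "det3 u v w = 0" using line_collinear[OF L(2)] l L2L by blast
    then have "(x2 - x1) * b w = (x2 - a w) * b u + (a w - x1) * b v"
      using collinear_relation[OF Qg Qg Qg, of u v w] h by simp
    moreover have "b u \<in> B" "b v \<in> B" "b w \<in> B" "a w \<in> A0" using h ne[OF t(1)] by (auto simp: A0_def A_def B_def)
    ultimately show "z \<in> G" unfolding G_def t(2) by (auto simp: image_iff) metis
  qed
  moreover have "finite G"
  proof (rule finite_subset)
    show "G \<subseteq> A \<times> B \<times> B" by (auto simp: G_def A0_def)
  qed (use finA finB in simp)
  ultimately have "card (TT x) \<le> card G" by (metis card_image card_mono)
  then have cG: "s ^ 3 / K ^ 80 \<le> card G" using x(2) unfolding Tx by linarith
  have "x1 \<noteq> x2" using \<open>TT x \<noteq> {}\<close> ne(1) by auto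
  moreover have "x1 \<in> F" "x2 \<in> F" using x(1) AF by (auto simp: xx)
  moreover have "card A0 \<le> 4 * K * s"
  proof -
    have "card A0 \<le> card A" unfolding A0_def using finA by (intro card_mono) auto
    then show ?thesis using cA by linarith
  qed
  moreover have "A0 \<subseteq> F" "x1 \<notin> A0" "x2 \<notin> A0" using AF by (auto simp: A0_def)
  ultimately show ?thesis using BF cB cG unfolding G_def
    by (intro exI[of _ A0] exI[of _ B] exI[of _ x1] exI[of _ x2] conjI)
qed

end

section \<open>The incidence theorem\<close>

text \<open>\<open>sum_product_core\<close> is applied with K^90 in place of \<open>K\<close>, and
  returning from M = K^3 s to \<open>s\<close> costs 3 more.\<close>

definition incidence_exponent :: "nat \<Rightarrow> nat" where
  "incidence_exponent j = 90 * (15840 * (growth_exponent j + 1) + 243) + 3"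

context anisotropic_field
begin

text \<open>Stated as a bound on \<open>s\<close>: incidences within a factor \<open>K\<close> of
  the trivial order are possible only if \<open>K\<close> is at least a fixed power of
  \<open>s\<close>. Hypothesis \<open>j\<close> is that of \<open>sum_product_core\<close> after
  substitution, with 1797 = 90 * 20 - 3.\<close>

theorem incidence_bound:
  fixes s K :: real
  assumes PF: "P \<subseteq> F \<times> F" and cP: "card P = s\<^sup>2"
    and L: "finite L" "\<And>l. l \<in> L \<Longrightarrow> is_line F l" "card L \<le> s\<^sup>2"
    and inc: "s ^ 3 / K \<le> (\<Sum>l\<in>L. real (card (l \<inter> P)))"
    and K: "2 \<le> K" and s0: "0 < s" and sF: "s\<^sup>2 \<le> card F" and j: "card F < (s / K ^ 1797) ^ (2 ^ j)"
  shows "s \<le> K ^ incidence_exponent j"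
proof (cases "8 * K ^ 23 \<le> s")
  case False
  have K1: "1 \<le> K" using K by simp
  have "s \<le> 8 * K ^ 23" using False by simp
  also have "\<dots> \<le> K ^ 3 * K ^ 23" using power_absorb[OF K, of 8 3] K by (intro mult_right_mono) auto
  also have "\<dots> = K ^ 26" by (simp flip: power_add)
  also have "\<dots> \<le> K ^ incidence_exponent j"
    using K1 by (intro power_increasing) (auto simp: incidence_exponent_def)
  finally show ?thesis .
next
  case True
  have K1: "1 \<le> K" and K0: "0 < K" using K by auto
  have finP: "finite P" using PF by (rule finite_subset) simp
  have "K ^ 1 \<le> K ^ 23" using K1 by (intro power_increasing) auto
  then have s8: "8 * K \<le> s" using True by simp
  have uniq: "l = l'" if "l \<in> L" "l' \<in> L" "w \<noteq> w'" "w \<in> l" "w \<in> l'" "w' \<in> l" "w' \<in> l'" for l l' w w'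
    using line_unique[OF L(2)[OF that(1)] L(2)[OF that(2)] that(3-7)] .
  obtain L1 p1 p2 Q where L1: "L1 \<subseteq> L" and p: "p1 \<in> P" "p2 \<in> P" and QP: "Q \<subseteq> P"
    and deg: "\<forall>p\<in>P. card {l\<in>L1. p \<in> l} \<le> 4 * K * s"
    and cQ: "s\<^sup>2 / K ^ 19 \<le> card Q" and dQ: "\<forall>q\<in>Q. s / (4 * K) \<le> card {l\<in>L1. q \<in> l}"
    and jQ: "\<forall>q\<in>Q. q \<noteq> p1 \<and> q \<noteq> p2 \<and> (\<exists>l1\<in>L1. \<exists>l2\<in>L1. l1 \<noteq> l2 \<and> q \<in> l1 \<and> p1 \<in> l1 \<and> q \<in> l2 \<and> p2 \<in> l2)"
  proof -
    have "\<exists>L1\<subseteq>L. \<exists>p1\<in>P. \<exists>p2\<in>P. \<exists>Q\<subseteq>P. (\<forall>p\<in>P. card {l\<in>L1. p \<in> l} \<le> 4 * K * s) \<and>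
      s\<^sup>2 / K ^ 19 \<le> card Q \<and> (\<forall>q\<in>Q. s / (4 * K) \<le> card {l\<in>L1. q \<in> l}) \<and>
      (\<forall>q\<in>Q. q \<noteq> p1 \<and> q \<noteq> p2 \<and> (\<exists>l1\<in>L1. \<exists>l2\<in>L1. l1 \<noteq> l2 \<and> q \<in> l1 \<and> p1 \<in> l1 \<and> q \<in> l2 \<and> p2 \<in> l2))"
      by (rule rich_pair[OF finP L(1) cP L(3) uniq inc K s8])
    then show ?thesis by (elim exE conjE bexE) (rule that)
  qed
  have finL1: "finite L1" using L1 L(1) by (rule finite_subset)
  have lines: "is_line F l" if "l \<in> L1" for l using that L1 L(2) by blast
  have cL1: "card L1 \<le> s\<^sup>2" using card_mono[OF L(1) L1] L(3) by linarith
  have pF: "p1 \<in> F \<times> F" "p2 \<in> F \<times> F" using p PF by auto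
  \<comment> \<open>Otherwise the line \<open>l1\<close> through \<open>q\<close> and
    \<open>p1\<close> would contain \<open>p2\<close> and coincide with \<open>l2\<close>.\<close>
  have ndet: "det3 p1 p2 q \<noteq> 0" if q: "q \<in> Q" for q
  proof
    assume d: "det3 p1 p2 q = 0"
    obtain l1 l2 where l: "l1 \<in> L1" "l2 \<in> L1" "l1 \<noteq> l2" "q \<in> l1" "p1 \<in> l1" "q \<in> l2" "p2 \<in> l2" "q \<noteq> p1" "q \<noteq> p2"
      using jQ q by blast
    have "det3 q p1 p2 = 0" using d det3_rotate[of q p1 p2] det3_rotate[of p2 q p1] by simp
    then have "p2 \<in> l1" using line_mem[OF lines[OF l(1)] l(4,5,8) pF(2)] by simp
    then have "l1 = l2" using line_unique[OF lines[OF l(1)] lines[OF l(2)] l(9)] l by simp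
    then show False using l(3) by simp
  qed
  have "0 < s\<^sup>2 / K ^ 19" using s0 K0 by simp
  then have "Q \<noteq> {}" using cQ by auto
  then obtain q0 where "q0 \<in> Q" by blast
  have "p1 \<noteq> p2"
  proof
    assume "p1 = p2"
    then have "det3 p1 p2 q0 = 0" by (simp add: det3_def)
    then show False using ndet[OF \<open>q0 \<in> Q\<close>] by simp
  qed
  then interpret pencils F e p1 p2 by unfold_locales (use pF in auto)
  have Qgood: "Q \<subseteq> good" using ndet QP PF by (auto simp: good_def)
  have "\<exists>A B x1 x2. A \<subseteq> F \<and> B \<subseteq> F \<and> x1 \<in> F \<and> x2 \<in> F \<and> x1 \<noteq> x2 \<and> x1 \<notin> A \<and> x2 \<notin> A \<and>
    card A \<le> 4 * K * s \<and> card B \<le> 4 * K * s \<and> s ^ 3 / K ^ 80 \<le>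
      card {(x, y1, y2). x \<in> A \<and> y1 \<in> B \<and> y2 \<in> B \<and> (x2 - x) * y1 + (x - x1) * y2 \<in> (*) (x2 - x1) ` B}"
  proof (rule grid_relation[OF finL1 lines cL1 Qgood cQ _ _ _ _ _ K True])
    show "real (card {l \<in> L1. p1 \<in> l}) \<le> 4 * K * s" "real (card {l \<in> L1. p2 \<in> l}) \<le> 4 * K * s"
      using deg p by auto
    show "\<exists>l\<in>L1. q \<in> l \<and> p1 \<in> l" "\<exists>l\<in>L1. q \<in> l \<and> p2 \<in> l" if "q \<in> Q" for q
      using jQ that by blast+
    show "s / (4 * K) \<le> real (card {l \<in> L1. q \<in> l})" if "q \<in> Q" for q using dQ that by simp
  qed
  then obtain A B x1 x2 where AF: "A \<subseteq> F" and BF: "B \<subseteq> F" and xF: "x1 \<in> F" "x2 \<in> F" and xne: "x1 \<noteq> x2"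
    and xA: "x1 \<notin> A" "x2 \<notin> A" and cA: "card A \<le> 4 * K * s" and cB: "card B \<le> 4 * K * s"
    and big: "s ^ 3 / K ^ 80 \<le>
      card {(x, y1, y2). x \<in> A \<and> y1 \<in> B \<and> y2 \<in> B \<and> (x2 - x) * y1 + (x - x1) * y2 \<in> (*) (x2 - x1) ` B}"
    by (elim exE conjE) (rule that)
  define G where "G = {(x, y1, y2). x \<in> A \<and> y1 \<in> B \<and> y2 \<in> B \<and> (x2 - x) * y1 + (x - x1) * y2 \<in> (*) (x2 - x1) ` B}"
  have finA: "finite A" and finB: "finite B" using AF BF finite_sub_F by auto
  have finBB: "finite (B \<times> B)" using finB by simp
  have G: "G \<subseteq> A \<times> (B \<times> B)" by (auto simp: G_def)
  define g where "g x = real (card {y. (x, y) \<in> G})" for x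
  have sg: "s ^ 3 / K ^ 80 \<le> sum g A"
    using big card_Sigma_sum(1)[OF finA finBB G] unfolding G_def[symmetric] g_def by (simp flip: of_nat_sum)
  define c where "c = s\<^sup>2 / (8 * K ^ 81)"
  define A1 where "A1 = {x\<in>A. c \<le> g x}"
  have A1A: "A1 \<subseteq> A" by (auto simp: A1_def)
  have c0: "0 < c" using s0 K0 by (simp add: c_def)
  have "card A * c \<le> (4 * K * s) * c" using cA c0 by (intro mult_right_mono) auto
  also have "\<dots> = s ^ 3 / K ^ 80 / 2"
    using K0 by (simp add: c_def power2_eq_square power3_eq_cube field_simps flip: power_Suc)
  finally have "s ^ 3 / K ^ 80 / 2 \<le> sum g A1"
    unfolding A1_def using finA sg c0 by (intro popular_sum) auto
  also have "\<dots> \<le> (\<Sum>x\<in>A1. (4 * K * s)\<^sup>2)"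
  proof (rule sum_mono)
    fix x
    have "card {y. (x, y) \<in> G} \<le> card (B \<times> B)" using finBB G by (intro card_mono) auto
    then have "g x \<le> real (card B) * real (card B)" by (simp add: g_def card_cartesian_product flip: of_nat_mult)
    also have "\<dots> \<le> (4 * K * s) * (4 * K * s)" using cB by (intro mult_mono) auto
    finally show "g x \<le> (4 * K * s)\<^sup>2" by (simp add: power2_eq_square)
  qed
  finally have "s ^ 3 / K ^ 80 / 2 \<le> card A1 * (4 * K * s)\<^sup>2" by simp
  moreover have "s ^ 3 / K ^ 80 / 2 = s / (32 * K ^ 82) * (4 * K * s)\<^sup>2"
  proof -
    have "K ^ 82 = K ^ 80 * K\<^sup>2" by (simp flip: power_add)
    then show ?thesis using K0 by (simp add: power2_eq_square power3_eq_cube)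
  qed
  ultimately have "s / (32 * K ^ 82) * (4 * K * s)\<^sup>2 \<le> card A1 * (4 * K * s)\<^sup>2" by linarith
  moreover have "0 < (4 * K * s)\<^sup>2" using K0 s0 by simp
  ultimately have cA1': "s / (32 * K ^ 82) \<le> card A1" by (rule mult_right_le_imp_le)
  have cA1: "s / K ^ 87 \<le> card A1"
  proof -
    have "32 * K ^ 82 \<le> K ^ 5 * K ^ 82" using power_absorb[OF K, of 32 5] K by (intro mult_right_mono) auto
    also have "\<dots> = K ^ 87" by (simp flip: power_add)
    finally have "s / K ^ 87 \<le> s / (32 * K ^ 82)" using s0 K0 by (intro divide_left_mono) auto
    then show ?thesis using cA1' by linarith
  qed
  have c84: "s\<^sup>2 / K ^ 84 \<le> c"
  proof -
    have "8 * K ^ 81 \<le> K ^ 3 * K ^ 81" using power_absorb[OF K, of 8 3] K by (intro mult_right_mono) auto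
    also have "\<dots> = K ^ 84" by (simp flip: power_add)
    finally show ?thesis unfolding c_def using s0 K0 by (intro divide_left_mono) auto
  qed
  \<comment> \<open>K^3 s dominates the bound 4 K s for \<open>B\<close>.\<close>
  define M where "M = K ^ 3 * s"
  have M0: "0 < M" using K0 s0 by (simp add: M_def)
  have cBM: "card B \<le> M"
  proof -
    have "4 * K \<le> K\<^sup>2 * K" using power_absorb[OF K, of 4 2] K by (intro mult_right_mono) auto
    then have "4 * K * s \<le> K ^ 3 * s" using s0 by (intro mult_right_mono) (auto simp: power2_eq_square power3_eq_cube)
    then show ?thesis using cB by (simp add: M_def)
  qed
  \<comment> \<open>Dividing the grid relation by x - x1 gives r x * y1 + y2 = (r x + e) * y3. The
    map is injective because r x + e is a fixed nonzero multiple of the inverse of x - x1.\<close>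
  define r where "r x = (x2 - x) * iv (x - x1)" for x
  have A1F: "x \<in> F" "x - x1 \<in> F" "x - x1 \<noteq> 0" "x2 - x \<in> F" "x2 - x \<noteq> 0" if "x \<in> A1" for x
    using that A1A AF xA xF by (auto intro: diff_F)
  have ivF: "iv (x - x1) \<in> F" "iv (x - x1) \<noteq> 0" "(x - x1) * iv (x - x1) = e" if "x \<in> A1" for x
    using iv[OF A1F(2,3)[OF that]] by auto
  have re: "r x + e = (x2 - x1) * iv (x - x1)" if "x \<in> A1" for x
  proof -
    have "r x + e = r x + (x - x1) * iv (x - x1)" by (simp only: ivF(3)[OF that])
    also have "\<dots> = (x2 - x1) * iv (x - x1)" by (simp add: r_def algebra_simps)
    finally show ?thesis .
  qed
  have x21: "x2 - x1 \<in> F" "x2 - x1 \<noteq> 0" using xF xne by (auto intro: diff_F)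
  define Lam where "Lam = r ` A1"
  have inj: "inj_on r A1"
  proof (rule inj_onI)
    fix x y assume xy: "x \<in> A1" "y \<in> A1" "r x = r y"
    have "(x2 - x1) * iv (x - x1) = (x2 - x1) * iv (y - x1)" using re[OF xy(1)] re[OF xy(2)] xy(3) by simp
    then have "(x2 - x1) * (y - x1) = (x2 - x1) * (x - x1)"
      using frac_eq_iff[OF x21(1) x21(1) A1F(2)[OF xy(1)] A1F(2)[OF xy(2)] A1F(3)[OF xy(1)] A1F(3)[OF xy(2)]] by simp
    then have "y - x1 = x - x1" using mult_cancel[OF x21 A1F(2)[OF xy(2)] A1F(2)[OF xy(1)]] by simp
    then show "x = y" by simp
  qed
  have LamF: "Lam \<subseteq> F" using A1F ivF by (auto simp: Lam_def r_def intro!: mult_F)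
  have "r x \<noteq> 0" if "x \<in> A1" for x
    using mult_eq_zero[OF A1F(4)[OF that] ivF(1)[OF that]] A1F(5)[OF that] ivF(2)[OF that] by (auto simp: r_def)
  then have Lam0: "0 \<notin> Lam" by (auto simp: Lam_def)
  \<comment> \<open>90 = 87 + 3 = 84 + 6 turns the lower bounds s / K^87 for the number of ratios
    and s^2 / K^84 for the solutions into M / K' and M^2 / K'.\<close>
  define K' where "K' = K ^ 90"
  have K'2: "2 \<le> K'"
  proof -
    have "K ^ 1 \<le> K ^ 90" using K1 by (intro power_increasing) auto
    then show ?thesis using K by (simp add: K'_def)
  qed
  have MK: "M / K' = s / K ^ 87"
  proof -
    have 1: "K' = K ^ 3 * K ^ 87" by (simp add: K'_def flip: power_add)
    show ?thesis unfolding M_def 1 by (rule mult_divide_mult_cancel_left) (use K0 in simp)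
  qed
  have MK2: "M\<^sup>2 / K' = s\<^sup>2 / K ^ 84"
  proof -
    have 1: "K' = K ^ 6 * K ^ 84" by (simp add: K'_def flip: power_add)
    have 2: "M\<^sup>2 = K ^ 6 * s\<^sup>2" by (simp add: M_def power_mult_distrib flip: power_mult)
    show ?thesis unfolding 1 2 by (rule mult_divide_mult_cancel_left) (use K0 in simp)
  qed
  have cLam: "M / K' \<le> card Lam" using cA1 inj by (simp add: MK Lam_def card_image)
  define C where "C l = (*) (l + e) ` B" for l
  have cC: "card (C l) \<le> M" for l
  proof -
    have "card (C l) \<le> card B" unfolding C_def using finB by (rule card_image_le)
    then show ?thesis using cBM by linarith
  qed
  have cE: "M\<^sup>2 / K' \<le> card {(x, y). x \<in> B \<and> y \<in> B \<and> l * x + y \<in> C l}" if l: "l \<in> Lam" for l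
  proof -
    obtain x where x: "x \<in> A1" "l = r x" using l by (auto simp: Lam_def)
    have "{y. (x, y) \<in> G} \<subseteq> {(y1, y2). y1 \<in> B \<and> y2 \<in> B \<and> l * y1 + y2 \<in> C l}"
    proof
      fix y assume y: "y \<in> {y. (x, y) \<in> G}"
      obtain y1 y2 where yy: "y = (y1, y2)" by (metis surj_pair)
      have h: "y1 \<in> B" "y2 \<in> B" "(x2 - x) * y1 + (x - x1) * y2 \<in> (*) (x2 - x1) ` B"
        using y by (auto simp: G_def yy)
      then obtain y3 where y3: "y3 \<in> B" "(x2 - x) * y1 + (x - x1) * y2 = (x2 - x1) * y3" by blast
      have "y2 \<in> F" using h(2) BF by auto
      have "l * y1 + y2 = l * y1 + e * y2" using unit[OF \<open>y2 \<in> F\<close>] by simp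
      also have "\<dots> = l * y1 + ((x - x1) * iv (x - x1)) * y2" by (simp only: ivF(3)[OF x(1)])
      also have "\<dots> = iv (x - x1) * ((x2 - x) * y1 + (x - x1) * y2)"
        unfolding x(2) r_def by (simp add: algebra_simps)
      also have "\<dots> = (l + e) * y3" unfolding y3(2) x(2) re[OF x(1)] by (simp only: mult_ac)
      finally have "l * y1 + y2 \<in> C l" using y3(1) by (simp add: C_def)
      then show "y \<in> {(y1, y2). y1 \<in> B \<and> y2 \<in> B \<and> l * y1 + y2 \<in> C l}" using h by (simp add: yy)
    qed
    moreover have "finite {(y1, y2). y1 \<in> B \<and> y2 \<in> B \<and> l * y1 + y2 \<in> C l}"
      by (rule finite_subset[OF _ finBB]) auto
    ultimately have "card {y. (x, y) \<in> G} \<le> card {(y1, y2). y1 \<in> B \<and> y2 \<in> B \<and> l * y1 + y2 \<in> C l}"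
      by (intro card_mono)
    moreover have "c \<le> card {y. (x, y) \<in> G}" using x(1) by (simp add: A1_def g_def)
    ultimately show ?thesis using c84 unfolding MK2 by linarith
  qed
  have j': "card F < (M / K' ^ 20) ^ (2 ^ j)"
  proof -
    have 1: "K' ^ 20 = K ^ 3 * K ^ 1797" unfolding K'_def by (simp flip: power_add power_mult)
    have "M / K' ^ 20 = s / K ^ 1797"
      unfolding M_def 1 by (rule mult_divide_mult_cancel_left) (use K0 in simp)
    then show ?thesis using j by simp
  qed
  have finC: "finite (C l)" for l using finB by (simp add: C_def)
  define n where "n = 15840 * (growth_exponent j + 1) + 243"
  have dich: "M \<le> K' ^ n \<or> card F \<le> K' ^ n * M"
    unfolding n_def by (rule sum_product_core[OF BF LamF Lam0 cLam finC cC cBM cE K'2 M0 j'])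
  have Kn: "K ^ incidence_exponent j = K' ^ n * K ^ 3"
    unfolding K'_def by (simp add: incidence_exponent_def n_def flip: power_mult power_add)
  have K3: "1 \<le> K ^ 3" using K1 by (rule one_le_power)
  from dich show ?thesis
  proof
    assume "M \<le> K' ^ n"
    moreover have "s \<le> M" using K3 s0 by (simp add: M_def)
    moreover have "K' ^ n \<le> K' ^ n * K ^ 3" using K3 K'2 by simp
    ultimately show ?thesis unfolding Kn by linarith
  next
    assume "card F \<le> K' ^ n * M"
    \<comment> \<open>The hypothesis s^2 \<le> |F| turns the second alternative into a bound on
      \<open>s\<close> as well.\<close>
    then have "s * s \<le> (K' ^ n * K ^ 3) * s" using sF by (simp add: M_def power2_eq_square mult_ac)
    then show ?thesis unfolding Kn using s0 by (rule mult_right_le_imp_le)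
  qed
qed

end

section \<open>Distances and bisectors\<close>

definition sqdist :: "'a::comm_ring \<times> 'a \<Rightarrow> 'a \<times> 'a \<Rightarrow> 'a" where
  "sqdist u v = (fst u - fst v) * (fst u - fst v) + (snd u - snd v) * (snd u - snd v)"

context prime_field
begin

text \<open>If the linear form kills v - u and w - u, both coefficients annihilate
  \<open>det3 u v w\<close>, and one of them is invertible. The converse uses a nonzero coordinate
  of v - u in the same way.\<close>

lemma linear_equation_is_line:
  assumes ab: "\<alpha> \<in> F" "\<beta> \<in> F" "\<alpha> \<noteq> 0 \<or> \<beta> \<noteq> 0"
  shows "is_line F {w \<in> F \<times> F. \<alpha> * fst w + \<beta> * snd w = \<gamma>}" (is "is_line F ?l")
proof -
  have dF: "fst v - fst u \<in> F" "snd v - snd u \<in> F" if "u \<in> F \<times> F" "v \<in> F \<times> F" for u v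
    using that by (auto intro: diff_F)
  have 1: "det3 u v w = 0" if h: "u \<in> ?l" "v \<in> ?l" "w \<in> ?l" for u v w
  proof -
    define d1 d2 e1 e2 where "d1 = fst v - fst u" and "d2 = snd v - snd u" and "e1 = fst w - fst u" and "e2 = snd w - snd u"
    have d: "\<alpha> * d1 + \<beta> * d2 = 0" using h unfolding d1_def d2_def by (simp add: algebra_simps)
    have e: "\<alpha> * e1 + \<beta> * e2 = 0" using h unfolding e1_def e2_def by (simp add: algebra_simps)
    have D: "det3 u v w = d1 * e2 - e1 * d2" by (simp add: det3_def d1_def d2_def e1_def e2_def)
    have F: "d1 \<in> F" "d2 \<in> F" "e1 \<in> F" "e2 \<in> F" using h dF by (auto simp: d1_def d2_def e1_def e2_def)
    have DF: "d1 * e2 - e1 * d2 \<in> F" using F by (intro diff_F mult_F)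
    have "\<alpha> * (d1 * e2 - e1 * d2) = (\<alpha> * d1 + \<beta> * d2) * e2 - (\<alpha> * e1 + \<beta> * e2) * d2" by (simp add: algebra_simps)
    then have a: "\<alpha> * (d1 * e2 - e1 * d2) = 0" by (simp add: d e)
    have "\<beta> * (d1 * e2 - e1 * d2) = (\<alpha> * e1 + \<beta> * e2) * d1 - (\<alpha> * d1 + \<beta> * d2) * e1" by (simp add: algebra_simps)
    then have b: "\<beta> * (d1 * e2 - e1 * d2) = 0" by (simp add: d e)
    show ?thesis using mult_eq_zero[OF ab(1) DF a] mult_eq_zero[OF ab(2) DF b] ab(3) D by auto
  qed
  have 2: "w \<in> ?l" if h: "u \<in> ?l" "v \<in> ?l" "u \<noteq> v" "w \<in> F \<times> F" and D0: "det3 u v w = 0" for u v w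
  proof -
    define d1 d2 e1 e2 where "d1 = fst v - fst u" and "d2 = snd v - snd u" and "e1 = fst w - fst u" and "e2 = snd w - snd u"
    have d: "\<alpha> * d1 + \<beta> * d2 = 0" using h unfolding d1_def d2_def by (simp add: algebra_simps)
    have D: "d1 * e2 = e1 * d2" using D0 by (simp add: det3_def d1_def d2_def e1_def e2_def)
    have F: "d1 \<in> F" "d2 \<in> F" "e1 \<in> F" "e2 \<in> F" using h dF by (auto simp: d1_def d2_def e1_def e2_def)
    have ne: "d1 \<noteq> 0 \<or> d2 \<noteq> 0" using h(3) by (auto simp: d1_def d2_def prod_eq_iff)
    have EF: "\<alpha> * e1 + \<beta> * e2 \<in> F" using F ab by (intro add_F mult_F)
    have "d1 * (\<alpha> * e1 + \<beta> * e2) = (\<alpha> * d1 + \<beta> * d2) * e1 + \<beta> * (d1 * e2 - e1 * d2)" by (simp add: algebra_simps)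
    then have a: "d1 * (\<alpha> * e1 + \<beta> * e2) = 0" by (simp add: d D)
    have "d2 * (\<alpha> * e1 + \<beta> * e2) = (\<alpha> * d1 + \<beta> * d2) * e2 - \<alpha> * (d1 * e2 - e1 * d2)" by (simp add: algebra_simps)
    then have b: "d2 * (\<alpha> * e1 + \<beta> * e2) = 0" by (simp add: d D)
    have "\<alpha> * e1 + \<beta> * e2 = 0"
      using mult_eq_zero[OF F(1) EF a] mult_eq_zero[OF F(2) EF b] ne by auto
    moreover have "\<alpha> * fst w + \<beta> * snd w = (\<alpha> * e1 + \<beta> * e2) + (\<alpha> * fst u + \<beta> * snd u)"
      by (simp add: e1_def e2_def algebra_simps)
    ultimately show ?thesis using h by simp
  qed
  show ?thesis unfolding is_line_def using 1 2 by blast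
qed

text \<open>The pair $(m, t)$ stands for the line $y = m x + t$. Two points with different abscissae lie on
  exactly one of these lines, two points with equal abscissae on none.\<close>

lemma line_second_moment:
  assumes P: "P \<subseteq> F \<times> F"
  defines "i \<equiv> (\<lambda>(m, t). real (card {w \<in> P. snd w = m * fst w + t}))"
  shows "(\<Sum>x\<in>F \<times> F. (i x - card P / card F)\<^sup>2) \<le> card F * card P"
proof -
  have finFF: "finite (F \<times> F)" by simp
  have finP: "finite P" using P finFF by (rule finite_subset)
  have one: "card {x \<in> F \<times> F. snd w = fst x * fst w + snd x} = card F" if w: "w \<in> P" for w
  proof -
    have "{x \<in> F \<times> F. snd w = fst x * fst w + snd x} = (\<lambda>m. (m, snd w - m * fst w)) ` F"
      using w P by (auto simp: image_iff intro!: diff_F mult_F)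
    then show ?thesis by (simp add: card_image inj_on_def)
  qed
  have two: "card {x \<in> F \<times> F. snd w = fst x * fst w + snd x \<and> snd w' = fst x * fst w' + snd x} \<le> 1"
    if w: "w \<in> P" "w' \<in> P" "w \<noteq> w'" for w w'
  proof -
    let ?S = "{x \<in> F \<times> F. snd w = fst x * fst w + snd x \<and> snd w' = fst x * fst w' + snd x}"
    have "x = y" if xy: "x \<in> ?S" "y \<in> ?S" for x y
    proof -
      have h: "fst w \<in> F" "fst w' \<in> F" "fst x \<in> F" "fst y \<in> F" using w P xy by auto
      have ne: "fst w \<noteq> fst w'" using w(3) xy(1) by (auto simp: prod_eq_iff)
      have slope: "(fst w - fst w') * fst z = snd w - snd w'" if "z \<in> ?S" for z
      proof -
        from that have "snd w = fst z * fst w + snd z" "snd w' = fst z * fst w' + snd z" by auto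
        then have "snd w - snd w' = (fst z * fst w + snd z) - (fst z * fst w' + snd z)" by (simp only:)
        then show ?thesis by (simp add: algebra_simps)
      qed
      have "fst x = fst y"
      proof (rule mult_cancel)
        show "(fst w - fst w') * fst x = (fst w - fst w') * fst y"
          by (simp only: slope[OF xy(1)] slope[OF xy(2)])
      qed (use h ne in \<open>auto intro: diff_F\<close>)
      from xy have "snd w = fst x * fst w + snd x" "snd w = fst y * fst w + snd y" by auto
      then have "fst x * fst w + snd x = fst y * fst w + snd y" by (rule trans[OF sym])
      then have "snd x = snd y" unfolding \<open>fst x = fst y\<close> by (rule add_left_imp_eq)
      with \<open>fst x = fst y\<close> show "x = y" by (rule prod_eqI)
    qed
    moreover have "finite ?S" using finFF by (rule rev_finite_subset) auto
    ultimately show ?thesis by (simp only: card_le_Suc0_iff_eq One_nat_def) blast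
  qed
  define on :: "'a \<times> 'a \<Rightarrow> 'a \<times> 'a \<Rightarrow> real" where "on x w = of_bool (snd w = fst x * fst w + snd x)" for x w
  have i_on: "i x = (\<Sum>w\<in>P. on x w)" for x
  proof -
    have "P \<inter> {w. snd w = fst x * fst w + snd x} = {w \<in> P. snd w = fst x * fst w + snd x}" by blast
    then show ?thesis using real_card_Int[OF finP, of "{w. snd w = fst x * fst w + snd x}"]
      by (simp add: i_def on_def case_prod_beta)
  qed
  have on1: "(\<Sum>x\<in>F \<times> F. on x w) = card F" if "w \<in> P" for w
  proof -
    have "(F \<times> F) \<inter> {x. snd w = fst x * fst w + snd x} = {x \<in> F \<times> F. snd w = fst x * fst w + snd x}" by blast
    then show ?thesis using real_card_Int[OF finFF, of "{x. snd w = fst x * fst w + snd x}"] one[OF that]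
      by (simp add: on_def)
  qed
  \<comment> \<open>Each point lies on |F| lines and two distinct points on at most one common line.
    Bounding the latter by 1 makes the second moment exceed the square of the mean only by the
    diagonal term |F| |P|.\<close>
  have on2: "(\<Sum>x\<in>F \<times> F. on x w * on x w') \<le> (if w = w' then real (card F) else 0) + 1" if "w \<in> P" "w' \<in> P" for w w'
  proof (cases "w = w'")
    case True
    have "(\<Sum>x\<in>F \<times> F. on x w * on x w) = (\<Sum>x\<in>F \<times> F. on x w)"
      by (intro sum.cong) (auto simp: on_def)
    then show ?thesis using on1[OF that(1)] True by simp
  next
    case False
    have "(F \<times> F) \<inter> {x. snd w = fst x * fst w + snd x \<and> snd w' = fst x * fst w' + snd x}
       = {x \<in> F \<times> F. snd w = fst x * fst w + snd x \<and> snd w' = fst x * fst w' + snd x}" by blast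
    moreover have "(\<Sum>x\<in>F \<times> F. on x w * on x w') =
        (\<Sum>x\<in>F \<times> F. of_bool (x \<in> {x. snd w = fst x * fst w + snd x \<and> snd w' = fst x * fst w' + snd x}))"
      by (intro sum.cong) (auto simp: on_def)
    ultimately show ?thesis
      using real_card_Int[OF finFF, of "{x. snd w = fst x * fst w + snd x \<and> snd w' = fst x * fst w' + snd x}"]
        two[OF that False] False by simp
  qed
  have s1: "sum i (F \<times> F) = card P * card F"
  proof -
    have "sum i (F \<times> F) = (\<Sum>w\<in>P. \<Sum>x\<in>F \<times> F. on x w)" unfolding i_on by (rule sum.swap)
    also have "\<dots> = (\<Sum>w\<in>P. real (card F))" using on1 by (intro sum.cong) auto
    finally show ?thesis by simp
  qed
  have s2: "(\<Sum>x\<in>F \<times> F. (i x)\<^sup>2) \<le> card P * card F + (real (card P))\<^sup>2"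
  proof -
    have "(\<Sum>x\<in>F \<times> F. (i x)\<^sup>2) = (\<Sum>x\<in>F \<times> F. \<Sum>w\<in>P. \<Sum>w'\<in>P. on x w * on x w')"
      unfolding i_on by (simp add: power2_eq_square sum_product)
    also have "\<dots> = (\<Sum>w\<in>P. \<Sum>x\<in>F \<times> F. \<Sum>w'\<in>P. on x w * on x w')" by (rule sum.swap)
    also have "\<dots> = (\<Sum>w\<in>P. \<Sum>w'\<in>P. \<Sum>x\<in>F \<times> F. on x w * on x w')"
      by (intro sum.cong refl sum.swap)
    also have "\<dots> \<le> (\<Sum>w\<in>P. \<Sum>w'\<in>P. (if w = w' then real (card F) else 0) + 1)"
      using on2 by (intro sum_mono)
    also have "\<dots> = (\<Sum>w\<in>P. real (card F) + card P)"
      using finP by (intro sum.cong) (auto simp: sum.distrib)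
    also have "\<dots> = card P * card F + (real (card P))\<^sup>2" by (simp add: algebra_simps power2_eq_square)
    finally show ?thesis .
  qed
  define \<mu> where "\<mu> = real (card P) / card F"
  have mu: "\<mu> * card F = card P" using e_F by (auto simp: \<mu>_def)
  have "(\<Sum>x\<in>F \<times> F. (i x - \<mu>)\<^sup>2) = (\<Sum>x\<in>F \<times> F. (i x)\<^sup>2) - 2 * \<mu> * sum i (F \<times> F) + card (F \<times> F) * \<mu>\<^sup>2"
    by (simp add: power2_diff sum.distrib sum_subtractf sum_distrib_left mult_ac)
  also have "card (F \<times> F) * \<mu>\<^sup>2 = (real (card P))\<^sup>2"
    unfolding mu[symmetric] by (simp add: card_cartesian_product power2_eq_square)
  also have "2 * \<mu> * sum i (F \<times> F) = 2 * (real (card P))\<^sup>2"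
    unfolding s1 using mu by (simp add: power2_eq_square)
  also have "(\<Sum>x\<in>F \<times> F. (i x)\<^sup>2) - 2 * (real (card P))\<^sup>2 + (real (card P))\<^sup>2 \<le> card F * card P"
    using s2 by (simp add: mult.commute)
  finally show ?thesis by (simp add: \<mu>_def)
qed

end

section \<open>Perpendicular bisectors and isosceles triangles\<close>

definition sqdists :: "('a::comm_ring \<times> 'a) set \<Rightarrow> 'a set" where
  "sqdists P = {sqdist u v | u v. u \<in> P \<and> v \<in> P}"

text \<open>Relative to a point set, so that one notion gives the line, for
  \<open>F \<times> F\<close>, and its trace on \<open>P\<close>.\<close>

definition bisector :: "('a::comm_ring \<times> 'a) set \<Rightarrow> 'a \<times> 'a \<Rightarrow> 'a \<times> 'a \<Rightarrow> ('a \<times> 'a) set" where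
  "bisector P u v = {w \<in> P. sqdist w u = sqdist w v}"

lemma bisector_iff:
  "sqdist w u = sqdist w v \<longleftrightarrow>
    ((fst v - fst u) + (fst v - fst u)) * fst w + ((snd v - snd u) + (snd v - snd u)) * snd w
      = (fst v * fst v + snd v * snd v) - (fst u * fst u + snd u * snd u)" (is "_ \<longleftrightarrow> ?l = ?r")
proof -
  have "sqdist w u - sqdist w v = ?l - ?r" by (simp add: sqdist_def algebra_simps)
  then show ?thesis by (metis eq_iff_diff_eq_0)
qed

context anisotropic_field
begin

text \<open>If x \<noteq> 0, division by \<open>x\<close> gives e + e = 0, so that (e, e) is a
  nontrivial zero of x^2 + y^2.\<close>

lemma double_nz:
  assumes "x \<in> F" "x + x = 0" shows "x = 0"
proof (rule ccontr)
  assume "x \<noteq> 0"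
  have "iv x * (x + x) = e + e" by (simp only: distrib_left iv(3)[OF assms(1) \<open>x \<noteq> 0\<close>])
  then have "e + e = 0" by (simp add: assms(2))
  moreover have "e * e = e" using unit e_F by blast
  ultimately show False using anisotropic[OF e_F e_F] e_nz by simp
qed

lemma sq_nz: "x \<in> F \<Longrightarrow> y \<in> F \<Longrightarrow> x \<noteq> 0 \<or> y \<noteq> 0 \<Longrightarrow> x * x + y * y \<noteq> 0"
  using anisotropic by blast

lemma bisector_is_line:
  assumes "u \<in> F \<times> F" "v \<in> F \<times> F" "u \<noteq> v"
  shows "is_line F (bisector (F \<times> F) u v)"
proof -
  have F: "fst v - fst u \<in> F" "snd v - snd u \<in> F" using assms by (auto intro: diff_F)
  have ne: "fst v - fst u \<noteq> 0 \<or> snd v - snd u \<noteq> 0" using assms(3) by (auto simp: prod_eq_iff)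
  have "(fst v - fst u) + (fst v - fst u) \<noteq> 0 \<or> (snd v - snd u) + (snd v - snd u) \<noteq> 0"
    using double_nz[OF F(1)] double_nz[OF F(2)] ne by blast
  then show ?thesis unfolding bisector_def bisector_iff
    using F by (intro linear_equation_is_line add_F)
qed

text \<open>Geometrically, \<open>v\<close> is the reflection of \<open>u\<close> in the line
  through \<open>w1\<close> and \<open>w2\<close>. In coordinates, v - u and v' - u are orthogonal
  to w1 - w2, hence parallel; both norms then equal their inner product, so v - v' has norm zero and
  vanishes by anisotropy.\<close>

lemma bisector_inj:
  assumes F: "u \<in> F \<times> F" "v \<in> F \<times> F" "v' \<in> F \<times> F" "w1 \<in> F \<times> F" "w2 \<in> F \<times> F" and ne: "v \<noteq> u" "v' \<noteq> u" "w1 \<noteq> w2"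
    and eq: "sqdist w1 u = sqdist w1 v" "sqdist w2 u = sqdist w2 v" "sqdist w1 u = sqdist w1 v'" "sqdist w2 u = sqdist w2 v'"
  shows "v = v'"
proof -
  define a b where "a = fst v - fst u" and "b = snd v - snd u"
  define a' b' where "a' = fst v' - fst u" and "b' = snd v' - snd u"
  define x y where "x = fst w1 - fst u" and "y = snd w1 - snd u"
  define x' y' where "x' = fst w2 - fst u" and "y' = snd w2 - snd u"
  have mem: "a \<in> F" "b \<in> F" "a' \<in> F" "b' \<in> F" "x \<in> F" "y \<in> F" "x' \<in> F" "y' \<in> F"
    using F by (auto simp: a_def b_def a'_def b'_def x_def y_def x'_def y'_def intro!: diff_F)
  have gen: "(c * z + d * t) + (c * z + d * t) - (c * c + d * d) = sqdist w u - sqdist w q"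
    if "c = fst q - fst u" "d = snd q - snd u" "z = fst w - fst u" "t = snd w - snd u" for c d z t w q
    unfolding that sqdist_def by (simp add: algebra_simps)
  have e1: "(a * x + b * y) + (a * x + b * y) = a * a + b * b"
    using gen[OF a_def b_def x_def y_def] eq(1) by simp
  have e2: "(a * x' + b * y') + (a * x' + b * y') = a * a + b * b"
    using gen[OF a_def b_def x'_def y'_def] eq(2) by simp
  have e3: "(a' * x + b' * y) + (a' * x + b' * y) = a' * a' + b' * b'"
    using gen[OF a'_def b'_def x_def y_def] eq(3) by simp
  have e4: "(a' * x' + b' * y') + (a' * x' + b' * y') = a' * a' + b' * b'"
    using gen[OF a'_def b'_def x'_def y'_def] eq(4) by simp
  define p q where "p = x - x'" and "q = y - y'"
  have pqF: "p \<in> F" "q \<in> F" using mem by (auto simp: p_def q_def intro!: diff_F)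
  have pq: "p \<noteq> 0 \<or> q \<noteq> 0" using ne(3) by (auto simp: p_def q_def x_def y_def x'_def y'_def prod_eq_iff)
  have "(a * p + b * q) + (a * p + b * q)
      = ((a * x + b * y) + (a * x + b * y)) - ((a * x' + b * y') + (a * x' + b * y'))"
    by (simp add: p_def q_def algebra_simps)
  also have "\<dots> = 0" unfolding e1 e2 by simp
  finally have "(a * p + b * q) + (a * p + b * q) = 0" .
  then have o1: "a * p + b * q = 0" by (rule double_nz[rotated]) (intro add_F mult_F mem pqF)
  have "(a' * p + b' * q) + (a' * p + b' * q)
      = ((a' * x + b' * y) + (a' * x + b' * y)) - ((a' * x' + b' * y') + (a' * x' + b' * y'))"
    by (simp add: p_def q_def algebra_simps)
  also have "\<dots> = 0" unfolding e3 e4 by simp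
  finally have "(a' * p + b' * q) + (a' * p + b' * q) = 0" .
  then have o2: "a' * p + b' * q = 0" by (rule double_nz[rotated]) (intro add_F mult_F mem pqF)
  \<comment> \<open>Parallelism: \<open>D\<close> is annihilated by both coordinates of w1 - w2, one
    of which is nonzero.\<close>
  define D where "D = a * b' - b * a'"
  have DF: "D \<in> F" using mem by (auto simp: D_def intro!: diff_F mult_F)
  have "p * D = b' * (a * p + b * q) - b * (a' * p + b' * q)" by (simp add: D_def algebra_simps)
  then have "p * D = 0" by (simp add: o1 o2)
  moreover have "q * D = a * (a' * p + b' * q) - a' * (a * p + b * q)" by (simp add: D_def algebra_simps)
  then have "q * D = 0" by (simp add: o1 o2)
  ultimately have D0: "D = 0" using mult_eq_zero[OF pqF(1) DF] mult_eq_zero[OF pqF(2) DF] pq by blast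
  define n n' m where "n = a * a + b * b" and "n' = a' * a' + b' * b'" and "m = a * a' + b * b'"
  have nF: "n \<in> F" "n' \<in> F" "m \<in> F" using mem by (auto simp: n_def n'_def m_def intro!: add_F mult_F)
  have n0: "n \<noteq> 0" unfolding n_def
    using ne(1) mem by (intro sq_nz) (auto simp: a_def b_def prod_eq_iff)
  have n'0: "n' \<noteq> 0" unfolding n'_def
    using ne(2) mem by (intro sq_nz) (auto simp: a'_def b'_def prod_eq_iff)
  \<comment> \<open>For D = 0 the two vectors are proportional and may be exchanged; doubled, and
    with \<open>e1\<close> and \<open>e3\<close>, this becomes n n' = n m.\<close>
  have "n * (a' * x + b' * y) = m * (a * x + b * y) + D * (a * y - b * x)"
    by (simp add: n_def m_def D_def algebra_simps)
  then have 1: "n * (a' * x + b' * y) = m * (a * x + b * y)" by (simp add: D0)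
  have "n * ((a' * x + b' * y) + (a' * x + b' * y)) = m * ((a * x + b * y) + (a * x + b * y))"
    by (simp only: distrib_left[of n "a' * x + b' * y"] distrib_left[of m "a * x + b * y"] 1)
  then have "n * n' = n * m" unfolding e1 e3 n_def[symmetric] n'_def[symmetric] by (simp only: mult.commute)
  then have m1: "n' = m" using mult_cancel[OF nF(1) n0 nF(2,3)] by blast
  have "n' * (a * x + b * y) = m * (a' * x + b' * y) - D * (a' * y - b' * x)"
    by (simp add: n'_def m_def D_def algebra_simps)
  then have 2: "n' * (a * x + b * y) = m * (a' * x + b' * y)" by (simp add: D0)
  have "n' * ((a * x + b * y) + (a * x + b * y)) = m * ((a' * x + b' * y) + (a' * x + b' * y))"
    by (simp only: distrib_left[of n' "a * x + b * y"] distrib_left[of m "a' * x + b' * y"] 2)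
  then have "n' * n = n' * m" unfolding e1 e3 n_def[symmetric] n'_def[symmetric] by (simp only: mult.commute)
  then have m2: "n = m" using mult_cancel[OF nF(2) n'0 nF(1,3)] by blast
  have "(a - a') * (a - a') + (b - b') * (b - b') = n - m + (n' - m)"
    by (simp add: n_def n'_def m_def algebra_simps)
  also have "\<dots> = 0" using m1 m2 by simp
  finally have "a - a' = 0 \<and> b - b' = 0" using mem by (intro anisotropic diff_F)
  then show ?thesis by (simp add: a_def b_def a'_def b'_def prod_eq_iff)
qed

end

text \<open>For an apex \<open>w\<close>, the distances from \<open>w\<close> to s^2 points take at
  most K s values, so Cauchy-Schwarz gives s^3 / K pairs (u, v) at equal distance. Summing over
  \<open>w\<close> and averaging over \<open>u\<close> fixes one end of the base.\<close>

lemma isosceles: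
  fixes s K :: real and P :: "('a::comm_ring \<times> 'a) set"
  assumes P: "finite P" "card P = s\<^sup>2" and s: "0 < s" and K: "0 < K" and D: "card (sqdists P) \<le> K * s"
  shows "\<exists>u\<in>P. s ^ 3 / K \<le> (\<Sum>v\<in>P. real (card (bisector P u v)))"
proof -
  define E :: "'a \<times> 'a \<Rightarrow> 'a \<times> 'a \<Rightarrow> 'a \<times> 'a \<Rightarrow> real" where "E w u v = of_bool (sqdist w u = sqdist w v)" for w u v
  have ne: "P \<noteq> {}" using P s by auto
  have finPP: "finite (P \<times> P)" using P by simp
  have "sqdists P = (\<lambda>(u, v). sqdist u v) ` (P \<times> P)" by (auto simp: sqdists_def)
  then have finD: "finite (sqdists P)" using finPP by simp
  have w: "s ^ 3 / K \<le> (\<Sum>u\<in>P. \<Sum>v\<in>P. E w u v)" if w: "w \<in> P" for w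
  proof -
    have im: "sqdist w ` P \<subseteq> sqdists P" using w unfolding sqdists_def by blast
    have "card (sqdist w ` P) \<le> card (sqdists P)" by (rule card_mono[OF finD im])
    then have cim: "card (sqdist w ` P) \<le> K * s" using D by linarith
    define c where "c = real (card {(x, y). x \<in> P \<and> y \<in> P \<and> sqdist w x = sqdist w y})"
    have "(s\<^sup>2)\<^sup>2 \<le> real (card (sqdist w ` P)) * c"
      using card_collisions_ge[OF P(1), of "sqdist w"] unfolding P(2) c_def by (simp only: of_nat_mult)
    also have "\<dots> \<le> (K * s) * c" using cim by (intro mult_right_mono) (auto simp: c_def)
    finally have "s * s ^ 3 \<le> s * (K * c)" by (simp add: eval_nat_numeral mult_ac)
    then have "s ^ 3 \<le> K * c" using s by (rule mult_left_le_imp_le)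
    then have "s ^ 3 / K \<le> c" using K by (simp add: pos_divide_le_eq mult.commute)
    also have "c = (\<Sum>u\<in>P. \<Sum>v\<in>P. E w u v)"
    proof -
      have "(P \<times> P) \<inter> {x. sqdist w (fst x) = sqdist w (snd x)} = {(x, y). x \<in> P \<and> y \<in> P \<and> sqdist w x = sqdist w y}" by auto
      then have "c = (\<Sum>x\<in>P \<times> P. E w (fst x) (snd x))"
        using real_card_Int[OF finPP, of "{x. sqdist w (fst x) = sqdist w (snd x)}"] by (simp add: c_def E_def)
      also have "\<dots> = (\<Sum>u\<in>P. \<Sum>v\<in>P. E w u v)" by (simp add: sum.cartesian_product case_prod_beta)
      finally show ?thesis .
    qed
    finally show ?thesis .
  qed
  have "card P * (s ^ 3 / K) = (\<Sum>w\<in>P. s ^ 3 / K)" by simp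
  also have "\<dots> \<le> (\<Sum>w\<in>P. \<Sum>u\<in>P. \<Sum>v\<in>P. E w u v)" using w by (rule sum_mono)
  also have "\<dots> = (\<Sum>u\<in>P. \<Sum>w\<in>P. \<Sum>v\<in>P. E w u v)" by (rule sum.swap)
  also have "\<dots> = (\<Sum>u\<in>P. \<Sum>v\<in>P. \<Sum>w\<in>P. E w u v)" by (intro sum.cong refl sum.swap)
  also have "\<dots> = (\<Sum>u\<in>P. \<Sum>v\<in>P. real (card (bisector P u v)))"
  proof (intro sum.cong refl)
    fix u v
    have "P \<inter> {w. sqdist w u = sqdist w v} = bisector P u v" by (auto simp: bisector_def)
    then show "(\<Sum>w\<in>P. E w u v) = real (card (bisector P u v))"
      using real_card_Int[OF P(1), of "{w. sqdist w u = sqdist w v}"] by (simp add: E_def)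
  qed
  finally show ?thesis by (rule pigeonhole_sum[OF P(1) ne])
qed

context anisotropic_field
begin

lemma bisector_Int: "P \<subseteq> F \<times> F \<Longrightarrow> bisector (F \<times> F) u v \<inter> P = bisector P u v"
  by (auto simp: bisector_def)

text \<open>The loss 2 s^2 pays for v = u, whose bisector is all of \<open>P\<close>, and for
  bisectors with at most one point. Two points are what makes \<open>v\<close> recoverable from its
  bisector.\<close>

lemma rich_bisectors:
  fixes s K :: real
  assumes PF: "P \<subseteq> F \<times> F" and cP: "card P = s\<^sup>2" and s: "0 < s" and K: "0 < K" and D: "card (sqdists P) \<le> K * s"
  shows "\<exists>u\<in>P. \<exists>V\<subseteq>P - {u}. (\<forall>v\<in>V. 2 \<le> card (bisector P u v)) \<and>
    s ^ 3 / K - 2 * s\<^sup>2 \<le> (\<Sum>v\<in>V. real (card (bisector P u v)))"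
proof -
  have finP: "finite P" using PF by (rule finite_subset) simp
  obtain u where u: "u \<in> P" "s ^ 3 / K \<le> (\<Sum>v\<in>P. real (card (bisector P u v)))"
    using isosceles[OF finP cP s K D] by blast
  define V where "V = {v\<in>P - {u}. 2 \<le> card (bisector P u v)}"
  have "(\<Sum>v\<in>P. real (card (bisector P u v)))
      \<le> (\<Sum>v\<in>P. (if v \<in> V then real (card (bisector P u v)) else 0) + 1 + (if v = u then s\<^sup>2 else 0))"
  proof (rule sum_mono)
    fix v assume v: "v \<in> P"
    have "card (bisector P u v) \<le> card P" using finP by (intro card_mono) (auto simp: bisector_def)
    then have "real (card (bisector P u v)) \<le> s\<^sup>2" using cP by linarith
    then show "real (card (bisector P u v)) \<le> (if v \<in> V then real (card (bisector P u v)) else 0) + 1 + (if v = u then s\<^sup>2 else 0)"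
      using v by (auto simp: V_def)
  qed
  also have "\<dots> = (\<Sum>v\<in>P. if v \<in> V then real (card (bisector P u v)) else 0) + real (card P) + s\<^sup>2"
    using finP u(1) by (simp add: sum.distrib)
  also have "(\<Sum>v\<in>P. if v \<in> V then real (card (bisector P u v)) else 0) = (\<Sum>v\<in>V. real (card (bisector P u v)))"
  proof -
    have "P \<inter> V = V" by (auto simp: V_def)
    then show ?thesis using sum.inter_restrict[OF finP, of "\<lambda>v. real (card (bisector P u v))" V] by simp
  qed
  finally have "s ^ 3 / K - 2 * s\<^sup>2 \<le> (\<Sum>v\<in>V. real (card (bisector P u v)))" using u(2) cP by linarith
  moreover have "V \<subseteq> P - {u}" "\<forall>v\<in>V. 2 \<le> card (bisector P u v)" by (auto simp: V_def)
  ultimately show ?thesis using u(1) by blast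
qed

lemma rich_bisector_unique:
  assumes PF: "P \<subseteq> F \<times> F" and "u \<in> P" "v \<in> P - {u}" "v' \<in> P - {u}" "2 \<le> card (bisector P u v)"
    and eq: "bisector P u v = bisector P u v'"
  shows "v = v'"
proof -
  have "finite P" using PF by (rule finite_subset) simp
  then have fin: "finite (bisector P u v)" by (simp add: bisector_def)
  have "\<not> card (bisector P u v) \<le> Suc 0" using assms(5) by simp
  then obtain w1 w2 where w: "w1 \<in> bisector P u v" "w2 \<in> bisector P u v" "w1 \<noteq> w2"
    using card_le_Suc0_iff_eq[OF fin] by blast
  then have "w1 \<in> bisector P u v'" "w2 \<in> bisector P u v'" using eq by auto
  then have "w1 \<in> P" "w2 \<in> P" "sqdist w1 u = sqdist w1 v" "sqdist w2 u = sqdist w2 v"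
      "sqdist w1 u = sqdist w1 v'" "sqdist w2 u = sqdist w2 v'"
    using w by (auto simp: bisector_def)
  then show ?thesis using assms PF w(3) by (intro bisector_inj[of u v v' w1 w2]) auto
qed

text \<open>The bisectors from one \<open>u\<close> are at most s^2 lines. For s \<ge> 4 K, passing
  from \<open>K\<close> to K^2 absorbs the loss 2 s^2 of \<open>rich_bisectors\<close>; smaller
  \<open>s\<close> satisfies the bound anyway.\<close>

theorem sparse_regime:
  fixes s K :: real
  assumes PF: "P \<subseteq> F \<times> F" and cP: "card P = s\<^sup>2" and s: "0 < s" and K: "2 \<le> K" and D: "card (sqdists P) \<le> K * s"
    and sF: "s\<^sup>2 \<le> card F" and j: "card F < (s / (K\<^sup>2) ^ 1797) ^ (2 ^ j)"
  shows "s \<le> (K\<^sup>2) ^ incidence_exponent j"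
proof (cases "4 * K \<le> s")
  case False
  have "s \<le> 4 * K" using False by simp
  also have "\<dots> \<le> K\<^sup>2 * K\<^sup>2"
    using power_absorb[OF K, of 4 2] power_absorb[OF K, of 2 1] K
    by (intro mult_mono) (auto simp: power2_eq_square)
  also have "\<dots> = (K\<^sup>2) ^ 2" by (simp only: power2_eq_square)
  also have "\<dots> \<le> (K\<^sup>2) ^ incidence_exponent j"
    using K by (intro power_increasing) (auto simp: incidence_exponent_def intro: one_le_power)
  finally show ?thesis .
next
  case True
  have K0: "0 < K" using K by simp
  have finP: "finite P" using PF by (rule finite_subset) simp
  obtain u V where u: "u \<in> P" and V: "V \<subseteq> P - {u}" "\<forall>v\<in>V. 2 \<le> card (bisector P u v)"
    and sV: "s ^ 3 / K - 2 * s\<^sup>2 \<le> (\<Sum>v\<in>V. real (card (bisector P u v)))"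
    using rich_bisectors[OF PF cP s K0 D] by blast
  have finV: "finite V" using V(1) finP finite_subset by blast
  define L where "L = bisector (F \<times> F) u ` V"
  have inj: "inj_on (bisector (F \<times> F) u) V"
  proof (rule inj_onI)
    fix v v' assume v: "v \<in> V" "v' \<in> V" "bisector (F \<times> F) u v = bisector (F \<times> F) u v'"
    have "bisector P u v = bisector P u v'" using v(3) bisector_Int[OF PF] by metis
    then show "v = v'" using v V by (intro rich_bisector_unique[OF PF u]) auto
  qed
  show ?thesis
  proof (rule incidence_bound[OF PF cP])
    show "finite L" using finV by (simp add: L_def)
    show "is_line F l" if l: "l \<in> L" for l
    proof -
      obtain v where "v \<in> V" "l = bisector (F \<times> F) u v" using l unfolding L_def by blast
      then show ?thesis using u V PF by (auto intro!: bisector_is_line)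
    qed
    have "card L \<le> card V" unfolding L_def using finV by (rule card_image_le)
    also have "\<dots> \<le> card P" using V finP by (intro card_mono) auto
    finally show "card L \<le> s\<^sup>2" using cP by linarith
    have "(\<Sum>l\<in>L. real (card (l \<inter> P))) = (\<Sum>v\<in>V. real (card (bisector P u v)))"
      unfolding L_def by (simp add: sum.reindex[OF inj] bisector_Int[OF PF])
    moreover have "s ^ 3 / K\<^sup>2 \<le> s ^ 3 / K - 2 * s\<^sup>2"
    proof -
      have "s ^ 3 / K\<^sup>2 \<le> s ^ 3 / (2 * K)"
        using K s by (intro divide_left_mono) (auto simp: power2_eq_square)
      moreover have "2 * s\<^sup>2 \<le> s ^ 3 / (2 * K)"
      proof -
        have "2 * s\<^sup>2 * (2 * K) \<le> s\<^sup>2 * s" using True s by simp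
        then show ?thesis using K0 by (simp add: pos_le_divide_eq power2_eq_square power3_eq_cube)
      qed
      moreover have "s ^ 3 / K = s ^ 3 / (2 * K) + s ^ 3 / (2 * K)" by simp
      ultimately show ?thesis by linarith
    qed
    ultimately show "s ^ 3 / K\<^sup>2 \<le> (\<Sum>l\<in>L. real (card (l \<inter> P)))" using sV by linarith
    show "2 \<le> K\<^sup>2" using power_absorb[OF K, of 2 2] by simp
  qed (use s sF j in auto)
qed

text \<open>Bisectors with a slope are among the lines of \<open>line_second_moment\<close> and
  distinct for distinct \<open>v\<close>, so by Cauchy-Schwarz their total exceeds the mean by at
  most s^2 sqrt |F|. Vertical bisectors are disjoint and contribute at most s^2, which with the 2
  s^2 of \<open>rich_bisectors\<close> makes the 3.\<close>

theorem dense_regime: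
  fixes s K :: real
  assumes PF: "P \<subseteq> F \<times> F" and cP: "card P = s\<^sup>2" and s: "0 < s" and K: "0 < K" and D: "card (sqdists P) \<le> K * s"
  shows "s / K \<le> 3 + s\<^sup>2 / card F + sqrt (card F)"
proof -
  have finP: "finite P" using PF by (rule finite_subset) simp
  have finFF: "finite (F \<times> F)" by simp
  have c0: "0 < real (card F)" using e_F by (auto simp: card_gt_0_iff)
  obtain u V where u: "u \<in> P" and V: "V \<subseteq> P - {u}" "\<forall>v\<in>V. 2 \<le> card (bisector P u v)"
    and sV: "s ^ 3 / K - 2 * s\<^sup>2 \<le> (\<Sum>v\<in>V. real (card (bisector P u v)))"
    using rich_bisectors[OF PF cP s K D] by blast
  have finV: "finite V" using V(1) finP finite_subset by blast
  \<comment> \<open>Points level with \<open>u\<close>, whose bisectors are vertical.\<close>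
  define V0 where "V0 = {v\<in>V. snd v = snd u}"
  define V1 where "V1 = {v\<in>V. snd v \<noteq> snd u}"
  have finV01: "finite V0" "finite V1" using finV by (auto simp: V0_def V1_def)
  have disj: "bisector P u v \<inter> bisector P u v' = {}" if v: "v \<in> V0" "v' \<in> V0" "v \<noteq> v'" for v v'
  proof (rule ccontr)
    assume "\<not> ?thesis"
    then obtain w where w: "w \<in> P" "sqdist w u = sqdist w v" "sqdist w u = sqdist w v'" by (auto simp: bisector_def)
    have snd: "snd v = snd u" "snd v' = snd u" "v \<in> P" "v' \<in> P" "v \<noteq> u" "v' \<noteq> u" using v V by (auto simp: V0_def)
    have key: "fst q = fst w + fst w - fst u" if q: "sqdist w u = sqdist w q" "snd q = snd u" "q \<in> P" "q \<noteq> u" for q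
    proof -
      have F: "fst q \<in> F" "fst u \<in> F" "fst w \<in> F" using q u w PF by auto
      have "(fst q - fst u) * (fst w + fst w - fst u - fst q) = sqdist w u - sqdist w q"
        by (simp add: sqdist_def q(2) algebra_simps)
      then have "(fst q - fst u) * (fst w + fst w - fst u - fst q) = 0" using q(1) by simp
      moreover have "fst q - fst u \<noteq> 0" using q(2,4) by (auto simp: prod_eq_iff)
      ultimately have "fst w + fst w - fst u - fst q = 0"
        using mult_eq_zero[of "fst q - fst u" "fst w + fst w - fst u - fst q"]
          diff_F[OF F(1,2)] diff_F[OF diff_F[OF add_F[OF F(3,3)] F(2)] F(1)] by blast
      then show ?thesis by simp
    qed
    have "fst v = fst v'" using key[OF w(2) snd(1,3,5)] key[OF w(3) snd(2,4,6)] by simp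
    then show False using v(3) snd by (simp add: prod_eq_iff)
  qed
  have sV0: "(\<Sum>v\<in>V0. real (card (bisector P u v))) \<le> s\<^sup>2"
  proof -
    have fb: "finite (bisector P u v)" for v using finP by (simp add: bisector_def)
    have "(\<Sum>v\<in>V0. real (card (bisector P u v))) = card (\<Union>v\<in>V0. bisector P u v)"
      using finV01 fb disj by (subst card_UN_disjoint) auto
    also have "\<dots> \<le> card P" using finP by (intro of_nat_mono card_mono) (auto simp: bisector_def)
    finally show ?thesis using cP by simp
  qed
  define al :: "'a \<times> 'a \<Rightarrow> 'a" where "al v = (fst v - fst u) + (fst v - fst u)" for v
  define be :: "'a \<times> 'a \<Rightarrow> 'a" where "be v = (snd v - snd u) + (snd v - snd u)" for v
  define ga :: "'a \<times> 'a \<Rightarrow> 'a" where "ga v = (fst v * fst v + snd v * snd v) - (fst u * fst u + snd u * snd u)" for v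
  \<comment> \<open>Slope and intercept, from solving the equation in \<open>bisector_iff\<close>
    for the second coordinate.\<close>
  define ph where "ph v = (- (al v * iv (be v)), ga v * iv (be v))" for v
  define i where "i = (\<lambda>(m, t). real (card {w \<in> P. snd w = m * fst w + t}))"
  have mem: "al v \<in> F" "be v \<in> F" "ga v \<in> F" "be v \<noteq> 0" if v: "v \<in> V1" for v
  proof -
    have uv: "fst v \<in> F" "snd v \<in> F" "fst u \<in> F" "snd u \<in> F" using u v V PF by (auto simp: V1_def)
    then show "al v \<in> F" "be v \<in> F" "ga v \<in> F"
      unfolding al_def be_def ga_def by - (intro add_F diff_F mult_F; assumption)+
    have "snd v - snd u \<in> F" "snd v - snd u \<noteq> 0" using uv v by (auto simp: V1_def intro: diff_F)
    then show "be v \<noteq> 0" using double_nz unfolding be_def by blast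
  qed
  have phF: "ph v \<in> F \<times> F" if "v \<in> V1" for v
    using mem[OF that] iv[of "be v"] by (auto simp: ph_def intro!: neg_F mult_F)
  have bis: "bisector P u v = {w \<in> P. snd w = fst (ph v) * fst w + snd (ph v)}" if v: "v \<in> V1" for v
  proof -
    note m = mem[OF v]
    note iv = iv[OF m(2,4)]
    have "sqdist w u = sqdist w v \<longleftrightarrow> snd w = fst (ph v) * fst w + snd (ph v)" if w: "w \<in> P" for w
    proof -
      have wF: "fst w \<in> F" "snd w \<in> F" using w PF by auto
      have dF: "ga v - al v * fst w \<in> F" using m wF by (intro diff_F mult_F)
      have "fst (ph v) * fst w + snd (ph v) = iv (be v) * (ga v - al v * fst w)"
        by (simp add: ph_def algebra_simps)
      moreover have "sqdist w u = sqdist w v \<longleftrightarrow> be v * snd w = ga v - al v * fst w"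
        unfolding bisector_iff al_def[symmetric] be_def[symmetric] ga_def[symmetric] by (auto simp: algebra_simps)
      moreover have "be v * snd w = ga v - al v * fst w \<longleftrightarrow> snd w = iv (be v) * (ga v - al v * fst w)"
      proof
        assume "be v * snd w = ga v - al v * fst w"
        then show "snd w = iv (be v) * (ga v - al v * fst w)" using iv_cancel(1)[OF m(2,4) wF(2)] by simp
      next
        assume "snd w = iv (be v) * (ga v - al v * fst w)"
        then show "be v * snd w = ga v - al v * fst w" using iv_cancel(2)[OF m(2,4) dF] by simp
      qed
      ultimately show ?thesis by simp
    qed
    then show ?thesis by (auto simp: bisector_def)
  qed
  have inj: "inj_on ph V1"
  proof (rule inj_onI)
    fix v v' assume v: "v \<in> V1" "v' \<in> V1" "ph v = ph v'"
    have "bisector P u v = bisector P u v'" unfolding bis[OF v(1)] bis[OF v(2)] v(3) by (rule refl)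
    then show "v = v'" using v V by (intro rich_bisector_unique[OF PF u]) (auto simp: V1_def)
  qed
  define \<mu> where "\<mu> = real (card P) / card F"
  have "(\<Sum>x\<in>F \<times> F. (i x - card P / card F)\<^sup>2) \<le> card F * card P"
    unfolding i_def by (rule line_second_moment[OF PF])
  then have m2: "(\<Sum>x\<in>F \<times> F. (i x - \<mu>)\<^sup>2) \<le> card F * s\<^sup>2" by (simp add: \<mu>_def cP)
  have cV1: "card V1 \<le> s\<^sup>2"
  proof -
    have "card V1 \<le> card P" using V finP by (intro card_mono) (auto simp: V1_def)
    then show ?thesis using cP by linarith
  qed
  have "(\<Sum>v\<in>V1. i (ph v) - \<mu>)\<^sup>2 \<le> card V1 * (\<Sum>v\<in>V1. (i (ph v) - \<mu>)\<^sup>2)" by (rule sum_square_ge)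
  also have "\<dots> \<le> s\<^sup>2 * (card F * s\<^sup>2)"
  proof (intro mult_mono cV1)
    have "(\<Sum>v\<in>V1. (i (ph v) - \<mu>)\<^sup>2) = (\<Sum>x\<in>ph ` V1. (i x - \<mu>)\<^sup>2)" by (simp add: sum.reindex[OF inj])
    also have "\<dots> \<le> (\<Sum>x\<in>F \<times> F. (i x - \<mu>)\<^sup>2)" using finFF by (rule sum_mono2) (use phF in blast, simp)
    finally show "(\<Sum>v\<in>V1. (i (ph v) - \<mu>)\<^sup>2) \<le> card F * s\<^sup>2" using m2 by linarith
  qed (auto intro: sum_nonneg)
  also have "\<dots> = (s\<^sup>2 * sqrt (card F))\<^sup>2" by (simp add: power_mult_distrib power2_eq_square)
  finally have dev: "(\<Sum>v\<in>V1. i (ph v) - \<mu>) \<le> s\<^sup>2 * sqrt (card F)" by (rule power2_le_imp_le) simp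
  have "(\<Sum>v\<in>V1. real (card (bisector P u v))) = (\<Sum>v\<in>V1. i (ph v))"
    by (intro sum.cong refl) (simp add: bis i_def case_prod_beta)
  also have "\<dots> = (\<Sum>v\<in>V1. i (ph v) - \<mu>) + card V1 * \<mu>" by (simp add: sum_subtractf)
  also have "\<dots> \<le> s\<^sup>2 * sqrt (card F) + s\<^sup>2 * (s\<^sup>2 / card F)"
  proof -
    have "card V1 * \<mu> \<le> s\<^sup>2 * \<mu>" using cV1 by (intro mult_right_mono) (auto simp: \<mu>_def)
    then show ?thesis using dev by (simp add: \<mu>_def cP)
  qed
  finally have sV1: "(\<Sum>v\<in>V1. real (card (bisector P u v))) \<le> s\<^sup>2 * sqrt (card F) + s\<^sup>2 * (s\<^sup>2 / card F)" .
  have "V = V0 \<union> V1" "V0 \<inter> V1 = {}" by (auto simp: V0_def V1_def)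
  then have "(\<Sum>v\<in>V. real (card (bisector P u v))) = (\<Sum>v\<in>V0. real (card (bisector P u v))) + (\<Sum>v\<in>V1. real (card (bisector P u v)))"
    using finV01 by (simp add: sum.union_disjoint)
  then have "s ^ 3 / K \<le> 3 * s\<^sup>2 + s\<^sup>2 * sqrt (card F) + s\<^sup>2 * (s\<^sup>2 / card F)"
    using sV sV0 sV1 by linarith
  then have "s\<^sup>2 * (s / K) \<le> s\<^sup>2 * (3 + s\<^sup>2 / card F + sqrt (card F))"
    by (simp add: distrib_left power2_eq_square power3_eq_cube mult_ac)
  moreover have "0 < s\<^sup>2" using s by simp
  ultimately show ?thesis by (rule mult_left_le_imp_le)
qed

end

section \<open>Residue fields as ideals of one ring\<close>

text \<open>HOL has no type of residues modulo a variable prime. All the fields $\mathbf{Z}/p\mathbf{Z}$ are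
  therefore realised as ideals of one commutative ring, the product of the rings
  $\mathbf{Z}/q\mathbf{Z}$ over all natural numbers $q$ (with $\mathbf{Z}/0\mathbf{Z} = \mathbf{Z}$);
  the unit of such an ideal is an idempotent different from 1.\<close>

typedef residue_family = "{f :: nat \<Rightarrow> int. \<forall>q. f q mod int q = f q}"
  by (rule exI[of _ "\<lambda>_. 0"]) simp

setup_lifting type_definition_residue_family

instantiation residue_family :: comm_ring_1
begin

lift_definition zero_residue_family :: residue_family is "\<lambda>_. 0" by simp
lift_definition one_residue_family :: residue_family is "\<lambda>q. 1 mod int q" by simp
lift_definition plus_residue_family :: "residue_family \<Rightarrow> residue_family \<Rightarrow> residue_family"
  is "\<lambda>f g q. (f q + g q) mod int q" by simp
lift_definition minus_residue_family :: "residue_family \<Rightarrow> residue_family \<Rightarrow> residue_family"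
  is "\<lambda>f g q. (f q - g q) mod int q" by simp
lift_definition uminus_residue_family :: "residue_family \<Rightarrow> residue_family"
  is "\<lambda>f q. (- f q) mod int q" by simp
lift_definition times_residue_family :: "residue_family \<Rightarrow> residue_family \<Rightarrow> residue_family"
  is "\<lambda>f g q. (f q * g q) mod int q" by simp

instance
proof
  fix a b c :: residue_family
  show "a + b + c = a + (b + c)" by transfer (simp add: fun_eq_iff mod_simps add.assoc)
  show "a + b = b + a" by transfer (simp add: add.commute)
  show "0 + a = a" by transfer (simp add: fun_eq_iff)
  show "- a + a = 0" by transfer (simp add: fun_eq_iff mod_simps)
  show "a - b = a + - b" by transfer (simp add: fun_eq_iff mod_simps)
  show "a * b * c = a * (b * c)" by transfer (simp add: fun_eq_iff mod_simps mult.assoc)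
  show "a * b = b * a" by transfer (simp add: mult.commute)
  show "1 * a = a" by transfer (simp add: fun_eq_iff mod_simps)
  show "(a + b) * c = a * c + b * c" by transfer (simp add: fun_eq_iff mod_simps distrib_right)
  show "(0 :: residue_family) \<noteq> 1" by transfer (auto simp: fun_eq_iff intro!: exI[of _ 0])
qed

end

section \<open>Embedding the residues modulo a prime\<close>

lift_definition embed :: "nat \<Rightarrow> int \<Rightarrow> residue_family" is "\<lambda>p k q. if q = p then k mod int p else 0"
  by simp

lemma embed_add: "embed p (k + l) = embed p k + embed p l"
  by transfer (simp add: fun_eq_iff mod_simps)

lemma embed_minus: "embed p (- k) = - embed p k"
  by transfer (simp add: fun_eq_iff mod_simps)

lemma embed_mult: "embed p (k * l) = embed p k * embed p l"
  by transfer (simp add: fun_eq_iff mod_simps)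

lemma embed_mod: "embed p (k mod int p) = embed p k"
  by transfer (simp add: fun_eq_iff)

lemma embed_zero: "embed p 0 = 0"
  by transfer (simp add: fun_eq_iff)

lemma embed_eq_iff: "embed p k = embed p l \<longleftrightarrow> k mod int p = l mod int p"
proof
  assume "embed p k = embed p l"
  then have "\<forall>q. (if q = p then k mod int p else 0) = (if q = p then l mod int p else 0)"
    by transfer (simp add: fun_eq_iff)
  from this[rule_format, of p] show "k mod int p = l mod int p" by simp
qed (metis embed_mod)

lemma embed_eq_0_iff: "embed p k = 0 \<longleftrightarrow> int p dvd k"
  using embed_eq_iff[of p k 0] by (simp add: embed_zero dvd_eq_mod_eq_0)

lemma embed_of_nat: "embed p (int n) = of_nat n * embed p 1"
proof (induction n)
  case (Suc n)
  have "embed p (int (Suc n)) = embed p (1 + int n)" by simp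
  also have "\<dots> = embed p 1 + of_nat n * embed p 1" unfolding embed_add Suc ..
  finally show ?case by (simp add: distrib_right)
qed (simp add: embed_zero)

lemma inj_on_embed: "inj_on (embed p) {0..int p - 1}"
  by (rule inj_onI) (auto simp: embed_eq_iff)

lemma range_embed: "0 < p \<Longrightarrow> range (embed p) = embed p ` {0..int p - 1}"
proof (intro equalityI subsetI)
  fix x assume p: "0 < p" and "x \<in> range (embed p)"
  then obtain k where "x = embed p (k mod int p)" by (auto simp: embed_mod)
  then show "x \<in> embed p ` {0..int p - 1}" using p by simp
qed auto

lemma card_range_embed: "0 < p \<Longrightarrow> card (range (embed p)) = p"
  by (simp add: range_embed card_image[OF inj_on_embed])

lemma fermat_int:
  assumes p: "prime p" and x: "\<not> int p dvd x"
  shows "[x ^ (p - 1) = 1] (mod int p)"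
proof -
  define a where "a = nat (x mod int p)"
  have p0: "0 < int p" using p prime_gt_0_nat by simp
  have a: "int a = x mod int p" using p0 by (simp add: a_def)
  have "\<not> p dvd a"
  proof
    assume "p dvd a"
    then have "int p dvd x mod int p" using a by (metis int_dvd_int_iff)
    then show False using x by (simp add: dvd_mod_iff)
  qed
  then have "[a ^ (p - 1) = 1] (mod p)" using p by (rule fermat_theorem[rotated])
  then have "[int (a ^ (p - 1)) = int 1] (mod int p)" by (simp only: cong_int_iff)
  then have "[(x mod int p) ^ (p - 1) = 1] (mod int p)" by (simp add: a)
  then show ?thesis by (simp only: cong_def power_mod)
qed

text \<open>If x^2 = - y^2 with both invertible, raising to the power (p - 1) / 2, which is odd,
  gives 1 = -1 by Fermat, impossible for odd \<open>p\<close>.\<close>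

lemma sum_two_squares_eq_0_mod:
  assumes p: "prime p" and p3: "[p = 3] (mod 4)" and d: "int p dvd x * x + y * y"
  shows "int p dvd x \<and> int p dvd y"
proof -
  have pi: "prime (int p)" using p by simp
  have p34: "p mod 4 = 3" using p3 by (simp add: cong_def)
  define k where "k = p div 4"
  have pk: "p - 1 = 2 * (2 * k + 1)" using p34 unfolding k_def by presburger
  have "int p dvd x"
  proof (rule ccontr)
    assume x: "\<not> int p dvd x"
    have y: "\<not> int p dvd y"
    proof
      assume "int p dvd y"
      then have "int p dvd x * x" using d by (simp add: dvd_add_left_iff)
      then show False using x pi by (simp add: prime_dvd_mult_iff)
    qed
    have "[x * x = - (y * y)] (mod int p)" using d by (simp add: cong_iff_dvd_diff)
    then have "[(x * x) ^ (2 * k + 1) = (- (y * y)) ^ (2 * k + 1)] (mod int p)" by (rule cong_pow)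
    moreover have "(x * x) ^ (2 * k + 1) = x ^ (p - 1)" unfolding pk by (simp only: power_mult power2_eq_square)
    moreover have "(- (y * y)) ^ (2 * k + 1) = - (y ^ (p - 1))"
    proof -
      have "(- (y * y)) ^ (2 * k + 1) = - ((y * y) ^ (2 * k + 1))" by (rule power_minus_odd) simp
      also have "(y * y) ^ (2 * k + 1) = y ^ (p - 1)" unfolding pk by (simp only: power_mult power2_eq_square)
      finally show ?thesis .
    qed
    ultimately have 1: "[x ^ (p - 1) = - (y ^ (p - 1))] (mod int p)" by (simp only:)
    have 2: "[- (y ^ (p - 1)) = - 1] (mod int p)" using fermat_int[OF p y] by (simp add: cong_minus_minus_iff)
    have "[1 = - 1] (mod int p)" by (rule cong_trans[OF cong_sym[OF fermat_int[OF p x]] cong_trans[OF 1 2]])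
    then have "int p dvd 2" by (simp add: cong_iff_dvd_diff)
    then have "int p \<le> 2" by (rule zdvd_imp_le) simp
    then have "p \<le> 2" by simp
    then show False using p34 by presburger
  qed
  moreover from this have "int p dvd y * y" using d by (simp add: dvd_add_right_iff)
  then have "int p dvd y" using pi by (simp add: prime_dvd_mult_iff)
  ultimately show ?thesis by blast
qed

lemma embed_field:
  assumes p: "prime p" and p3: "[p = 3] (mod 4)"
  shows "anisotropic_field (range (embed p)) (embed p 1)"
proof
  have p0: "0 < p" using p by (rule prime_gt_0_nat)
  show "finite (range (embed p))" using p0 by (simp add: range_embed)
  show "embed p 1 \<in> range (embed p)" by simp
  have "\<not> int p dvd 1" using p by (auto simp: prime_nat_iff)
  then show "embed p 1 \<noteq> 0" by (simp add: embed_eq_0_iff)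
  fix x y assume "x \<in> range (embed p)"
  then obtain k where k: "x = embed p k" by auto
  show "- x \<in> range (embed p)" by (simp add: k flip: embed_minus)
  show "embed p 1 * x = x" by (simp add: k flip: embed_mult)
  show "\<exists>n. x = of_nat n * embed p 1"
  proof -
    have "x = embed p (int (nat (k mod int p)))" using p0 by (simp add: k embed_mod)
    then show ?thesis using embed_of_nat by blast
  qed
  show "\<exists>y\<in>range (embed p). x * y = embed p 1" if "x \<noteq> 0"
  proof -
    have "\<not> int p dvd k" using that by (simp add: k embed_eq_0_iff)
    then have "coprime k (int p)" using p by (metis coprime_commute prime_imp_coprime prime_nat_int_transfer)
    then obtain l where "[k * l = 1] (mod int p)" using cong_solve_coprime_int by blast
    then have "embed p (k * l) = embed p 1" by (simp add: embed_eq_iff cong_def)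
    then show ?thesis by (auto simp: k embed_mult)
  qed
  assume "y \<in> range (embed p)"
  then obtain l where l: "y = embed p l" by auto
  show "x + y \<in> range (embed p)" unfolding k l embed_add[symmetric] by (rule rangeI)
  show "x * y \<in> range (embed p)" unfolding k l embed_mult[symmetric] by (rule rangeI)
  show "x = 0 \<and> y = 0" if "x * x + y * y = 0"
  proof -
    have "embed p (k * k + l * l) = 0" using that by (simp only: k l embed_add embed_mult)
    then have "int p dvd k * k + l * l" by (simp only: embed_eq_0_iff)
    then have "int p dvd k \<and> int p dvd l" by (rule sum_two_squares_eq_0_mod[OF p p3])
    then show ?thesis by (simp only: k l embed_eq_0_iff)
  qed
qed

definition embed2 :: "nat \<Rightarrow> int \<times> int \<Rightarrow> residue_family \<times> residue_family" where
  "embed2 p u = (embed p (fst u), embed p (snd u))"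

text \<open>\<open>embed\<close> respects sums and products and ignores reduction modulo
  \<open>p\<close>, so every reduction made by the residue ring disappears.\<close>

lemma embed_plane_dist:
  assumes p: "prime p"
  shows "embed p (plane_dist (residue_ring (int p)) u v) = sqdist (embed2 p u) (embed2 p v)"
proof -
  interpret residues_prime p "residue_ring (int p)"
    by unfold_locales (rule p)
  \<comment> \<open>The recursive power starts from the unit, hence the factor 1.\<close>
  have sq: "x [^]\<^bsub>residue_ring (int p)\<^esub> (2::nat) = (((1 * x) mod int p) * x) mod int p" for x
    by (simp only: numeral_2_eq_2 nat_pow_Suc nat_pow_0 res_mult_eq res_one_eq)
  show ?thesis
    unfolding plane_dist_def sq a_minus_def res_add_eq res_neg_eq sqdist_def embed2_def
    by (simp only: embed_mod embed_add embed_mult embed_minus mult_1_left fst_conv snd_conv diff_conv_add_uminus)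
qed

section \<open>Choice of exponents\<close>

text \<open>With s = q powr (\<alpha> / 2) and K = q powr \<eta>, the hypotheses and the conclusion
  of \<open>sparse_regime\<close> become comparisons of exponents of q = |F|.\<close>

lemma sparse_exponent:
  fixes \<alpha> :: real
  assumes a: "0 < \<alpha>" "\<alpha> \<le> 1"
  shows "\<exists>\<eta>>0. \<forall>(F :: residue_family set) e P. anisotropic_field F e \<longrightarrow> P \<subseteq> F \<times> F \<longrightarrow>
    real (card P) = real (card F) powr \<alpha> \<longrightarrow> 6 \<le> real (card F) powr \<eta> \<longrightarrow>
    real (card F) powr (\<alpha> / 2 + \<eta>) \<le> real (card (sqdists P))"
proof -
  \<comment> \<open>The rounds must lift the exponent \<alpha> / 4 above 1; the other half of
    \<alpha> / 2 is reserved for losses.\<close>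
  obtain j where j: "4 / \<alpha> < 2 ^ j" using real_arch_pow[of 2 "4 / \<alpha>"] by auto
  define n where "n = real (incidence_exponent j)"
  have n0: "0 \<le> n" by (simp add: n_def)
  \<comment> \<open>3594 = 2 * 1797, since \<open>sparse_regime\<close> uses K^2. The choice gives
    3594 \<eta> \<le> \<alpha> / 4 for the growth condition and 2 \<eta> n < \<alpha> / 2 for the
    contradiction.\<close>
  define \<eta> where "\<eta> = \<alpha> / (4 * (n + 3594))"
  have eta: "0 < \<eta>" using a n0 by (simp add: \<eta>_def)
  have eta_n: "4 * \<eta> * (n + 3594) = \<alpha>" using n0 by (simp add: \<eta>_def field_simps)
  have "real (card F) powr (\<alpha> / 2 + \<eta>) \<le> real (card (sqdists P))"
    if F: "anisotropic_field F e" and PF: "P \<subseteq> F \<times> F" and cP: "real (card P) = real (card F) powr \<alpha>"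
      and big: "6 \<le> real (card F) powr \<eta>" for F :: "residue_family set" and e P
  proof (rule ccontr)
    assume "\<not> ?thesis"
    then have small: "real (card (sqdists P)) < real (card F) powr (\<alpha> / 2 + \<eta>)" by simp
    interpret anisotropic_field F e by (rule F)
    define q where "q = real (card F)"
    have "1 \<le> q" using e_F by (auto simp: q_def Suc_le_eq card_gt_0_iff)
    moreover have "q \<noteq> 1" using big by (auto simp: q_def[symmetric])
    ultimately have q1: "1 < q" by simp
    define s where "s = q powr (\<alpha> / 2)"
    define K where "K = q powr \<eta>"
    have K2: "2 \<le> K" using big by (simp add: K_def q_def)
    have s0: "0 < s" using q1 by (simp add: s_def)
    have cP': "card P = s\<^sup>2" using cP q1 by (simp add: s_def q_def[symmetric] powr_power)
    have D: "card (sqdists P) \<le> K * s"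
      using small by (simp add: K_def s_def q_def[symmetric] powr_add mult.commute)
    have sF: "s\<^sup>2 \<le> card F"
    proof -
      have "s\<^sup>2 = q powr \<alpha>" using q1 by (simp add: s_def powr_power)
      also have "\<dots> \<le> q powr 1" using q1 a by (intro powr_mono) auto
      finally show ?thesis using q1 by (simp add: q_def)
    qed
    have Kp: "(K\<^sup>2) ^ m = q powr (2 * \<eta> * real m)" for m
      using q1 by (simp add: K_def powr_power mult_ac flip: power_mult)
    have "card F < (s / (K\<^sup>2) ^ 1797) ^ (2 ^ j)"
    proof -
      have "s / (K\<^sup>2) ^ 1797 = q powr (\<alpha> / 2 - 3594 * \<eta>)"
        unfolding Kp s_def powr_diff by simp
      then have "(s / (K\<^sup>2) ^ 1797) ^ (2 ^ j) = q powr ((\<alpha> / 2 - 3594 * \<eta>) * 2 ^ j)"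
        using q1 by (simp add: powr_power mult.commute)
      moreover have "1 < (\<alpha> / 2 - 3594 * \<eta>) * 2 ^ j"
      proof -
        have "4 * \<eta> * 3594 \<le> 4 * \<eta> * (n + 3594)" using n0 eta by (intro mult_left_mono) auto
        then have "\<alpha> / 4 \<le> \<alpha> / 2 - 3594 * \<eta>" using eta_n by linarith
        moreover have "1 < \<alpha> / 4 * 2 ^ j" using j a by (simp add: field_simps)
        moreover have "\<alpha> / 4 * 2 ^ j \<le> (\<alpha> / 2 - 3594 * \<eta>) * 2 ^ j" by (rule mult_right_mono[OF calculation(1)]) simp
        ultimately show ?thesis by linarith
      qed
      then have "q powr 1 < q powr ((\<alpha> / 2 - 3594 * \<eta>) * 2 ^ j)" using q1 by (intro powr_less_mono) auto
      ultimately show ?thesis using q1 by (simp add: q_def)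
    qed
    then have "s \<le> (K\<^sup>2) ^ incidence_exponent j"
      by (rule sparse_regime[OF PF cP' s0 K2 D sF])
    then have "q powr (\<alpha> / 2) \<le> q powr (2 * \<eta> * n)" unfolding Kp s_def n_def .
    then have "\<alpha> / 2 \<le> 2 * \<eta> * n" using q1 by simp
    moreover have "2 * \<eta> * n < 2 * \<eta> * (n + 3594)" using eta by (intro mult_strict_left_mono) auto
    moreover have "2 * \<eta> * (n + 3594) = \<alpha> / 2" using eta_n by linarith
    ultimately show False by linarith
  qed
  then show ?thesis using eta by blast
qed

text \<open>\<open>m\<close> is the larger of the exponents of s^2 / q and sqrt q; it lies below
  \<alpha> / 2 because 1 < \<alpha> < 2. With \<open>\<eta>\<close> half of the gap, s / K equals K
  * q powr m, whereas \<open>dense_regime\<close> allows at most 5 * q powr m: hence the 6.\<close>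

lemma dense_exponent:
  fixes \<alpha> :: real
  assumes a: "1 < \<alpha>" "\<alpha> < 2"
  shows "\<exists>\<eta>>0. \<forall>(F :: residue_family set) e P. anisotropic_field F e \<longrightarrow> P \<subseteq> F \<times> F \<longrightarrow>
    real (card P) = real (card F) powr \<alpha> \<longrightarrow> 6 \<le> real (card F) powr \<eta> \<longrightarrow>
    real (card F) powr (\<alpha> / 2 + \<eta>) \<le> real (card (sqdists P))"
proof -
  define m where "m = max (\<alpha> - 1) (1 / 2)"
  define \<eta> where "\<eta> = (\<alpha> / 2 - m) / 2"
  have m0: "0 \<le> m" by (simp add: m_def)
  have "m < \<alpha> / 2" using a unfolding m_def by linarith
  then have eta: "0 < \<eta>" by (simp add: \<eta>_def)
  have "real (card F) powr (\<alpha> / 2 + \<eta>) \<le> real (card (sqdists P))"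
    if F: "anisotropic_field F e" and PF: "P \<subseteq> F \<times> F" and cP: "real (card P) = real (card F) powr \<alpha>"
      and big: "6 \<le> real (card F) powr \<eta>" for F :: "residue_family set" and e P
  proof (rule ccontr)
    assume "\<not> ?thesis"
    then have small: "real (card (sqdists P)) < real (card F) powr (\<alpha> / 2 + \<eta>)" by simp
    interpret anisotropic_field F e by (rule F)
    define q where "q = real (card F)"
    have q1: "1 \<le> q" using e_F by (auto simp: q_def Suc_le_eq card_gt_0_iff)
    define s where "s = q powr (\<alpha> / 2)"
    define K where "K = q powr \<eta>"
    have K0: "0 < K" using q1 by (simp add: K_def)
    have s0: "0 < s" using q1 by (simp add: s_def)
    have s2: "s\<^sup>2 = q powr \<alpha>" using q1 by (simp add: s_def powr_power)
    have cP': "card P = s\<^sup>2" using cP by (simp add: s2 q_def)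
    have D: "card (sqdists P) \<le> K * s"
      using small by (simp add: K_def s_def q_def[symmetric] powr_add mult.commute)
    have le: "s / K \<le> 3 + s\<^sup>2 / q + sqrt q"
      unfolding q_def by (rule dense_regime[OF PF cP' s0 K0 D])
    have Q: "1 \<le> q powr m" using q1 m0 by (intro ge_one_powr_ge_zero) auto
    have "s\<^sup>2 / q = q powr (\<alpha> - 1)" using q1 by (simp add: s2 powr_diff)
    also have "\<dots> \<le> q powr m" using q1 by (intro powr_mono) (auto simp: m_def)
    finally have 1: "s\<^sup>2 / q \<le> q powr m" .
    have "sqrt q = q powr (1 / 2)" using q1 by (simp add: powr_half_sqrt)
    also have "\<dots> \<le> q powr m" using q1 by (intro powr_mono) (auto simp: m_def)
    finally have 2: "sqrt q \<le> q powr m" .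
    have "s / K = q powr (\<alpha> / 2 - \<eta>)" by (simp add: s_def K_def powr_diff)
    also have "\<alpha> / 2 - \<eta> = \<eta> + m" by (simp add: \<eta>_def field_simps)
    also have "q powr (\<eta> + m) = K * q powr m" by (simp add: K_def powr_add)
    finally have "K * q powr m \<le> 5 * q powr m" using le 1 2 Q by linarith
    moreover have "6 * q powr m \<le> K * q powr m" using big Q by (intro mult_right_mono) (auto simp: K_def q_def)
    ultimately show False using Q by linarith
  qed
  then show ?thesis using eta by blast
qed

theorem theorem7p1:
  fixes \<alpha> :: real
  assumes "0 < \<alpha>" and "\<alpha> < 2"
  shows "\<exists>\<epsilon> c :: real. \<epsilon> > 0 \<and> c > 0 \<and>
    (\<forall>(p::nat) (P :: (int \<times> int) set).
       prime p \<and> [p = 3] (mod 4) \<and>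
       P \<subseteq> carrier (residue_ring (int p)) \<times> carrier (residue_ring (int p)) \<and>
       real (card P) = real (card (carrier (residue_ring (int p)))) powr \<alpha> \<longrightarrow>
       real (card (distance_set (residue_ring (int p)) P)) \<ge> c * real (card P) powr (1/2 + \<epsilon>))"
proof -
  have "\<exists>\<eta>>0. \<forall>(F :: residue_family set) e P. anisotropic_field F e \<longrightarrow> P \<subseteq> F \<times> F \<longrightarrow>
    real (card P) = real (card F) powr \<alpha> \<longrightarrow> 6 \<le> real (card F) powr \<eta> \<longrightarrow>
    real (card F) powr (\<alpha> / 2 + \<eta>) \<le> real (card (sqdists P))"
  proof (cases "\<alpha> \<le> 1")
    case True
    with assms(1) show ?thesis by (rule sparse_exponent)
  next
    case False
    then have "1 < \<alpha>" by simp
    then show ?thesis using assms(2) by (rule dense_exponent)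
  qed
  then obtain \<eta> where eta: "0 < \<eta>" and key: "\<And>(F :: residue_family set) e P. anisotropic_field F e \<Longrightarrow> P \<subseteq> F \<times> F \<Longrightarrow>
    real (card P) = real (card F) powr \<alpha> \<Longrightarrow> 6 \<le> real (card F) powr \<eta> \<Longrightarrow>
    real (card F) powr (\<alpha> / 2 + \<eta>) \<le> real (card (sqdists P))"
    by metis
  \<comment> \<open>If q powr \<eta> < 6, then q powr (\<alpha> / 2 + \<eta>) < 6 powr t, so
    \<open>c\<close> takes care of the small primes, where a single distance suffices.\<close>
  define t where "t = (\<alpha> / 2 + \<eta>) / \<eta>"
  define c where "c = 1 / 6 powr t"
  have t0: "0 < t" using assms eta by (simp add: t_def)
  have c0: "0 < c" by (simp add: c_def)
  have c1: "c \<le> 1" using t0 by (simp add: c_def ge_one_powr_ge_zero)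
  have main: "c * real (card P) powr (1/2 + \<eta> / \<alpha>) \<le> real (card (distance_set (residue_ring (int p)) P))"
    if p: "prime p" and p3: "[p = 3] (mod 4)"
      and PR: "P \<subseteq> carrier (residue_ring (int p)) \<times> carrier (residue_ring (int p))"
      and cP: "real (card P) = real (card (carrier (residue_ring (int p)))) powr \<alpha>"
    for p :: nat and P :: "(int \<times> int) set"
  proof -
    have p0: "0 < p" using p by (rule prime_gt_0_nat)
    define R where "R = residue_ring (int p)"
    have carr: "carrier R = {0..int p - 1}" by (simp add: R_def residue_ring_def)
    define q where "q = real p"
    have q1: "1 \<le> q" using p0 by (simp add: q_def)
    have cP': "real (card P) = q powr \<alpha>" using cP by (simp add: carr q_def flip: R_def)
    have PRR: "P \<subseteq> {0..int p - 1} \<times> {0..int p - 1}" using PR by (simp add: carr flip: R_def)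
    then have finP: "finite P" by (rule finite_subset) simp
    have "distance_set R P = (\<lambda>(u, v). plane_dist R u v) ` (P \<times> P)" by (auto simp: distance_set_def)
    then have finD: "finite (distance_set R P)" using finP by simp
    \<comment> \<open>As \<open>card P\<close> is q powr \<alpha>, a gain \<eta> in the exponent of
      \<open>q\<close> is a gain \<eta> / \<alpha> in that of \<open>card P\<close>.\<close>
    have pw: "real (card P) powr (1/2 + \<eta> / \<alpha>) = q powr (\<alpha> / 2 + \<eta>)"
      unfolding cP' powr_powr using assms by (simp add: distrib_left)
    show ?thesis
    proof (cases "6 \<le> q powr \<eta>")
      case True
      define F where "F = range (embed p)"
      define P' where "P' = embed2 p ` P"
      have cF: "real (card F) = q" using p0 by (simp add: F_def q_def card_range_embed)
      have "inj_on (embed2 p) P"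
      proof (rule inj_onI)
        fix u v assume uv: "u \<in> P" "v \<in> P" "embed2 p u = embed2 p v"
        have "fst u \<in> {0..int p - 1}" "snd u \<in> {0..int p - 1}" "fst v \<in> {0..int p - 1}" "snd v \<in> {0..int p - 1}"
          using uv(1,2) PRR by auto
        moreover have "embed p (fst u) = embed p (fst v)" "embed p (snd u) = embed p (snd v)"
          using uv(3) by (simp_all add: embed2_def)
        ultimately show "u = v" using inj_onD[OF inj_on_embed] by (metis prod_eqI)
      qed
      then have "card P' = card P" by (simp add: P'_def card_image)
      then have "q powr (\<alpha> / 2 + \<eta>) \<le> real (card (sqdists P'))"
        using key[OF embed_field[OF p p3, folded F_def], of P'] True cP'
        by (simp add: cF) (auto simp: P'_def embed2_def F_def)
      \<comment> \<open>Inclusion in an image suffices, since a lower bound for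
        \<open>sqdists P'\<close> is carried back to the distance set.\<close>
      moreover have "sqdists P' \<subseteq> embed p ` distance_set R P"
      proof
        fix x assume "x \<in> sqdists P'"
        then obtain u v where uv: "u \<in> P" "v \<in> P" "x = sqdist (embed2 p u) (embed2 p v)"
          unfolding sqdists_def P'_def by blast
        then have "x = embed p (plane_dist R u v)" unfolding R_def using embed_plane_dist[OF p] by simp
        then show "x \<in> embed p ` distance_set R P" using uv unfolding distance_set_def by blast
      qed
      then have "card (sqdists P') \<le> card (distance_set R P)" using finD by (rule surj_card_le[rotated])
      ultimately have "q powr (\<alpha> / 2 + \<eta>) \<le> real (card (distance_set R P))" by linarith
      moreover have "c * q powr (\<alpha> / 2 + \<eta>) \<le> 1 * q powr (\<alpha> / 2 + \<eta>)" using c1 by (intro mult_right_mono) auto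
      ultimately show ?thesis unfolding pw R_def[symmetric] by linarith
    next
      case False
      have "q powr (\<alpha> / 2 + \<eta>) = (q powr \<eta>) powr t" using eta by (simp add: powr_powr t_def)
      also have "\<dots> \<le> 6 powr t" using False t0 by (intro powr_mono2) auto
      finally have "c * q powr (\<alpha> / 2 + \<eta>) \<le> c * 6 powr t" using c0 by (intro mult_left_mono) auto
      also have "\<dots> = 1" by (simp add: c_def)
      also have "1 \<le> real (card (distance_set R P))"
      proof -
        have "0 < real (card P)" using cP' q1 by simp
        then obtain u where "u \<in> P" by (auto simp: card_gt_0_iff)
        then have "plane_dist R u u \<in> distance_set R P" unfolding distance_set_def by blast
        then have "0 < card (distance_set R P)" using finD by (auto simp: card_gt_0_iff)
        then show ?thesis by simp
      qed
      finally show ?thesis unfolding pw R_def[symmetric] .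
    qed
  qed
  show ?thesis
  proof (rule exI[of _ "\<eta> / \<alpha>"], rule exI[of _ c], intro conjI allI impI)
    show "0 < \<eta> / \<alpha>" using eta assms by simp
    show "0 < c" by (rule c0)
  qed (elim conjE, rule main)
qed

end
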